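(* Let $n\ge 2$ and $1\le k<n$ be integers, and let $T\colon \mathbb{M}_n\to\mathbb{M}_n$ be a bijective (complex) linear map. The following conditions are equivalent. (a) $T$ preserves parallel pairs with respect to $w_k$, i.e. $T(A)\parallel T(B)$ whenever $A\parallel B$. (b) $T$ preserves TEA pairs with respect to $w_k$, i.e. $(T(A),T(B))$ is a TEA pair whenever $(A,B)$ is a TEA pair. (c) There exist a nonzero $\mu\in\mathbb{C}$ and a unitary $U\in\mathbb{M}_n$ such that either (c.1) $\mu T$ has the form $A\mapsto U^*AU$ or $A\mapsto U^*A^tU$; or (c.2) $n=2k>2$ and $\mu T$ has the form $A\mapsto \frac{1}{k}(\operatorname{tr}A)I-U^*AU$ or $A\mapsto \frac1k(\operatorname{tr}A)I-U^*A^tU$.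
   Context: $\mathbb{M}_n$ is the space of complex $n\times n$ matrices. For $A\in\mathbb{M}_n$ and $1\le k<n$, the $k$-numerical range is $W_k(A)=\{\operatorname{tr}(AP): P=P^*=P^2,\ \operatorname{tr}P=k\}$ and the $k$-numerical radius is $w_k(A)=\max\{|z|: z\in W_k(A)\}$; $w_k$ is a norm on $\mathbb{M}_n$. Two matrices $A,B$ are parallel, written $A\parallel B$, if $w_k(A+\mu B)=w_k(A)+w_k(B)$ for some $\mu\in\mathbb{C}$ with $|\mu|=1$; $(A,B)$ is a TEA (triangle equality attaining) pair if $w_k(A+B)=w_k(A)+w_k(B)$. $A^t$ denotes the transpose. *)

theory Defs
  imports "HOL-Analysis.Analysis"
begin

type_synonym 'n cmat = "complex ^ 'n ^ 'n"

definition mtrace :: "'n::finite cmat \<Rightarrow> complex" where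
  "mtrace A = (\<Sum>i\<in>UNIV. A $ i $ i)"

definition adj :: "'n::finite cmat \<Rightarrow> 'n cmat" where
  "adj A = (\<chi> i j. cnj (A $ j $ i))"

definition cscale :: "complex \<Rightarrow> 'n::finite cmat \<Rightarrow> 'n cmat" where
  "cscale c A = (\<chi> i j. c * A $ i $ j)"

definition unitary :: "'n::finite cmat \<Rightarrow> bool" where
  "unitary U \<longleftrightarrow> adj U ** U = mat 1 \<and> U ** adj U = mat 1"

definition is_proj :: "nat \<Rightarrow> 'n::finite cmat \<Rightarrow> bool" where
  "is_proj k P \<longleftrightarrow> P = adj P \<and> P ** P = P \<and> mtrace P = of_nat k"

definition kNR :: "nat \<Rightarrow> 'n::finite cmat \<Rightarrow> complex set" where
  "kNR k A = {mtrace (A ** P) | P. is_proj k P}"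

definition kradius :: "nat \<Rightarrow> 'n::finite cmat \<Rightarrow> real" where
  "kradius k A = Sup (cmod ` kNR k A)"

definition kparallel :: "nat \<Rightarrow> 'n::finite cmat \<Rightarrow> 'n cmat \<Rightarrow> bool" where
  "kparallel k A B \<longleftrightarrow> (\<exists>\<mu>. cmod \<mu> = 1 \<and>
      kradius k (A + cscale \<mu> B) = kradius k A + kradius k B)"

definition kTEA :: "nat \<Rightarrow> 'n::finite cmat \<Rightarrow> 'n cmat \<Rightarrow> bool" where
  "kTEA k A B \<longleftrightarrow> kradius k (A + B) = kradius k A + kradius k B"

definition clinear_map :: "('n::finite cmat \<Rightarrow> 'n cmat) \<Rightarrow> bool" where
  "clinear_map T \<longleftrightarrow> (\<forall>A B. T (A + B) = T A + T B) \<and> (\<forall>c A. T (cscale c A) = cscale c (T A))"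

end

(*
  A and B are parallel iff a common rank k projection P attains both |tr(AP)| = w_k(A) and
  |tr(BP)| = w_k(B).  Since I is the only matrix, up to scalars, parallel to all others, a parallelism
  preserver T may be normalised to T(I) = I.  For Hermitian H and large real s the projections attaining
  w_k(sI + H) are those maximising tr(HP), so shifting by sI turns parallelism into convex geometry on
  Hermitian matrices: T(H) is Hermitian up to an imaginary scalar, and first-order optimality for
  sI + P + iG shows that to every P there is a Q with tr(T(G)Q) = tr(GP) for all G.  Hence T preserves
  the Hermitian matrices and the function topsum(H) = max tr(HP).  Every Hermitian matrix spanning, modulo
  scalars, an extreme ray of a cone on which topsum is additive has the form a xx^* + bI, and xx^* or
  -xx^* is of this kind.  So T sends xx^* to some yy^* or, when n = 2k, to some I/k - yy^*; composing with
  A -> (tr A / k) I - A in the second case, T maps rank one projections to rank one projections, and such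
  maps are A -> U^*AU or A -> U^*A^tU.
*)

theory Submission
  imports Defs
begin

section \<open>Complex vectors and matrices\<close>

text \<open>Preservation is assumed in one direction only, and each use of it yields some projection
  attaining two radii at once, without saying which one. Perturbations that make the maximiser
  unique remove this ambiguity. Complex linearity rules out a skew part: a shift by sI tests the
  real part of a trace, and multiplying G by the imaginary unit moves the unwanted part of T(G) into
  that place. Rank one matrices come with two signs because extremality of \<open>outer x x\<close>
  is obtained from a second dimension in the range of a maximising projection, and that of
  \<open>- outer x x\<close> from one in its kernel; only n = 2 offers neither, and there every
  Hermitian matrix already has the required shape. The shift 1/k is forced by the values 1 and 0 of
  \<open>topsum\<close> at \<open>outer x x\<close> and \<open>- outer x x\<close>, and n = 2k by
  comparing traces at the identity. That (b) implies (a) comes from absorbing the phase into the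
  second matrix; (c) implies (b) because such maps multiply w_k by a constant.\<close>

definition cip :: "complex^'n::finite \<Rightarrow> complex^'n \<Rightarrow> complex" where
  "cip x y = (\<Sum>i\<in>UNIV. cnj (x $ i) * y $ i)"

definition outer :: "complex^'n::finite \<Rightarrow> complex^'n \<Rightarrow> 'n cmat" where
  "outer x y = (\<chi> i j. x $ i * cnj (y $ j))"

abbreviation smat :: "complex \<Rightarrow> 'n::finite cmat" where
  "smat z \<equiv> cscale z (mat 1)"

abbreviation herm :: "'n::finite cmat \<Rightarrow> bool" where
  "herm A \<equiv> adj A = A"

lemma cip_add_left: "cip (x + y) z = cip x z + cip y z"
  and cip_add_right: "cip z (x + y) = cip z x + cip z y"
  and cip_diff_left: "cip (x - y) z = cip x z - cip y z"
  and cip_diff_right: "cip z (x - y) = cip z x - cip z y"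
  and cip_scale_left: "cip (c *s x) y = cnj c * cip x y"
  and cip_scale_right: "cip x (c *s y) = c * cip x y"
  and cip_minus_left: "cip (- x) y = - cip x y"
  and cip_minus_right: "cip x (- y) = - cip x y"
  and cip_zero_left: "cip 0 y = 0"
  and cip_zero_right: "cip x 0 = 0"
  by (simp_all add: cip_def algebra_simps sum.distrib sum_subtractf sum_distrib_left sum_negf)

lemmas cip_simps = cip_add_left cip_add_right cip_diff_left cip_diff_right cip_scale_left
  cip_scale_right cip_minus_left cip_minus_right cip_zero_left cip_zero_right

lemma cip_commute: "cip y x = cnj (cip x y)"
  by (simp add: cip_def mult.commute)

lemma cip_self: "cip x x = of_real ((norm x)\<^sup>2)"
proof -
  have "(norm x)\<^sup>2 = (\<Sum>i\<in>UNIV. (cmod (x $ i))\<^sup>2)"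
    by (simp add: norm_vec_def L2_set_def sum_nonneg)
  thus ?thesis
    by (simp add: cip_def complex_norm_square mult.commute del: of_real_power)
qed

lemma cip_eq_0_iff: "cip x x = 0 \<longleftrightarrow> x = 0"
  by (simp add: cip_self)

lemma cip_adj: "cip x (A *v y) = cip (adj A *v x) y"
proof -
  have "cip x (A *v y) = (\<Sum>i\<in>UNIV. \<Sum>j\<in>UNIV. cnj (x $ i) * (A $ i $ j * y $ j))"
    by (simp add: cip_def matrix_vector_mult_def sum_distrib_left)
  also have "\<dots> = (\<Sum>j\<in>UNIV. \<Sum>i\<in>UNIV. cnj (x $ i) * (A $ i $ j * y $ j))"
    by (rule sum.swap)
  also have "\<dots> = cip (adj A *v x) y"
    by (simp add: cip_def matrix_vector_mult_def adj_def sum_distrib_left sum_distrib_right algebra_simps)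
  finally show ?thesis .
qed

lemma cip_axis: "cip (axis i 1) x = x $ i"
proof -
  have "cip (axis i 1) x = (\<Sum>j\<in>UNIV. if j = i then x $ j else 0)"
    unfolding cip_def by (rule sum.cong) (auto simp: axis_def)
  thus ?thesis by simp
qed

lemma eq_zero_if_cip: "(\<And>z. cip z x = 0) \<Longrightarrow> x = 0"
  using cip_eq_0_iff by blast

lemma adj_add: "adj (A + B) = adj A + adj B"
  and adj_diff: "adj (A - B) = adj A - adj B"
  and adj_minus: "adj (- A) = - adj A"
  and adj_cscale: "adj (cscale c A) = cscale (cnj c) (adj A)"
  and adj_scaleR: "adj (r *\<^sub>R A) = r *\<^sub>R adj A"
  and adj_adj: "adj (adj A) = A"
  and adj_outer: "adj (outer x y) = outer y x"
  and adj_mat: "adj (mat c) = mat (cnj c)"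
  by (auto simp: adj_def cscale_def outer_def vec_eq_iff mat_def)

lemma adj_mult: "adj (A ** B) = adj B ** adj A"
  by (simp add: adj_def matrix_matrix_mult_def vec_eq_iff mult.commute)

lemmas adj_simps = adj_add adj_diff adj_minus adj_cscale adj_scaleR adj_adj adj_outer adj_mat adj_mult

lemma cscale_add: "cscale c (A + B) = cscale c A + cscale c B"
  and cscale_diff: "cscale c (A - B) = cscale c A - cscale c B"
  and cscale_minus: "cscale c (- A) = - cscale c A"
  and cscale_cscale: "cscale c (cscale d A) = cscale (c * d) A"
  and cscale_one: "cscale 1 A = A"
  and cscale_zero: "cscale 0 A = 0"
  and cscale_uminus: "cscale (- c) A = - cscale c A"
  and cscale_plus: "cscale (c + d) A = cscale c A + cscale d A"
  and cscale_of_real: "cscale (of_real r) A = r *\<^sub>R A"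
  and cscale_scaleR: "cscale c (r *\<^sub>R A) = cscale (c * of_real r) A"
  by (auto simp: cscale_def vec_eq_iff algebra_simps scaleR_conv_of_real[where 'a=complex])

lemma cscale_mult_left: "cscale c A ** B = cscale c (A ** B)"
  and cscale_mult_right: "A ** cscale c B = cscale c (A ** B)"
  by (simp_all add: cscale_def matrix_matrix_mult_def vec_eq_iff sum_distrib_left algebra_simps)

lemma mmult_add_left: "((A::'n::finite cmat) + B) ** C = A ** C + B ** C"
  and mmult_add_right: "C ** ((A::'n::finite cmat) + B) = C ** A + C ** B"
  and mmult_diff_left: "((A::'n::finite cmat) - B) ** C = A ** C - B ** C"
  and mmult_diff_right: "C ** ((A::'n::finite cmat) - B) = C ** A - C ** B"
  and mmult_minus_left: "(- (A::'n::finite cmat)) ** C = - (A ** C)"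
  and mmult_minus_right: "C ** (- (A::'n::finite cmat)) = - (C ** A)"
  by (simp_all add: matrix_matrix_mult_def vec_eq_iff algebra_simps sum.distrib sum_subtractf sum_negf)

lemma mmult_zero_left: "(0::'n::finite cmat) ** C = 0"
  and mmult_zero_right: "C ** (0::'n::finite cmat) = 0"
  by (simp_all add: matrix_matrix_mult_def vec_eq_iff)

lemma mmult_scaleR_left: "(r *\<^sub>R (A::'n::finite cmat)) ** B = r *\<^sub>R (A ** (B::'n::finite cmat))"
  and mmult_scaleR_right: "(A::'n::finite cmat) ** (r *\<^sub>R B) = r *\<^sub>R (A ** (B::'n::finite cmat))"
  using cscale_mult_left[of "of_real r" A B] cscale_mult_right[of A "of_real r" B]
  by (simp_all only: cscale_of_real)

lemmas mmult_simps = mmult_add_left mmult_add_right mmult_diff_left mmult_diff_right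
  mmult_minus_left mmult_minus_right cscale_mult_left cscale_mult_right
  mmult_scaleR_left mmult_scaleR_right mmult_zero_left mmult_zero_right

lemma mtrace_add: "mtrace (A + B) = mtrace A + mtrace B"
  and mtrace_diff: "mtrace (A - B) = mtrace A - mtrace B"
  and mtrace_minus: "mtrace (- A) = - mtrace A"
  and mtrace_cscale: "mtrace (cscale c A) = c * mtrace A"
  and mtrace_scaleR: "mtrace (r *\<^sub>R A) = of_real r * mtrace A"
  and mtrace_adj: "mtrace (adj A) = cnj (mtrace A)"
  and mtrace_outer: "mtrace (outer x y) = cip y x"
  and mtrace_zero: "mtrace 0 = 0"
  by (simp_all add: mtrace_def cscale_def adj_def outer_def cip_def sum.distrib sum_subtractf
      sum_negf sum_distrib_left scaleR_conv_of_real[where 'a=complex] mult.commute)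

lemma mtrace_one: "mtrace (mat 1 :: 'n::finite cmat) = of_nat CARD('n)"
  by (simp add: mtrace_def mat_def)

lemmas mtrace_simps = mtrace_add mtrace_diff mtrace_minus mtrace_cscale mtrace_scaleR
  mtrace_adj mtrace_outer mtrace_one mtrace_zero

lemma mtrace_mult: "mtrace (A ** B) = (\<Sum>i\<in>UNIV. \<Sum>j\<in>UNIV. A $ i $ j * B $ j $ i)"
  by (simp add: mtrace_def matrix_matrix_mult_def)

lemma mtrace_mult_commute: "mtrace (A ** B) = mtrace (B ** A)"
  unfolding mtrace_mult by (subst sum.swap) (simp add: mult.commute)

lemma mult_outer: "A ** outer x y = outer (A *v x) y"
  by (simp add: outer_def matrix_matrix_mult_def matrix_vector_mult_def vec_eq_iff
      sum_distrib_right mult.assoc)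

lemma outer_mult: "outer x y ** A = outer x (adj A *v y)"
  by (simp add: outer_def adj_def matrix_matrix_mult_def matrix_vector_mult_def vec_eq_iff
      sum_distrib_left algebra_simps)

lemma outer_mv: "outer x y *v z = cip y z *s x"
  by (simp add: outer_def cip_def matrix_vector_mult_def vec_eq_iff sum_distrib_left sum_distrib_right
      algebra_simps)

lemma outer_add_left: "outer (x + y) z = outer x z + outer y z"
  and outer_add_right: "outer z (x + y) = outer z x + outer z y"
  and outer_scale_left: "outer (c *s x) y = cscale c (outer x y)"
  and outer_scale_right: "outer x (c *s y) = cscale (cnj c) (outer x y)"
  and outer_zero_left: "outer 0 y = 0"
  and outer_zero_right: "outer y 0 = 0"
  by (simp_all add: outer_def cscale_def vec_eq_iff algebra_simps)

lemmas outer_simps = outer_add_left outer_add_right outer_scale_left outer_scale_right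
  outer_zero_left outer_zero_right

lemma mtrace_mult_outer: "mtrace (A ** outer x y) = cip y (A *v x)"
  by (simp add: mult_outer mtrace_outer)

lemma mv_add: "((A::'n::finite cmat) + B) *v x = A *v x + B *v x"
  and mv_diff: "((A::'n::finite cmat) - B) *v x = A *v x - B *v x"
  and mv_minus: "(- (A::'n::finite cmat)) *v x = - (A *v x)"
  and mv_cscale: "cscale c A *v x = c *s (A *v x)"
  and mv_scaleR: "(r *\<^sub>R (A::'n::finite cmat)) *v x = of_real r *s (A *v x)"
  and mv_scale: "(A::'n::finite cmat) *v (c *s x) = c *s (A *v x)"
  and mv_vdiff: "(A::'n::finite cmat) *v (x - y) = A *v x - A *v y"
  and mv_uminus: "(A::'n::finite cmat) *v (- x) = - (A *v x)"
  by (simp_all add: matrix_vector_mult_def cscale_def vec_eq_iff algebra_simps sum.distrib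
      sum_subtractf sum_negf sum_distrib_left scaleR_conv_of_real[where 'a=complex])

lemmas mv_simps = mv_add mv_diff mv_minus mv_cscale mv_scaleR mv_scale mv_uminus
  matrix_vector_right_distrib mv_vdiff outer_mv

lemma mv_assoc: "(A ** B) *v x = A *v (B *v (x::complex^'n::finite))"
  by (simp add: matrix_vector_mul_assoc)

lemma mat_eq_iff_mv: "(A::'n::finite cmat) = B \<longleftrightarrow> (\<forall>x. A *v x = B *v x)"
  by (metis matrix_eq)

text \<open>The real inner product of matrices is Re tr(A adj(B)), so a Hermitian second factor
  turns it into the trace form. This makes Cauchy-Schwarz and Riesz representation available for
  traces against projections.\<close>

lemma inner_herm:
  fixes A B :: "'n::finite cmat"
  assumes "herm B"
  shows "Re (mtrace (A ** B)) = A \<bullet> B"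
proof -
  have b: "B $ j $ i = cnj (B $ i $ j)" for i j
    using assms by (metis (no_types, lifting) adj_def vec_lambda_beta)
  show ?thesis
    unfolding mtrace_mult inner_vec_def Re_sum
    by (subst b) (simp add: inner_complex_def)
qed

lemma mtrace_herm:
  fixes A B :: "'n::finite cmat"
  assumes "herm A" "herm B"
  shows "mtrace (A ** B) = of_real (A \<bullet> B)"
proof -
  have "cnj (mtrace (A ** B)) = mtrace (A ** B)"
    using assms by (metis adj_mult mtrace_adj mtrace_mult_commute)
  hence "mtrace (A ** B) \<in> \<real>" by (simp add: Reals_cnj_iff)
  thus ?thesis using inner_herm[OF assms(2), of A] by (metis of_real_Re)
qed

lemma cip_herm_real: "herm A \<Longrightarrow> cip x (A *v x) = of_real (Re (cip x (A *v x)))"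
  by (metis cip_adj cip_commute Reals_cnj_iff of_real_Re)

section \<open>Cartesian decomposition into Hermitian real and imaginary parts\<close>

definition hre :: "'n::finite cmat \<Rightarrow> 'n cmat" where
  "hre A = (1/2) *\<^sub>R (A + adj A)"

definition him :: "'n::finite cmat \<Rightarrow> 'n cmat" where
  "him A = cscale (- \<i> / 2) (A - adj A)"

lemma herm_hre: "herm (hre A)"
  by (simp add: hre_def adj_simps add.commute)

lemma herm_him: "herm (him A)"
  by (simp add: him_def adj_simps cscale_diff cscale_uminus)

lemma hre_him: "A = hre A + cscale \<i> (him A)"
  by (simp add: hre_def him_def adj_def cscale_def vec_eq_iff scaleR_conv_of_real[where 'a=complex] field_simps)

lemma herm_combo:
  assumes "herm H" "herm G" 
  shows "hre (H + cscale \<i> G) = H" "him (H + cscale \<i> G) = G"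
  using assms
  by (auto simp: hre_def him_def adj_simps cscale_diff cscale_uminus cscale_add cscale_cscale
      vec_eq_iff scaleR_conv_of_real[where 'a=complex]) (auto simp: cscale_def)

section \<open>Projections and the k-numerical radius\<close>

lemma mv_axis: "(A *v axis i (1::complex)) $ j = A $ j $ i"
proof -
  have "(A *v axis i (1::complex)) $ j = (\<Sum>l\<in>UNIV. if l = i then A $ j $ l else 0)"
    unfolding matrix_vector_mult_def vec_lambda_beta by (rule sum.cong) (auto simp: axis_def)
  thus ?thesis by simp
qed

lemma mtrace_cip: "mtrace A = (\<Sum>i\<in>UNIV. cip (axis i 1) (A *v axis i 1))"
  by (simp add: mtrace_def cip_axis mv_axis)

lemma is_projD:
  assumes "is_proj k P"
  shows "herm P" "P ** P = P" "mtrace P = of_nat k"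
  using assms by (auto simp: is_proj_def)

lemma is_projI: "herm P \<Longrightarrow> P ** P = P \<Longrightarrow> mtrace P = of_nat k \<Longrightarrow> is_proj k P"
  by (auto simp: is_proj_def)

lemma proj_mv_idem: "is_proj k P \<Longrightarrow> P *v (P *v x) = P *v x"
  by (metis is_projD(2) mv_assoc)

lemma proj_compl:
  fixes P :: "'n::finite cmat"
  assumes "is_proj k P" "k \<le> CARD('n)"
  shows "is_proj (CARD('n) - k) (mat 1 - P)"
  using is_projD[OF assms(1)] assms(2)
  by (intro is_projI) (simp_all add: adj_simps mmult_simps mtrace_simps of_nat_diff)

lemma proj_inner_self: "is_proj k P \<Longrightarrow> P \<bullet> P = real k"
  using mtrace_herm[of P P] is_projD[of k P] by (metis of_real_eq_iff of_real_of_nat_eq)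

lemma proj_norm: "is_proj k P \<Longrightarrow> norm P = sqrt (real k)"
  using proj_inner_self[of k P] by (simp add: norm_eq_sqrt_inner)

lemma cip_proj: "is_proj k P \<Longrightarrow> cip x (P *v x) = of_real ((norm (P *v x))\<^sup>2)"
  by (metis cip_adj cip_self is_projD(1) proj_mv_idem)

lemma cip_proj_swap: "is_proj k P \<Longrightarrow> cip x (P *v y) = cip (P *v x) y"
  by (metis cip_adj is_projD(1))

lemma cip_normalize:
  assumes "x \<noteq> (0::complex^'n::finite)"
  shows "norm (of_real (1 / norm x) *s x) = 1"
proof -
  have "of_real (1 / norm x) *s x = (1 / norm x) *\<^sub>R x"
    by (simp add: vec_eq_iff scaleR_conv_of_real[where 'a=complex])
  thus ?thesis using assms by simp
qed

lemma ex_unit_fixed: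
  assumes "herm P" "P ** P = P" "P \<noteq> 0"
  shows "\<exists>u. norm u = 1 \<and> P *v u = u"
proof -
  obtain x where x: "P *v x \<noteq> 0"
    using assms(3) mat_eq_iff_mv[of P 0] by auto
  define u where "u = of_real (1 / norm (P *v x)) *s (P *v x)"
  have "norm u = 1" unfolding u_def by (rule cip_normalize[OF x])
  moreover have "P *v u = u" unfolding u_def mv_scale using assms(2) mv_assoc by metis
  ultimately show ?thesis by blast
qed

lemma proj_ran:
  assumes "is_proj k P" "1 \<le> k"
  shows "\<exists>u. norm u = 1 \<and> P *v u = u"
  using ex_unit_fixed[OF is_projD(1,2)[OF assms(1)]] is_projD(3)[OF assms(1)] assms(2)
  by (cases "P = 0") (auto simp: mtrace_simps)

lemma proj_ker:
  fixes P :: "'n::finite cmat"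
  assumes "is_proj k P" "k < CARD('n)"
  shows "\<exists>u. norm u = 1 \<and> P *v u = 0"
proof -
  have "1 \<le> CARD('n) - k" "k \<le> CARD('n)" using assms(2) by auto
  then obtain u where u: "norm u = 1" "(mat 1 - P) *v u = u"
    using proj_ran[OF proj_compl[OF assms(1)]] by metis
  from u(2) have "P *v u = 0" by (simp add: mv_simps)
  with u(1) show ?thesis by blast
qed

lemma inner_outer: "herm H \<Longrightarrow> H \<bullet> outer x x = Re (cip x (H *v x))"
  using inner_herm[of "outer x x" H] by (simp add: adj_simps mtrace_mult_outer)

lemma inner_one: "herm P \<Longrightarrow> mat 1 \<bullet> P = Re (mtrace P)"
  using inner_herm[of P "mat 1"] by simp

lemma inner_one_proj: "is_proj k P \<Longrightarrow> mat 1 \<bullet> P = real k"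
  by (simp add: inner_one is_projD)

text \<open>tr(KR) = tr(RKR), and the diagonal entries of RKR are values of the form of K at the
  vectors R e_i.\<close>

lemma psd_inner_proj:
  assumes psd: "\<And>z. 0 \<le> Re (cip z (K *v z))" and R: "is_proj k R"
  shows "0 \<le> K \<bullet> R"
proof -
  have "mtrace (K ** R) = mtrace (R ** K ** R)"
    using mtrace_mult_commute[of "R ** K" R] mtrace_mult_commute[of R K] is_projD(2)[OF R]
    by (simp add: matrix_mul_assoc)
  also have "\<dots> = (\<Sum>i\<in>UNIV. cip (R *v axis i 1) (K *v (R *v axis i 1)))"
    unfolding mtrace_cip mv_assoc cip_proj_swap[OF R] ..
  finally have "Re (mtrace (K ** R)) \<ge> 0" by (simp add: psd sum_nonneg)
  thus ?thesis using inner_herm is_projD(1)[OF R] by metis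
qed

section \<open>Exchanging and rotating vectors between range and kernel\<close>

lemma proj_add:
  assumes "is_proj m E" "E *v x = 0" "norm x = 1"
  shows "is_proj (Suc m) (E + outer x x)"
  using is_projD[OF assms(1)] assms
  by (intro is_projI) (simp_all add: adj_simps mmult_simps mtrace_simps mult_outer outer_mult
      outer_simps outer_mv cip_self mv_simps)

lemma proj_sub:
  assumes "is_proj (Suc m) Q" "Q *v u = u" "norm u = 1"
  shows "is_proj m (Q - outer u u)"
  using is_projD[OF assms(1)] assms
  by (intro is_projI) (simp_all add: adj_simps mmult_simps mtrace_simps mult_outer outer_mult
      outer_simps outer_mv cip_self mv_simps)

lemma proj_orth:
  assumes "is_proj k Q" "Q *v u = u" "Q *v v = 0"
  shows "cip u v = 0" "cip v u = 0"
  using cip_proj_swap[OF assms(1), of u v] cip_proj_swap[OF assms(1), of v u] assms(2,3)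
  by (simp_all add: cip_simps)

text \<open>Removing u leaves a projection of rank k - 1 that kills both u and v, hence x; adding
  the unit vector x restores the rank.\<close>

lemma proj_rot:
  assumes Q: "is_proj k Q" and u: "Q *v u = u" "norm u = 1" and v: "Q *v v = 0" "norm v = 1"
    and ab: "(cmod \<alpha>)\<^sup>2 + (cmod \<beta>)\<^sup>2 = 1"
  defines "x \<equiv> \<alpha> *s u + \<beta> *s v"
  shows "is_proj k (Q - outer u u + outer x x)"
proof -
  have "k \<noteq> 0"
  proof
    assume "k = 0"
    hence "Q = 0" using proj_norm[OF Q] by simp
    thus False using u by simp
  qed
  then obtain m where k: "k = Suc m" using not0_implies_Suc by blast
  have "cip u u = 1" "cip v v = 1" using u v by (simp_all add: cip_self)
  hence "cip x x = of_real ((cmod \<alpha>)\<^sup>2 + (cmod \<beta>)\<^sup>2)"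
    unfolding x_def of_real_add complex_norm_square
    using proj_orth[OF Q u(1) v(1)] by (simp add: cip_simps mult.commute)
  hence "(norm x)\<^sup>2 = 1" using ab unfolding cip_self of_real_eq_iff by simp
  hence "norm x = 1" by (simp add: power2_eq_1_iff) (metis norm_ge_zero not_one_le_zero neg_0_le_iff_le)
  moreover have "(Q - outer u u) *v x = 0"
    using proj_orth[OF Q u(1) v(1)] u v by (simp add: x_def mv_simps cip_simps cip_self vec_eq_iff)
  ultimately show ?thesis
    using proj_add[OF proj_sub[OF Q[unfolded k] u]] k by simp
qed

lemma proj_swap:
  assumes "is_proj k Q" "Q *v u = u" "norm u = 1" "Q *v v = 0" "norm v = 1"
  shows "is_proj k (Q - outer u u + outer v v)"
  using proj_rot[OF assms, of 0 1] by simp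

text \<open>A plain expansion in the plane of u and v. Real angles will give the first-order
  condition; equal weights with varying phase will isolate the off-diagonal entries.\<close>

lemma rot_value:
  fixes A :: "'n::finite cmat" and u v :: "complex^'n" and \<alpha> \<beta> :: complex
  defines "x \<equiv> \<alpha> *s u + \<beta> *s v"
  shows "mtrace (A ** (Q - outer u u + outer x x)) = mtrace (A ** Q) 
     + (of_real ((cmod \<alpha>)\<^sup>2) - 1) * cip u (A *v u) + of_real ((cmod \<beta>)\<^sup>2) * cip v (A *v v)
     + cnj \<alpha> * \<beta> * cip u (A *v v) + \<alpha> * cnj \<beta> * cip v (A *v u)"
  by (simp add: mmult_simps mtrace_simps mtrace_mult_outer x_def mv_simps cip_simps
      complex_norm_square algebra_simps del: of_real_power)

definition diagproj :: "'n set \<Rightarrow> 'n::finite cmat" where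
  "diagproj S = (\<chi> i j. if i = j \<and> i \<in> S then 1 else 0)"

lemma diagproj_mv: "(diagproj S *v x) $ i = (if i \<in> S then x $ i else 0)"
proof -
  have "(diagproj S *v x) $ i = (\<Sum>j\<in>UNIV. if j = i then (if i \<in> S then x $ i else 0) else 0)"
    unfolding matrix_vector_mult_def diagproj_def vec_lambda_beta by (rule sum.cong) auto
  thus ?thesis by simp
qed

lemma is_proj_diagproj: "is_proj (card S) (diagproj S)"
proof (rule is_projI)
  show "herm (diagproj S)" by (auto simp: adj_def diagproj_def vec_eq_iff)
  show "diagproj S ** diagproj S = diagproj S"
    unfolding mat_eq_iff_mv mv_assoc by (simp add: vec_eq_iff diagproj_mv)
  have "mtrace (diagproj S) = (\<Sum>i\<in>UNIV. if i \<in> S then 1 else 0)"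
    by (simp add: mtrace_def diagproj_def)
  also have "\<dots> = (\<Sum>i\<in>S. 1)" by (simp add: sum.If_cases)
  finally show "mtrace (diagproj S) = of_nat (card S)" by simp
qed

lemma diagproj_axis: "diagproj S *v axis i 1 = (if i \<in> S then axis i 1 else 0)"
  by (auto simp: vec_eq_iff diagproj_mv axis_def)

text \<open>Rotating e_i towards e_j exposes the entries of a matrix at i and j; this requires a
  starting projection that contains the one and kills the other.\<close>

lemma ex_diagproj:
  fixes i j :: "'n::finite"
  assumes "1 \<le> k" "k < CARD('n)" "i \<noteq> j"
  shows "\<exists>S. card S = k \<and> i \<in> S \<and> j \<notin> S"
proof -
  have "card (UNIV - {i,j}) = CARD('n) - 2" using assms(3) by (simp add: card_Diff_subset)
  hence "k - 1 \<le> card (UNIV - {i,j})" using assms by simp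
  then obtain S where "S \<subseteq> UNIV - {i,j}" "card S = k - 1"
    by (meson obtain_subset_with_card_n)
  moreover have "finite S" by simp
  ultimately have "card (insert i S) = k" "i \<in> insert i S" "j \<notin> insert i S"
    using assms by (auto simp: card_insert_if)
  thus ?thesis by blast
qed

lemma ex_proj:
  assumes "1 \<le> k" "k < CARD('n::finite)"
  shows "\<exists>P::'n cmat. is_proj k P"
proof -
  obtain S :: "'n set" where "card S = k"
    using obtain_subset_with_card_n[of k "UNIV::'n set"] assms by auto
  thus ?thesis using is_proj_diagproj by blast
qed

section \<open>Compactness and attainment of the radius\<close>

lemma compact_proj: "compact {R::'n::finite cmat. is_proj k R}"
proof -
  have "closed {R::'n cmat. is_proj k R}"
    unfolding is_proj_def vec_eq_iff adj_def matrix_matrix_mult_def mtrace_def vec_lambda_beta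
    by (intro closed_Collect_conj closed_Collect_all closed_Collect_eq continuous_intros)
  moreover have "bounded {R::'n cmat. is_proj k R}"
    by (rule boundedI[of _ "sqrt (real k)"]) (simp add: proj_norm)
  ultimately show ?thesis by (simp add: compact_eq_bounded_closed)
qed

lemma continuous_mtrace: "continuous_on S (\<lambda>R. mtrace (A ** (R::'n::finite cmat)))"
  unfolding mtrace_mult by (intro continuous_intros)

text \<open>Phrased as a comparison between projections, so that maximality arguments avoid the
  supremum in \<open>kradius\<close>; \<open>att_kradius\<close> links the two.\<close>

definition att :: "nat \<Rightarrow> 'n::finite cmat \<Rightarrow> 'n cmat \<Rightarrow> bool" where
  "att k A R \<longleftrightarrow> is_proj k R \<and> (\<forall>R'. is_proj k R' \<longrightarrow> cmod (mtrace (A ** R')) \<le> cmod (mtrace (A ** R)))"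

lemma att_ex:
  assumes "1 \<le> k" "k < CARD('n::finite)"
  shows "\<exists>R. att k (A::'n cmat) R"
proof -
  have "\<exists>x\<in>{R. is_proj k R}. \<forall>y\<in>{R. is_proj k R}. cmod (mtrace (A ** y)) \<le> cmod (mtrace (A ** x))"
    using ex_proj[OF assms]
    by (intro continuous_attains_sup compact_proj continuous_on_norm continuous_mtrace) auto
  thus ?thesis by (auto simp: att_def)
qed

lemma att_kradius: "att k A R \<Longrightarrow> kradius k A = cmod (mtrace (A ** R))"
  unfolding kradius_def kNR_def
  by (intro cSup_eq_maximum) (auto simp: att_def)

lemma le_kradius:
  assumes "1 \<le> k" "k < CARD('n::finite)" "is_proj k R"
  shows "cmod (mtrace (A ** R)) \<le> kradius k (A::'n cmat)"
  using att_ex[OF assms(1,2), of A] att_kradius assms(3) by (metis att_def)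

lemma att_iff:
  assumes "1 \<le> k" "k < CARD('n::finite)"
  shows "att k (A::'n cmat) R \<longleftrightarrow> is_proj k R \<and> cmod (mtrace (A ** R)) = kradius k A"
  using att_kradius le_kradius[OF assms, of _ A] by (metis att_def)

lemma ex_phase: "\<exists>\<mu>. cmod \<mu> = 1 \<and> cmod (a + \<mu> * b) = cmod a + cmod b"
proof (cases "a = 0 \<or> b = 0")
  case True
  thus ?thesis by (intro exI[of _ 1]) auto
next
  case False
  define \<mu> where "\<mu> = sgn a / sgn b"
  have "cmod \<mu> = 1" using False by (simp add: \<mu>_def norm_divide norm_sgn)
  moreover have "a + \<mu> * b = sgn a * of_real (cmod a + cmod b)"
    using False by (simp add: \<mu>_def sgn_div_norm scaleR_conv_of_real field_simps)
  hence "cmod (a + \<mu> * b) = cmod a + cmod b"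
    using False by (simp add: norm_mult norm_sgn del: of_real_add)
  ultimately show ?thesis by blast
qed

text \<open>At a maximiser of A + mu B the triangle inequality must be an equality in both summands.
  Conversely, at a common maximiser a phase aligning the two traces attains the sum of the radii,
  which is also an upper bound.\<close>

lemma kparallel_iff:
  fixes A B :: "'n::finite cmat"
  assumes k: "1 \<le> k" "k < CARD('n)"
  shows "kparallel k A B \<longleftrightarrow> (\<exists>R. att k A R \<and> att k B R)"
proof
  assume "kparallel k A B"
  then obtain \<mu> where mu: "cmod \<mu> = 1" "kradius k (A + cscale \<mu> B) = kradius k A + kradius k B"
    by (auto simp: kparallel_def)
  obtain R where R: "att k (A + cscale \<mu> B) R" using att_ex[OF k] by blast
  hence pR: "is_proj k R" by (simp add: att_def)
  have "kradius k A + kradius k B = cmod (mtrace (A ** R) + \<mu> * mtrace (B ** R))"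
    using att_kradius[OF R] mu by (simp add: mmult_simps mtrace_simps)
  also have "\<dots> \<le> cmod (mtrace (A ** R)) + cmod (mtrace (B ** R))"
    by (rule order_trans[OF norm_triangle_ineq]) (simp add: norm_mult mu)
  finally have "cmod (mtrace (A ** R)) = kradius k A" "cmod (mtrace (B ** R)) = kradius k B"
    using le_kradius[OF k pR, of A] le_kradius[OF k pR, of B] by linarith+
  thus "\<exists>R. att k A R \<and> att k B R" using att_iff[OF k] pR by blast
next
  assume "\<exists>R. att k A R \<and> att k B R"
  then obtain R where R: "att k A R" "att k B R" by blast
  hence pR: "is_proj k R" by (simp add: att_def)
  obtain \<mu> where mu: "cmod \<mu> = 1" "cmod (mtrace (A ** R) + \<mu> * mtrace (B ** R)) = kradius k A + kradius k B"
    using ex_phase att_kradius R by metis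
  have "kradius k (A + cscale \<mu> B) \<ge> kradius k A + kradius k B"
    using le_kradius[OF k pR, of "A + cscale \<mu> B"] mu(2) by (simp add: mmult_simps mtrace_simps)
  moreover have "kradius k (A + cscale \<mu> B) \<le> kradius k A + kradius k B"
  proof -
    obtain R' where R': "att k (A + cscale \<mu> B) R'" using att_ex[OF k] by blast
    hence pR': "is_proj k R'" by (simp add: att_def)
    have "kradius k (A + cscale \<mu> B) = cmod (mtrace (A ** R') + \<mu> * mtrace (B ** R'))"
      using att_kradius[OF R'] by (simp add: mmult_simps mtrace_simps)
    also have "\<dots> \<le> cmod (mtrace (A ** R')) + cmod (mtrace (B ** R'))"
      by (rule order_trans[OF norm_triangle_ineq]) (simp add: norm_mult mu)
    also have "\<dots> \<le> kradius k A + kradius k B"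
      by (intro add_mono le_kradius[OF k pR'])
    finally show ?thesis .
  qed
  ultimately show "kparallel k A B" using mu(1) by (force simp: kparallel_def)
qed

text \<open>The derivative at t = 0 of the squared modulus is 2 Re(cnj w * g). Only t > 0 is used,
  hence an inequality.\<close>

lemma stationary_aux:
  fixes w p g :: complex
  assumes "\<And>t. cmod (w + of_real ((sin t)\<^sup>2) * p + of_real (sin t * cos t) * g) \<le> cmod w"
  shows "Re (cnj w * g) \<le> 0"
proof -
  have *: "sin t * Re (cnj w * p) + cos t * Re (cnj w * g) \<le> 0" if t: "0 < t" "t < 1" for t
  proof -
    have st: "sin t > 0" using t pi_gt3 by (intro sin_gt_zero) auto
    \<comment> \<open>The perturbation is sin t times d, so one factor sin t can be cancelled before
      the limit is taken.\<close>
    define d where "d = of_real (sin t) * p + of_real (cos t) * g"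
    have "(cmod (w + of_real (sin t) * d))\<^sup>2 \<le> (cmod w)\<^sup>2"
      using assms[of t] by (intro power_mono) (simp_all add: d_def power2_eq_square algebra_simps)
    moreover have "(cmod (w + of_real (sin t) * d))\<^sup>2 = (cmod w)\<^sup>2 + 2 * sin t * Re (cnj w * d) + (sin t)\<^sup>2 * (cmod d)\<^sup>2"
      unfolding cmod_power2 by (simp add: power2_eq_square algebra_simps)
    ultimately have "sin t * Re (cnj w * d) \<le> 0"
      using mult_nonneg_nonneg[OF zero_le_power2[of "sin t"] zero_le_power2[of "cmod d"]] by linarith
    hence "Re (cnj w * d) \<le> 0" using st by (simp add: mult_le_0_iff)
    thus ?thesis by (simp add: d_def algebra_simps)
  qed
  have "((\<lambda>t. sin t * Re (cnj w * p) + cos t * Re (cnj w * g)) \<longlongrightarrow> sin 0 * Re (cnj w * p) + cos 0 * Re (cnj w * g)) (at_right 0)"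
    by (intro tendsto_intros)
  moreover have "eventually (\<lambda>t. sin t * Re (cnj w * p) + cos t * Re (cnj w * g) \<le> 0) (at_right (0::real))"
    using * eventually_at_right_less[of 0] by (auto simp: eventually_at_right_field intro!: exI[of _ 1])
  ultimately show ?thesis
    using tendsto_upperbound[OF _ _ trivial_limit_at_right_real] by fastforce
qed

text \<open>First-order optimality along the circle of projections obtained by rotating u towards v.\<close>

lemma att_stationary:
  assumes A: "att k A Q" and u: "Q *v u = u" "norm u = 1" and v: "Q *v v = 0" "norm v = 1"
  shows "Re (cnj (mtrace (A ** Q)) * (cip u (A *v v) + cip v (A *v u))) = 0"
proof -
  have *: "Re (cnj (mtrace (A ** Q)) * (cip u (A *v v) + cip v (A *v u))) \<le> 0"
    if v: "Q *v v = 0" "norm v = 1" for v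
  proof (rule stationary_aux[where p = "cip v (A *v v) - cip u (A *v u)"])
    fix t
    have Q: "is_proj k Q" using A by (simp add: att_def)
    have e: "(cmod (of_real (cos t)))\<^sup>2 + (cmod (of_real (sin t)))\<^sup>2 = 1" by simp
    have "mtrace (A ** Q) + of_real ((sin t)\<^sup>2) * (cip v (A *v v) - cip u (A *v u))
        + of_real (sin t * cos t) * (cip u (A *v v) + cip v (A *v u))
      = mtrace (A ** (Q - outer u u + outer (of_real (cos t) *s u + of_real (sin t) *s v) (of_real (cos t) *s u + of_real (sin t) *s v)))"
      unfolding rot_value by (simp add: cos_squared_eq algebra_simps)
    thus "cmod (mtrace (A ** Q) + of_real ((sin t)\<^sup>2) * (cip v (A *v v) - cip u (A *v u))
        + of_real (sin t * cos t) * (cip u (A *v v) + cip v (A *v u))) \<le> cmod (mtrace (A ** Q))"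
      using A proj_rot[OF Q u v e] unfolding att_def by metis
  qed
  \<comment> \<open>Reversing v reverses the sign of the first-order term, which turns the
    inequality into an equality.\<close>
  show ?thesis
    using *[OF v] *[of "- v"] v by (simp add: mv_simps cip_simps algebra_simps)
qed

lemma norm_vscale: "norm (c *s x) = cmod c * norm (x :: complex^'n::finite)"
proof -
  have "complex_of_real ((norm (c *s x))\<^sup>2) = of_real ((cmod c * norm x)\<^sup>2)"
    unfolding power_mult_distrib of_real_mult cip_self[symmetric] complex_norm_square
    by (simp add: cip_simps)
  hence "(norm (c *s x))\<^sup>2 = (cmod c * norm x)\<^sup>2" using of_real_eq_iff by blast
  thus ?thesis by (simp add: power2_eq_iff_nonneg)
qed

lemma norm_axis: "norm (axis i (1::complex)) = 1"
proof -
  have "complex_of_real ((norm (axis i (1::complex)))\<^sup>2) = of_real 1"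
    unfolding cip_self[symmetric] cip_axis by (simp add: axis_def)
  hence "(norm (axis i (1::complex)))\<^sup>2 = 1" using of_real_eq_iff by blast
  thus ?thesis by (metis norm_ge_zero one_power2 power2_eq_iff_nonneg zero_le_one)
qed

lemma inner_adj: "adj A \<bullet> adj B = A \<bullet> (B::'n::finite cmat)"
proof -
  have "adj A \<bullet> adj B = (\<Sum>i\<in>UNIV. \<Sum>j\<in>UNIV. A $ j $ i \<bullet> B $ j $ i)"
    by (simp add: inner_vec_def adj_def inner_complex_def)
  also have "\<dots> = A \<bullet> B"
    unfolding inner_vec_def by (rule sum.swap)
  finally show ?thesis .
qed

lemma herm_one: "herm (mat 1 :: 'n::finite cmat)"
  by (simp add: adj_simps)

section \<open>Sums of the largest eigenvalues\<close>

definition topproj :: "nat \<Rightarrow> 'n::finite cmat \<Rightarrow> 'n cmat \<Rightarrow> bool" where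
  "topproj k H R \<longleftrightarrow> is_proj k R \<and> (\<forall>R'. is_proj k R' \<longrightarrow> H \<bullet> R' \<le> H \<bullet> R)"

text \<open>By Ky Fan's maximum principle this is the sum of the k largest eigenvalues of a
  Hermitian H. The variational form makes it convex at sight and avoids diagonalisation.\<close>

definition topsum :: "nat \<Rightarrow> 'n::finite cmat \<Rightarrow> real" where
  "topsum k H = Sup ((\<lambda>R. H \<bullet> R) ` {R. is_proj k R})"

lemma topproj_ex:
  assumes "1 \<le> k" "k < CARD('n::finite)"
  shows "\<exists>R. topproj k (H::'n cmat) R"
proof -
  have "\<exists>x\<in>{R. is_proj k R}. \<forall>y\<in>{R. is_proj k R}. H \<bullet> y \<le> H \<bullet> x"
    using ex_proj[OF assms]
    by (intro continuous_attains_sup compact_proj continuous_intros) auto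
  thus ?thesis by (auto simp: topproj_def)
qed

lemma topproj_topsum: "topproj k H R \<Longrightarrow> topsum k H = H \<bullet> R"
  unfolding topsum_def by (intro cSup_eq_maximum) (auto simp: topproj_def)

lemma le_topsum:
  assumes "1 \<le> k" "k < CARD('n::finite)" "is_proj k R"
  shows "H \<bullet> R \<le> topsum k (H::'n cmat)"
  using topproj_ex[OF assms(1,2), of H] topproj_topsum assms(3) by (metis topproj_def)

lemma topproj_iff:
  assumes "1 \<le> k" "k < CARD('n::finite)"
  shows "topproj k (H::'n cmat) R \<longleftrightarrow> is_proj k R \<and> H \<bullet> R = topsum k H"
  using topproj_topsum le_topsum[OF assms, of _ H] by (metis topproj_def)

lemma inner_le_kradius:
  assumes "1 \<le> k" "k < CARD('n::finite)" "is_proj k R" "herm H"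
  shows "\<bar>H \<bullet> R\<bar> \<le> kradius k (H::'n cmat)"
  using le_kradius[OF assms(1-3), of H] mtrace_herm[OF assms(4) is_projD(1)[OF assms(3)]]
  by simp

lemma mtrace_shift:
  assumes "is_proj k R" "herm H" "herm G"
  shows "mtrace ((H + cscale \<i> G) ** R) = Complex (H \<bullet> R) (G \<bullet> R)"
  using mtrace_herm[OF assms(2) is_projD(1)[OF assms(1)]] mtrace_herm[OF assms(3) is_projD(1)[OF assms(1)]]
  by (simp add: mmult_simps mtrace_simps complex_eq_iff)

text \<open>For such r all real parts r k + H . R are nonnegative, and the imaginary part c k is the
  same at every projection; so the modulus grows with H . R.\<close>

lemma att_shift:
  fixes H :: "'n::finite cmat"
  assumes k: "1 \<le> k" "k < CARD('n)" and H: "herm H" and r: "kradius k H \<le> r * real k"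
  shows "att k (r *\<^sub>R mat 1 + H + cscale (\<i> * of_real c) (mat 1)) R \<longleftrightarrow> topproj k H R"
proof -
  have val: "cmod (mtrace ((r *\<^sub>R mat 1 + H + cscale (\<i> * of_real c) (mat 1)) ** R)) = sqrt ((r * real k + H \<bullet> R)\<^sup>2 + (c * real k)\<^sup>2)"
    "0 \<le> r * real k + H \<bullet> R" if R: "is_proj k R" for R
  proof -
    have "mtrace ((r *\<^sub>R mat 1 + H + cscale (\<i> * of_real c) (mat 1)) ** R) = Complex (r * real k + H \<bullet> R) (c * real k)"
      using mtrace_herm[OF H is_projD(1)[OF R]] is_projD(3)[OF R]
      by (simp add: mmult_simps mtrace_simps complex_eq_iff)
    thus "cmod (mtrace ((r *\<^sub>R mat 1 + H + cscale (\<i> * of_real c) (mat 1)) ** R)) = sqrt ((r * real k + H \<bullet> R)\<^sup>2 + (c * real k)\<^sup>2)"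
      by (simp add: complex_norm)
    show "0 \<le> r * real k + H \<bullet> R"
      using inner_le_kradius[OF k R H] r by linarith
  qed
  have "cmod (mtrace ((r *\<^sub>R mat 1 + H + cscale (\<i> * of_real c) (mat 1)) ** R')) \<le> cmod (mtrace ((r *\<^sub>R mat 1 + H + cscale (\<i> * of_real c) (mat 1)) ** R)) \<longleftrightarrow> H \<bullet> R' \<le> H \<bullet> R"
    if "is_proj k R" "is_proj k R'" for R R'
    using val[OF that(1)] val[OF that(2)]
    by (simp add: abs_le_square_iff[symmetric])
  thus ?thesis by (auto simp: att_def topproj_def)
qed

section \<open>Distance between projections and a criterion for scalar matrices\<close>

lemma proj_inner_nonneg: "is_proj k P \<Longrightarrow> is_proj m R \<Longrightarrow> 0 \<le> P \<bullet> R"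
  by (rule psd_inner_proj) (simp_all add: cip_proj del: of_real_power)

text \<open>Both projections have squared norm k, so the inner product alone measures their
  distance: it is at most k, and equal to k only for P = R.\<close>

lemma proj_dist:
  assumes "is_proj k P" "is_proj k R"
  shows "(norm (R - P))\<^sup>2 = 2 * (real k - P \<bullet> R)"
  using proj_inner_self[OF assms(1)] proj_inner_self[OF assms(2)]
  by (simp add: power2_norm_eq_inner inner_diff_left inner_diff_right inner_commute)

lemma proj_inner_le: "is_proj k P \<Longrightarrow> is_proj k R \<Longrightarrow> P \<bullet> R \<le> real k"
  using proj_dist[of k P R] zero_le_power2[of "norm (R - P)"] by (simp del: zero_le_power2)

lemma proj_inner_eq: "is_proj k P \<Longrightarrow> is_proj k R \<Longrightarrow> real k \<le> P \<bullet> R \<Longrightarrow> R = P"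
  using proj_dist[of k P R] zero_le_power2[of "norm (R - P)"]
  by (metis diff_ge_0_iff_ge eq_iff_diff_eq_0 mult_eq_0_iff norm_eq_zero proj_inner_le antisym power_eq_0_iff)

text \<open>The two hypotheses make the real and the imaginary part of \<open>cnj b * c\<close>
  vanish.\<close>

lemma orthogonal_sum_zero:
  fixes b c :: complex
  assumes "cmod (b + c) = cmod (b - c)" "cmod (\<i> * b + c) = cmod (b - c)"
  shows "b * c = 0"
proof -
  have "(cmod (b + c))\<^sup>2 = (cmod (b - c))\<^sup>2" "(cmod (\<i> * b + c))\<^sup>2 = (cmod (b - c))\<^sup>2"
    using assms by simp_all
  hence "Re b * Re c + Im b * Im c = 0" "Re b * Im c - Im b * Re c = 0"
    unfolding cmod_power2 by (simp_all add: power2_eq_square algebra_simps)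
  hence "cnj b * c = 0" by (simp add: complex_eq_iff)
  thus ?thesis by simp
qed

text \<open>It suffices to treat the 2 by 2 block at each pair of coordinates. Rotating e_i towards
  e_j with equal weights and phase \<omega> gives the trace (X + Y + \<omega> b + cnj \<omega> c)/2,
  where X and Y are the traces before and after exchanging e_i and e_j. Constancy of its modulus,
  with stationarity, forces b = c = 0 and X = Y.\<close>

lemma const_modulus_scalar:
  fixes A :: "'n::finite cmat"
  assumes k: "1 \<le> k" "k < CARD('n)" and A: "\<And>R. is_proj k R \<Longrightarrow> cmod (mtrace (A ** R)) = r"
  shows "\<exists>c. A = smat c"
proof -
  have off: "A $ i $ j = 0 \<and> A $ i $ i = A $ j $ j" if ij: "i \<noteq> j" for i j
  proof -
    obtain S where S: "card S = k" "i \<in> S" "j \<notin> S" using ex_diagproj[OF k ij] by blast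
    define P :: "'n cmat" where "P = diagproj S"
    have P: "is_proj k P" using is_proj_diagproj[of S] S by (simp add: P_def)
    define u v :: "complex^'n" where "u = axis i 1" and "v = axis j 1"
    have u: "P *v u = u" "norm u = 1" and v: "P *v v = 0" "norm v = 1"
      using S by (simp_all add: P_def u_def v_def diagproj_axis norm_axis)
    define a b c d where "a = A $ i $ i" and "b = A $ i $ j" and "c = A $ j $ i" and "d = A $ j $ j"
    have abcd: "cip u (A *v u) = a" "cip u (A *v v) = b" "cip v (A *v u) = c" "cip v (A *v v) = d"
      by (simp_all add: u_def v_def cip_axis mv_axis a_def b_def c_def d_def)
    define X Y where "X = mtrace (A ** P)" and "Y = X - a + d"
    have X: "cmod X = r" using A[OF P] by (simp add: X_def)
    have Y: "cmod Y = r"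
      using A[OF proj_swap[OF P u v]]
      by (simp add: Y_def X_def mmult_simps mtrace_simps mtrace_mult_outer abcd algebra_simps)
    have attP: "att k A P" using A P by (simp add: att_def)
    have st1: "Re (cnj X * (b + c)) = 0"
      using att_stationary[OF attP u v] by (simp add: abcd X_def)
    \<comment> \<open>Turning v by a quarter phase gives the companion of \<open>st1\<close>; if b
      or c vanishes, the two determine both parts of the other one times cnj X.\<close>
    have st2: "Re (cnj X * (\<i> * b - \<i> * c)) = 0"
      using att_stationary[OF attP u, of "\<i> *s v"] v abcd
      by (simp add: X_def mv_simps cip_simps norm_vscale)
    \<comment> \<open>Parallelogram law for the phases \<omega> and - \<omega>: the cross term
      between X + Y and the off-diagonal contribution cancels.\<close>
    have circ: "(cmod (X + Y))\<^sup>2 + (cmod (\<omega> * b + cnj \<omega> * c))\<^sup>2 = 4 * r\<^sup>2" if w: "cmod \<omega> = 1" for \<omega>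
    proof -
      have *: "cmod (X + Y + (\<omega> * b + cnj \<omega> * c)) = 2 * r" if w: "cmod \<omega> = 1" for \<omega>
      proof -
        define \<alpha> where "\<alpha> = complex_of_real (1 / sqrt 2)"
        define \<beta> where "\<beta> = \<alpha> * \<omega>"
        have aa: "\<alpha> * \<alpha> = 1/2" "cnj \<alpha> = \<alpha>" unfolding \<alpha>_def of_real_mult[symmetric] by simp_all
        have ca: "(cmod \<alpha>)\<^sup>2 = 1/2" by (simp add: \<alpha>_def norm_divide power_divide)
        have cb: "(cmod \<beta>)\<^sup>2 = 1/2" by (simp add: \<beta>_def norm_mult power_mult_distrib w ca)
        have ab: "cnj \<alpha> * \<beta> = \<omega> / 2" "\<alpha> * cnj \<beta> = cnj \<omega> / 2"
          using aa by (simp_all add: \<beta>_def mult.assoc[symmetric])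
        have e: "(cmod \<alpha>)\<^sup>2 + (cmod \<beta>)\<^sup>2 = 1" using ca cb by simp
        have "mtrace (A ** (P - outer u u + outer (\<alpha> *s u + \<beta> *s v) (\<alpha> *s u + \<beta> *s v)))
            = X + (of_real (1/2) - 1) * a + of_real (1/2) * d + \<omega> / 2 * b + cnj \<omega> / 2 * c"
          unfolding rot_value abcd X_def ca cb ab ..
        also have "\<dots> = (X + Y + (\<omega> * b + cnj \<omega> * c)) / 2"
          by (simp add: Y_def field_simps)
        finally have "cmod ((X + Y + (\<omega> * b + cnj \<omega> * c)) / 2) = r"
          using A[OF proj_rot[OF P u v e]] by metis
        thus ?thesis by (simp add: norm_divide)
      qed
      have "(cmod (X + Y + (\<omega> * b + cnj \<omega> * c)))\<^sup>2 = 4 * r\<^sup>2" "(cmod (X + Y - (\<omega> * b + cnj \<omega> * c)))\<^sup>2 = 4 * r\<^sup>2"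
        using *[of \<omega>] *[of "- \<omega>"] w by (simp_all add: power_mult_distrib algebra_simps)
      thus ?thesis unfolding cmod_power2 by (simp add: power2_eq_square algebra_simps)
    qed
    have c1: "(cmod (X + Y))\<^sup>2 + (cmod (b + c))\<^sup>2 = 4 * r\<^sup>2" using circ[of 1] by simp
    have "\<i> * b + cnj \<i> * c = \<i> * (b - c)" by (simp add: algebra_simps)
    hence "cmod (\<i> * b + cnj \<i> * c) = cmod (b - c)" by (simp add: norm_mult)
    hence "(cmod (X + Y))\<^sup>2 + (cmod (b - c))\<^sup>2 = 4 * r\<^sup>2" using circ[of \<i>] by simp
    hence "(cmod (b + c))\<^sup>2 = (cmod (b - c))\<^sup>2" using c1 by linarith
    moreover have "(cmod (\<i> * b + c))\<^sup>2 = (cmod (b + c))\<^sup>2"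
    proof -
      \<comment> \<open>An eighth root of unity with i cnj \<omega> = \<omega>, so that the
        off-diagonal sum has modulus |i b + c|.\<close>
      define \<omega> where "\<omega> = cis (pi/4)"
      have "\<i> * cnj \<omega> = \<omega>" by (simp add: \<omega>_def complex_eq_iff cos_45 sin_45)
      hence "\<omega> * b + cnj \<omega> * c = cnj \<omega> * (\<i> * b + c)" by (metis distrib_left mult.assoc mult.commute)
      hence "cmod (\<omega> * b + cnj \<omega> * c) = cmod (\<i> * b + c)" by (simp add: norm_mult \<omega>_def)
      moreover have "cmod \<omega> = 1" by (simp add: \<omega>_def)
      ultimately have "(cmod (X + Y))\<^sup>2 + (cmod (\<i> * b + c))\<^sup>2 = 4 * r\<^sup>2" using circ[of \<omega>] by simp
      thus ?thesis using c1 by linarith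
    qed
    ultimately have bc: "b * c = 0"
      by (intro orthogonal_sum_zero) (simp_all add: power2_eq_iff_nonneg)
    have sq: "(cmod (X + Y))\<^sup>2 + (cmod b)\<^sup>2 + (cmod c)\<^sup>2 = 4 * r\<^sup>2"
      using circ[of 1] bc by auto
    have "b = 0 \<and> c = 0"
    \<comment> \<open>Stationarity says nothing when X = 0; there the right-hand side of
      \<open>sq\<close> is zero instead.\<close>
    proof (cases "r = 0")
      case True
      hence "4 * r\<^sup>2 = 0" by simp
      hence "(cmod b)\<^sup>2 + (cmod c)\<^sup>2 \<le> 0" using sq zero_le_power2[of "cmod (X + Y)"] by linarith
      thus ?thesis by (simp add: sum_power2_le_zero_iff)
    next
      case False
      hence X0: "X \<noteq> 0" using X by auto
      have "b = 0 \<or> c = 0" using bc by simp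
      hence "cnj X * b = 0 \<and> cnj X * c = 0"
        using st1 st2 by (elim disjE) (simp_all add: complex_eq_iff algebra_simps)
      thus ?thesis using X0 by simp
    qed
    \<comment> \<open>Two numbers of modulus r whose sum has modulus 2r coincide, by the
      parallelogram law.\<close>
    moreover have "X = Y"
    proof -
      have "(cmod (X + Y))\<^sup>2 = 4 * r\<^sup>2" using sq calculation by simp
      moreover have "(cmod (X + Y))\<^sup>2 + (cmod (X - Y))\<^sup>2 = 2 * (cmod X)\<^sup>2 + 2 * (cmod Y)\<^sup>2"
        unfolding cmod_power2 by (simp add: power2_eq_square algebra_simps)
      ultimately show ?thesis using X Y by simp
    qed
    ultimately show ?thesis by (simp add: Y_def a_def b_def d_def)
  qed
  define i0 :: 'n where "i0 = undefined"
  have "A = smat (A $ i0 $ i0)"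
    unfolding vec_eq_iff
  proof (intro allI)
    fix i j show "A $ i $ j = smat (A $ i0 $ i0) $ i $ j"
      using off[of i j] off[of i i0] by (cases "i = i0") (auto simp: cscale_def mat_def)
  qed
  thus ?thesis by blast
qed

lemma const_inner_scalar:
  fixes Y :: "'n::finite cmat"
  assumes k: "1 \<le> k" "k < CARD('n)" and Y: "herm Y" and c: "\<And>R. is_proj k R \<Longrightarrow> Y \<bullet> R = c"
  shows "\<exists>y. Y = y *\<^sub>R mat 1"
proof -
  have "cmod (mtrace (Y ** R)) = \<bar>c\<bar>" if "is_proj k R" for R
    using mtrace_herm[OF Y is_projD(1)[OF that]] c[OF that] by simp
  then obtain z where z: "Y = smat z" using const_modulus_scalar[OF k] by blast
  fix i :: 'n
  have "cnj z = z" using arg_cong[OF Y, of "\<lambda>M. M $ i $ i"]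
    by (simp add: z adj_def cscale_def mat_def)
  hence "z = of_real (Re z)" by (metis Reals_cnj_iff of_real_Re)
  thus ?thesis using z by (metis cscale_of_real)
qed

lemma hre_add: "hre (A + B) = hre A + hre B"
  and hre_diff: "hre (A - B) = hre A - hre B"
  and hre_scaleR: "hre (r *\<^sub>R A) = r *\<^sub>R hre A"
  by (simp_all add: hre_def adj_simps algebra_simps)

lemma hre_herm: "herm A \<Longrightarrow> hre A = A"
  by (simp add: hre_def scaleR_2[symmetric])

lemma inner_hre: "herm G \<Longrightarrow> G \<bullet> hre A = G \<bullet> A"
  using inner_adj[of G A] by (simp add: hre_def inner_add_right)

lemma mat_one_nonzero: "(mat 1 :: 'n::finite cmat) \<noteq> 0"
  by (simp add: mat_def vec_eq_iff)

section \<open>Unital parallelism preservers\<close>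

text \<open>Adding the two inequalities cancels the squares of a and the terms linear in y. The
  bound that remains on the right does not involve a, so a large a rules out y1 > y0.\<close>

lemma opposite_shift_le:
  fixes a :: real
  assumes "(a - y0)\<^sup>2 + x0\<^sup>2 \<le> (a - y)\<^sup>2 + x\<^sup>2" "(a + y1)\<^sup>2 + x1\<^sup>2 \<le> (a + y)\<^sup>2 + x\<^sup>2"
  shows "a * (y1 - y0) \<le> y\<^sup>2 + x\<^sup>2"
proof -
  have "a\<^sup>2 - 2 * (a * y0) + y0\<^sup>2 + x0\<^sup>2 \<le> a\<^sup>2 - 2 * (a * y) + y\<^sup>2 + x\<^sup>2"
    "a\<^sup>2 + 2 * (a * y1) + y1\<^sup>2 + x1\<^sup>2 \<le> a\<^sup>2 + 2 * (a * y) + y\<^sup>2 + x\<^sup>2"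
    using assms by (simp_all add: power2_sum power2_diff mult.assoc)
  moreover have "0 \<le> x0\<^sup>2" "0 \<le> x1\<^sup>2" "0 \<le> y0\<^sup>2" "0 \<le> y1\<^sup>2" by simp_all
  ultimately have "2 * (a * y1) - 2 * (a * y0) \<le> 2 * y\<^sup>2 + 2 * x\<^sup>2" by linarith
  thus ?thesis by (simp add: right_diff_distrib)
qed

text \<open>The normalisation \<open>T_one\<close> costs no generality: T maps the identity to a
  nonzero scalar matrix by \<open>parallel_preserver_one\<close>, and division by that scalar keeps
  parallelism.\<close>

locale parallel_preserver =
  fixes k :: nat and T :: "'n::finite cmat \<Rightarrow> 'n cmat"
  assumes k: "1 \<le> k" "k < CARD('n)"
    and lin: "clinear_map T" and bij: "bij T"
    and pres: "kparallel k A B \<Longrightarrow> kparallel k (T A) (T B)"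
    and T_one: "T (mat 1) = mat 1"
begin

lemma T_add: "T (A + B) = T A + T B" and T_cscale: "T (cscale c A) = cscale c (T A)"
  using lin by (auto simp: clinear_map_def)

lemma T_scaleR: "T (r *\<^sub>R A) = r *\<^sub>R T A"
  by (metis T_cscale cscale_of_real)

lemma T_minus: "T (- A) = - T A"
  using T_cscale[of "-1" A] by (simp add: cscale_uminus cscale_one)

lemma T_diff: "T (A - B) = T A - T B"
  using T_add[of A "- B"] by (simp add: T_minus)

lemmas T_simps = T_add T_cscale T_scaleR T_minus T_diff T_one

lemma pres_att: "att k A R \<Longrightarrow> att k B R \<Longrightarrow> \<exists>Q. att k (T A) Q \<and> att k (T B) Q"
  using pres[of A B] kparallel_iff[OF k] by blast

text \<open>For real s the matrices s + iG and s - iG attain their radius at the same projections; comparing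
  their images as s tends to infinity shows that the skew part of T G is scalar.\<close>

lemma him_T_scalar:
  assumes G: "herm G"
  shows "\<exists>c. him (T G) = c *\<^sub>R mat 1"
proof (rule const_inner_scalar[OF k herm_him])
  define X where "X = hre (T G)"
  define Y where "Y = him (T G)"
  have X: "herm X" and Y: "herm Y" by (simp_all add: X_def Y_def herm_hre herm_him)
  have TG: "T G = X + cscale \<i> Y" unfolding X_def Y_def by (rule hre_him)
  have le: "Y \<bullet> R1 \<le> Y \<bullet> R0" if R: "is_proj k R0" "is_proj k R1" for R0 R1
  proof (rule ccontr)
    define \<delta> where "\<delta> = Y \<bullet> R1 - Y \<bullet> R0"
    assume "\<not> ?thesis"
    hence d: "\<delta> > 0" by (simp add: \<delta>_def)
    define M where "M = (kradius k Y)\<^sup>2 + (kradius k X)\<^sup>2"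
    \<comment> \<open>Chosen so that s k \<delta> = M + 1, just above the bound M that
      \<open>opposite_shift_le\<close> will give.\<close>
    define s where "s = (M + 1) / (real k * \<delta>)"
    define A where "A = s *\<^sub>R mat 1 + cscale \<i> G"
    define B where "B = s *\<^sub>R mat 1 + cscale \<i> (- G)"
    have G': "herm (- G)" using G by (simp add: adj_simps)
    have s1: "herm (s *\<^sub>R mat 1 :: 'n cmat)" by (simp add: adj_simps)
    \<comment> \<open>The traces of A and B at a projection are complex conjugates, so A and B
      attain their radii at the same places.\<close>
    have "cmod (mtrace (A ** R)) = cmod (mtrace (B ** R))" if "is_proj k R" for R
      unfolding A_def B_def mtrace_shift[OF that s1 G] mtrace_shift[OF that s1 G'] by (simp add: complex_norm)
    hence "att k A R \<longleftrightarrow> att k B R" for R by (auto simp: att_def)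
    then obtain R where R': "att k (T A) R" "att k (T B) R"
      using pres_att att_ex[OF k, of A] by blast
    hence pR: "is_proj k R" by (simp add: att_def)
    \<comment> \<open>Multiplication by i puts Y into the real part, with opposite signs for A and
      B.\<close>
    have TA: "T A = (s *\<^sub>R mat 1 - Y) + cscale \<i> X"
      by (simp add: A_def T_simps TG cscale_add cscale_cscale cscale_uminus cscale_one)
    have TB: "T B = (s *\<^sub>R mat 1 + Y) + cscale \<i> (- X)"
      by (simp add: B_def T_simps TG cscale_add cscale_minus cscale_cscale cscale_uminus cscale_one)
    have h: "herm (s *\<^sub>R mat 1 - Y)" "herm (s *\<^sub>R mat 1 + Y)" "herm (- X)"
      using X Y by (simp_all add: adj_simps)
    have vA: "mtrace (T A ** R) = Complex (s * real k - Y \<bullet> R) (X \<bullet> R)"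
      and vB: "mtrace (T B ** R) = Complex (s * real k + Y \<bullet> R) (- (X \<bullet> R))" if "is_proj k R" for R
      unfolding TA TB mtrace_shift[OF that h(1) X] mtrace_shift[OF that h(2) h(3)]
      using inner_one_proj[OF that] by (simp_all add: inner_diff_left inner_add_left)
    have "(cmod (mtrace (T A ** R0)))\<^sup>2 \<le> (cmod (mtrace (T A ** R)))\<^sup>2"
      "(cmod (mtrace (T B ** R1)))\<^sup>2 \<le> (cmod (mtrace (T B ** R)))\<^sup>2"
      using R R' by (auto simp: att_def intro!: power_mono)
    hence 1: "(s * real k - Y \<bullet> R0)\<^sup>2 + (X \<bullet> R0)\<^sup>2 \<le> (s * real k - Y \<bullet> R)\<^sup>2 + (X \<bullet> R)\<^sup>2"
      "(s * real k + Y \<bullet> R1)\<^sup>2 + (X \<bullet> R1)\<^sup>2 \<le> (s * real k + Y \<bullet> R)\<^sup>2 + (X \<bullet> R)\<^sup>2"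
      unfolding vA[OF pR] vB[OF pR] vA[OF R(1)] vB[OF R(2)] cmod_power2 by simp_all
    have "(Y \<bullet> R)\<^sup>2 \<le> (kradius k Y)\<^sup>2" "(X \<bullet> R)\<^sup>2 \<le> (kradius k X)\<^sup>2"
      using inner_le_kradius[OF k pR X] inner_le_kradius[OF k pR Y]
      by (metis abs_ge_zero power2_abs power_mono)+
    hence M: "(Y \<bullet> R)\<^sup>2 + (X \<bullet> R)\<^sup>2 \<le> M" by (simp add: M_def)
    have "s * real k * \<delta> \<le> M"
      using opposite_shift_le[OF 1] M by (simp add: \<delta>_def)
    moreover have "s * real k * \<delta> = M + 1" using d k by (simp add: s_def)
    ultimately show False by simp
  qed
  fix R :: "'n cmat" assume "is_proj k R"
  thus "him (T G) \<bullet> R = Y \<bullet> (SOME R. is_proj k R)"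
    using le ex_proj[OF k] unfolding Y_def by (metis antisym someI_ex)
qed

section \<open>Splitting T on Hermitian matrices into a Hermitian part and a scalar
  functional\<close>

definition S :: "'n cmat \<Rightarrow> 'n cmat" where "S G = hre (T G)"

text \<open>The scalar of \<open>him_T_scalar\<close>, written as a normalised trace so that real
  linearity is evident and no witness has to be chosen. It will turn out to be zero on Hermitian
  matrices.\<close>

definition f :: "'n cmat \<Rightarrow> real" where "f G = Re (mtrace (him (T G))) / CARD('n)"

lemma T_S_f: "herm G \<Longrightarrow> T G = S G + cscale (\<i> * of_real (f G)) (mat 1)"
proof -
  assume "herm G"
  then obtain c where c: "him (T G) = c *\<^sub>R mat 1" using him_T_scalar by blast
  hence "f G = c" by (simp add: f_def mtrace_simps)
  moreover have "T G = S G + cscale \<i> (him (T G))" unfolding S_def by (rule hre_him)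
  ultimately show ?thesis by (simp add: c cscale_scaleR)
qed

lemma herm_S: "herm (S G)"
  by (simp add: S_def herm_hre)

lemma S_add: "S (A + B) = S A + S B" and S_diff: "S (A - B) = S A - S B"
  and S_scaleR: "S (r *\<^sub>R A) = r *\<^sub>R S A" and S_one: "S (mat 1) = mat 1"
  by (simp_all add: S_def T_simps hre_add hre_diff hre_scaleR hre_herm adj_simps)

lemma him_lin: "him (A + B) = him A + him B" "him (r *\<^sub>R A) = r *\<^sub>R him A"
  by (simp_all add: him_def adj_simps cscale_add cscale_diff algebra_simps cscale_scaleR)
    (simp add: cscale_def vec_eq_iff scaleR_conv_of_real[where 'a=complex] algebra_simps)

lemma f_add: "f (A + B) = f A + f B" and f_scaleR: "f (r *\<^sub>R A) = r * f A"
  by (simp_all add: f_def T_simps him_lin mtrace_simps add_divide_distrib)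

lemma f_one: "f (mat 1) = 0"
  by (simp add: f_def T_simps him_def adj_simps cscale_def mtrace_def)

text \<open>Write a preimage of Y under T as X + i W. Comparing Hermitian parts gives Y = S X - f(W)
  I, and the scalar is absorbed into X since S fixes the identity.\<close>

lemma S_surj:
  assumes "herm Y"
  shows "\<exists>X. herm X \<and> S X = Y"
proof -
  obtain Z where Z: "T Z = Y" using bij by (metis bij_pointE)
  define X W where "X = hre Z" and "W = him Z"
  have XW: "herm X" "herm W" "Z = X + cscale \<i> W"
    unfolding X_def W_def by (simp_all add: herm_hre herm_him) (rule hre_him)
  have "Y = (S X - f W *\<^sub>R mat 1) + cscale \<i> (S W + f X *\<^sub>R mat 1)"
    unfolding Z[symmetric] XW(3) T_add T_cscale T_S_f[OF XW(1)] T_S_f[OF XW(2)]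
    by (simp add: cscale_add cscale_cscale cscale_uminus cscale_of_real cscale_scaleR mult.assoc[symmetric])
  hence "hre Y = S X - f W *\<^sub>R mat 1"
    using herm_combo(1)[of "S X - f W *\<^sub>R mat 1" "S W + f X *\<^sub>R mat 1"] herm_S
    by (simp add: adj_simps)
  hence "S (X - f W *\<^sub>R mat 1) = Y" using hre_herm[OF assms] by (simp add: S_diff S_scaleR S_one)
  moreover have "herm (X - f W *\<^sub>R mat 1)" using XW by (simp add: adj_simps)
  ultimately show ?thesis by blast
qed

text \<open>With d = k - P . R, the real part drops by d, while Cauchy-Schwarz and
  \<open>proj_dist\<close> bound the squared imaginary part by 2 d times the squared norm of G. The
  threshold on s makes the loss outweigh the gain.\<close>

lemma att_perturbed:
  assumes P: "is_proj k P" and G: "herm G" "G \<bullet> P = 0" and s: "(norm G)\<^sup>2 \<le> s * real k" "0 \<le> s"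
  shows "att k (s *\<^sub>R mat 1 + P + cscale \<i> G) P"
proof -
  have h: "herm (s *\<^sub>R mat 1 + P)" using is_projD(1)[OF P] by (simp add: adj_simps)
  have val: "(cmod (mtrace ((s *\<^sub>R mat 1 + P + cscale \<i> G) ** R)))\<^sup>2 = (s * real k + P \<bullet> R)\<^sup>2 + (G \<bullet> R)\<^sup>2"
    if "is_proj k R" for R
    unfolding mtrace_shift[OF that h G(1)] cmod_power2
    using inner_one_proj[OF that] by (simp add: inner_add_left)
  have "(cmod (mtrace ((s *\<^sub>R mat 1 + P + cscale \<i> G) ** R)))\<^sup>2 \<le> (cmod (mtrace ((s *\<^sub>R mat 1 + P + cscale \<i> G) ** P)))\<^sup>2"
    if R: "is_proj k R" for R
  proof -
    define d where "d = real k - P \<bullet> R"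
    have d: "0 \<le> d" "d \<le> real k"
      using proj_inner_le[OF P R] proj_inner_nonneg[OF P R] by (simp_all add: d_def)
    have "\<bar>G \<bullet> R\<bar> \<le> norm G * norm (R - P)"
      using Cauchy_Schwarz_ineq2[of G "R - P"] G(2) by (simp add: inner_diff_right)
    hence "(G \<bullet> R)\<^sup>2 \<le> (norm G * norm (R - P))\<^sup>2" by (metis abs_ge_zero power2_abs power_mono)
    also have "\<dots> = (norm G)\<^sup>2 * (2 * d)" by (simp add: power_mult_distrib proj_dist[OF P R] d_def)
    also have "\<dots> \<le> s * real k * (2 * d)" using s d by (intro mult_right_mono) auto
    finally have "(s * real k + P \<bullet> R)\<^sup>2 + (G \<bullet> R)\<^sup>2 \<le> (s * real k + real k - d)\<^sup>2 + s * real k * (2 * d)"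
      by (simp add: d_def)
    also have "\<dots> = (s * real k + real k)\<^sup>2 - d * (2 * real k - d)"
      by (simp add: power2_eq_square algebra_simps)
    also have "\<dots> \<le> (s * real k + real k)\<^sup>2" using d by simp
    finally show ?thesis unfolding val[OF R] val[OF P] using proj_inner_self[OF P] G(2) by simp
  qed
  thus ?thesis using P by (auto simp: att_def intro: power2_le_imp_le)
qed

text \<open>In the first-order condition for T(sI + P + iG) at Q, the matrix G may carry any real factor; this
  forces the imaginary part of tr(T(sI + P + iG) Q) to vanish.\<close>

lemma dual_at_projection:
  assumes P: "is_proj k P" and Q: "is_proj k Q" and PQ: "\<And>A. att k A P \<Longrightarrow> att k (T A) Q"
  shows "f P = 0" "\<And>G. herm G \<Longrightarrow> S G \<bullet> Q = G \<bullet> P"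
proof -
  obtain u v where u: "Q *v u = u" "norm u = 1" and v: "Q *v v = 0" "norm v = 1"
    using proj_ran[OF Q k(1)] proj_ker[OF Q k(2)] by blast
  \<comment> \<open>The derivative of the pairing of S H with Q when u is rotated towards v; it is
    real because S H is Hermitian.\<close>
  define g where "g H = 2 * Re (cip u (S H *v v))" for H
  have g: "cip u (S H *v v) + cip v (S H *v u) = of_real (g H)" for H
  proof -
    have "cip v (S H *v u) = cnj (cip u (S H *v v))"
      by (metis cip_adj cip_commute herm_S)
    thus ?thesis by (simp add: g_def complex_eq_iff)
  qed
  have hP: "herm P" using is_projD[OF P] by simp
  have main: "Re (cnj (Complex (s * real k + S P \<bullet> Q - f G * real k) (f P * real k + S G \<bullet> Q)) * Complex (g P) (g G)) = 0"
    if G: "herm G" "G \<bullet> P = 0" and s: "(norm G)\<^sup>2 \<le> s * real k" "0 \<le> s" for G s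
  proof -
    define B where "B = T (s *\<^sub>R mat 1 + P + cscale \<i> G)"
    have B: "B = ((s - f G) *\<^sub>R mat 1 + S P) + cscale \<i> (S G + f P *\<^sub>R mat 1)"
      unfolding B_def T_simps T_S_f[OF G(1)] T_S_f[OF hP]
      by (simp add: cscale_add cscale_cscale cscale_uminus cscale_of_real cscale_scaleR mult.assoc[symmetric]
          scaleR_diff_left)
    have h: "herm ((s - f G) *\<^sub>R mat 1 + S P)" "herm (S G + f P *\<^sub>R mat 1)"
      by (simp_all add: adj_simps herm_S)
    have "att k B Q" unfolding B_def by (intro PQ att_perturbed P G s)
    note st = att_stationary[OF this u v]
    have "mtrace (B ** Q) = Complex (s * real k + S P \<bullet> Q - f G * real k) (f P * real k + S G \<bullet> Q)"
      unfolding B mtrace_shift[OF Q h] using inner_one_proj[OF Q] by (simp add: inner_add_left algebra_simps)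
    moreover have "cip u (B *v v) + cip v (B *v u) = of_real (g P) + \<i> * of_real (g G)"
      unfolding B g[symmetric] using proj_orth[OF Q u(1) v(1)]
      by (simp add: mv_simps cip_simps algebra_simps)
    moreover have "\<dots> = Complex (g P) (g G)" by (simp add: complex_eq_iff)
    ultimately show ?thesis using st by simp
  qed
  have S0: "S 0 = 0" "f 0 = 0" using S_scaleR[of 0 0] f_scaleR[of 0 0] by simp_all
  hence g0: "g 0 = 0" by (simp add: g_def cip_simps)
  \<comment> \<open>G = 0 is admissible for every s >= 0; the conditions for s = 0 and s = 1 differ
    by k times \<open>g P\<close>.\<close>
  have "g P = 0"
    using main[of 0 0] main[of 0 1] k by (auto simp: S0 g0 adj_def vec_eq_iff)
  have im: "f P = 0 \<and> S G \<bullet> Q = 0" if G: "herm G" "G \<bullet> P = 0" "g G \<noteq> 0" for G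
  proof -
    \<comment> \<open>Scaling G by c scales \<open>g G\<close> and S G . Q but leaves f P alone, so
      two values of c separate the terms; s is the smallest shift that \<open>att_perturbed\<close>
      admits.\<close>
    have *: "f P * real k + c * (S G \<bullet> Q) = 0" if c: "c \<noteq> 0" for c
    proof -
      define s where "s = (norm (c *\<^sub>R G))\<^sup>2 / real k"
      have "herm (c *\<^sub>R G)" "(c *\<^sub>R G) \<bullet> P = 0" "(norm (c *\<^sub>R G))\<^sup>2 \<le> s * real k" "0 \<le> s"
        using G k by (simp_all add: adj_simps s_def)
      note main[OF this]
      hence "(f P * real k + S (c *\<^sub>R G) \<bullet> Q) * g (c *\<^sub>R G) = 0" using \<open>g P = 0\<close> by (auto simp: add_eq_0_iff)
      moreover have "g (c *\<^sub>R G) = c * g G" by (simp add: g_def S_scaleR mv_simps cip_simps)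
      ultimately show ?thesis using G c by (simp add: S_scaleR)
    qed
    have "S G \<bullet> Q = 0" using *[of 1] *[of 2] by simp
    thus ?thesis using *[of 1] k by simp
  qed
  \<comment> \<open>Surjectivity of S supplies a direction with g equal to 2. Subtracting a scalar
    matrix makes it orthogonal to P without changing g, since u and v are orthogonal.\<close>
  obtain G0 where G0: "herm G0" "S G0 = outer u v + outer v u"
    using S_surj[of "outer u v + outer v u"] by (auto simp: adj_simps add.commute)
  define G1 where "G1 = G0 - (G0 \<bullet> P / real k) *\<^sub>R mat 1"
  have G1: "herm G1" "G1 \<bullet> P = 0"
    using G0 k inner_one_proj[OF P] by (simp_all add: G1_def adj_simps inner_diff_left)
  have "g G1 = 2"
    using proj_orth[OF Q u(1) v(1)] u v
    by (simp add: g_def G1_def S_diff S_scaleR S_one G0 mv_simps cip_simps cip_self)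
  have zero: "S G \<bullet> Q = 0" if G: "herm G" "G \<bullet> P = 0" for G
  proof (cases "g G = 0")
    case True
    \<comment> \<open>A direction with vanishing derivative is the difference of two directions
      where it does not vanish.\<close>
    have "g (G + G1) = 2" using True \<open>g G1 = 2\<close> by (simp add: g_def S_add mv_simps cip_simps)
    hence "S (G + G1) \<bullet> Q = 0" "S G1 \<bullet> Q = 0"
      using im[of "G + G1"] im[of G1] G G1 \<open>g G1 = 2\<close> by (simp_all add: adj_simps inner_add_left)
    thus ?thesis by (simp add: S_add inner_add_left)
  qed (use im G in blast)
  show "f P = 0" using im[OF G1] \<open>g G1 = 2\<close> by simp
  fix G :: "'n cmat" assume G: "herm G"
  have "S (G - (G \<bullet> P / real k) *\<^sub>R mat 1) \<bullet> Q = 0"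
    using G k inner_one_proj[OF P] by (intro zero) (simp_all add: adj_simps inner_diff_left)
  thus "S G \<bullet> Q = G \<bullet> P"
    using k inner_one_proj[OF Q] by (simp add: S_diff S_scaleR S_one inner_diff_left)
qed

text \<open>Perturbing P by \<epsilon>X, where S X is a projection Q at the top of S P, makes Q the unique top projection
  of the image, so that every matrix attaining its radius at a top projection of P + \<epsilon>X is mapped to a matrix
  attaining its radius at Q.\<close>

lemma ex_dual_projection:
  assumes P: "is_proj k P"
  shows "\<exists>Q. is_proj k Q \<and> (\<forall>A. att k A P \<longrightarrow> att k (T A) Q)"
proof -
  have hP: "herm P" using is_projD[OF P] by simp
  obtain Q where Q: "topproj k (S P) Q" using topproj_ex[OF k] by blast
  hence pQ: "is_proj k Q" by (simp add: topproj_def)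
  obtain X where X: "herm X" "S X = Q" using S_surj is_projD(1)[OF pQ] by blast
  have tr: "att k (T A) Q" if e: "\<epsilon> > 0" and R: "topproj k (P + \<epsilon> *\<^sub>R X) R" and A: "att k A R" for \<epsilon> R A
  proof -
    define H where "H = P + \<epsilon> *\<^sub>R X"
    have H: "herm H" using hP X by (simp add: H_def adj_simps)
    define s where "s = max (kradius k H) (kradius k (S H)) / real k"
    have s: "kradius k H \<le> s * real k" "kradius k (S H) \<le> s * real k" using k by (simp_all add: s_def)
    have "att k (s *\<^sub>R mat 1 + H + cscale (\<i> * of_real 0) (mat 1)) R"
      using att_shift[OF k H s(1), of 0 R] R by (simp add: H_def)
    hence "att k (s *\<^sub>R mat 1 + H) R" by (simp add: cscale_zero)
    then obtain Q' where Q': "att k (T A) Q'" "att k (T (s *\<^sub>R mat 1 + H)) Q'"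
      using pres_att[OF A] by blast
    have "T (s *\<^sub>R mat 1 + H) = s *\<^sub>R mat 1 + S H + cscale (\<i> * of_real (f H)) (mat 1)"
      by (simp add: T_simps T_S_f[OF H] add.assoc)
    hence "topproj k (S H) Q'" using Q' att_shift[OF k herm_S s(2)] by simp
    hence "is_proj k Q'" "S H \<bullet> Q \<le> S H \<bullet> Q'" using pQ by (simp_all add: topproj_def)
    moreover have "S P \<bullet> Q' \<le> S P \<bullet> Q" using Q calculation by (simp add: topproj_def)
    moreover have "S H = S P + \<epsilon> *\<^sub>R Q" by (simp add: H_def S_add S_scaleR X)
    ultimately have "\<epsilon> * (Q \<bullet> Q) \<le> \<epsilon> * (Q \<bullet> Q')" by (simp add: inner_add_left)
    hence "real k \<le> Q \<bullet> Q'" using e proj_inner_self[OF pQ] by simp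
    hence "Q' = Q" using proj_inner_eq[OF pQ \<open>is_proj k Q'\<close>] by simp
    thus ?thesis using Q' by simp
  qed
  obtain P1 where P1: "topproj k (P + 1 *\<^sub>R X) P1" using topproj_ex[OF k] by blast
  hence pP1: "is_proj k P1" by (simp add: topproj_def)
  have d1: "S G \<bullet> Q = G \<bullet> P1" if "herm G" for G
    using dual_at_projection(2)[OF pP1 pQ tr[OF zero_less_one P1] that] by simp
  \<comment> \<open>By duality every top projection R of P + \<epsilon> X pairs with R - P1 as P1
    does, so R = P1 for every \<epsilon>. Letting \<epsilon> tend to 0 then identifies P1 with
    P.\<close>
  have le: "real k - P \<bullet> P1 \<le> \<epsilon> * (X \<bullet> P1 - X \<bullet> P)" if e: "\<epsilon> > 0" for \<epsilon>
  proof -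
    obtain R where R: "topproj k (P + \<epsilon> *\<^sub>R X) R" using topproj_ex[OF k] by blast
    hence pR: "is_proj k R" by (simp add: topproj_def)
    have "(R - P1) \<bullet> R = (R - P1) \<bullet> P1"
      using dual_at_projection(2)[OF pR pQ tr[OF e R], of "R - P1"] d1[of "R - P1"] is_projD(1)[OF pR] is_projD(1)[OF pP1]
      by (simp add: adj_simps)
    hence "(R - P1) \<bullet> (R - P1) = 0" by (simp add: inner_diff_right)
    hence "R = P1" by simp
    hence "(P + \<epsilon> *\<^sub>R X) \<bullet> P \<le> (P + \<epsilon> *\<^sub>R X) \<bullet> P1" using R P by (simp add: topproj_def)
    thus ?thesis using proj_inner_self[OF P] by (simp add: inner_add_left right_diff_distrib)
  qed
  have "real k - P \<bullet> P1 \<le> 0"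
  proof (rule field_le_epsilon)
    fix e :: real assume e: "e > 0"
    define D where "D = \<bar>X \<bullet> P1 - X \<bullet> P\<bar> + 1"
    have D: "D > 0" by (simp add: D_def)
    have "real k - P \<bullet> P1 \<le> e / D * (X \<bullet> P1 - X \<bullet> P)" using e D by (intro le) simp
    also have "\<dots> \<le> e / D * D" using e D by (intro mult_left_mono) (auto simp: D_def)
    finally show "real k - P \<bullet> P1 \<le> 0 + e" using D by simp
  qed
  hence "P1 = P" using proj_inner_eq[OF P pP1] by simp
  thus ?thesis using tr[OF zero_less_one P1] pQ by blast
qed

text \<open>On Hermitian matrices f is the pairing with some Hermitian M. It vanishes on rank k
  projections, so M is scalar, and f(I) = 0 leaves only M = 0.\<close>

lemma f_zero:
  assumes "herm G"
  shows "f G = 0"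
proof -
  define l where "l A = f (hre A)" for A
  have "linear l" by (rule linearI) (simp_all add: l_def hre_add hre_scaleR f_add f_scaleR)
  \<comment> \<open>\<open>adjoint l 1\<close> is the Riesz vector of l; taking its Hermitian part
    does not change pairings with Hermitian matrices.\<close>
  define M where "M = hre (adjoint l 1)"
  have M: "f H = H \<bullet> M" if "herm H" for H
  proof -
    have "H \<bullet> M = H \<bullet> adjoint l 1" unfolding M_def by (rule inner_hre[OF that])
    also have "\<dots> = l H" using adjoint_works[OF \<open>linear l\<close>, of H 1] by simp
    finally show ?thesis using hre_herm[OF that] by (simp add: l_def)
  qed
  have "M \<bullet> P = 0" if P: "is_proj k P" for P
    using ex_dual_projection[OF P] dual_at_projection(1)[OF P] M[OF is_projD(1)[OF P]] by (metis inner_commute)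
  then obtain c where c: "M = c *\<^sub>R mat 1"
    using const_inner_scalar[OF k, of M 0] herm_hre M_def by metis
  have "M \<bullet> M = c * f (mat 1)" using M[OF herm_one] by (simp add: c)
  hence "M = 0" by (simp add: f_one)
  thus ?thesis using M[OF assms] by simp
qed

lemma T_eq_S: "herm G \<Longrightarrow> T G = S G"
  using T_S_f[of G] f_zero[of G] by (simp add: cscale_zero)

lemma herm_T: "herm G \<Longrightarrow> herm (T G)"
  using T_eq_S herm_S by metis

text \<open>A large shift by sI turns a top projection P of G into one attaining the radius; its
  dual Q is then top for T G, and duality equates the two values.\<close>

lemma topsum_T:
  assumes G: "herm G"
  shows "topsum k (T G) = topsum k G"
proof -
  obtain P where P: "topproj k G P" using topproj_ex[OF k] by blast
  hence pP: "is_proj k P" by (simp add: topproj_def)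
  obtain Q where Q: "is_proj k Q" "\<And>A. att k A P \<Longrightarrow> att k (T A) Q"
    using ex_dual_projection[OF pP] by blast
  define s where "s = max (kradius k G) (kradius k (T G)) / real k"
  have s: "kradius k G \<le> s * real k" "kradius k (T G) \<le> s * real k" using k by (simp_all add: s_def)
  have "att k (s *\<^sub>R mat 1 + G) P"
    using att_shift[OF k G s(1), of 0 P] P by (simp add: cscale_zero)
  hence "att k (s *\<^sub>R mat 1 + T G) Q" using Q(2) by (metis T_add T_scaleR T_one)
  hence "topproj k (T G) Q"
    using att_shift[OF k herm_T[OF G] s(2), of 0 Q] by (simp add: cscale_zero)
  thus ?thesis
    using topproj_topsum P dual_at_projection(2)[OF pP Q G] T_eq_S[OF G] by metis
qed

lemma T_surj_herm:
  assumes "herm Y"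
  shows "\<exists>X. herm X \<and> T X = Y"
  using S_surj[OF assms] T_eq_S by metis

end

section \<open>Extremal Hermitian matrices\<close>

text \<open>A certificate of optimality: P reduces H, and t cuts the spectrum between range and
  kernel. No rank is mentioned, so the notion serves P and, with signs reversed, its
  complement.\<close>

definition separates :: "'n::finite cmat \<Rightarrow> 'n cmat \<Rightarrow> real \<Rightarrow> bool" where
  "separates P H t \<longleftrightarrow> P ** H = H ** P \<and>
     (\<forall>z. P *v z = z \<longrightarrow> t * (norm z)\<^sup>2 \<le> Re (cip z (H *v z))) \<and>
     (\<forall>z. P *v z = 0 \<longrightarrow> Re (cip z (H *v z)) \<le> t * (norm z)\<^sup>2)"

lemma separates_compl:
  assumes "separates P H t"
  shows "separates (mat 1 - P) (- H) (- t)"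
  using assms by (auto simp: separates_def mmult_simps mv_simps cip_simps)

lemma separates_compl_iff: "separates (mat 1 - P) (- H) (- t) \<longleftrightarrow> separates P H t"
  using separates_compl[of P H t] separates_compl[of "mat 1 - P" "- H" "- t"] by auto

text \<open>For K = H - t I both \<open>K ** P\<close> and \<open>K ** P - K\<close> have
  nonnegative form, so K . R <= KP . R <= KP . I = K . P.\<close>

lemma separates_topproj:
  fixes P :: "'n::finite cmat"
  assumes k: "k < CARD('n)" and P: "is_proj k P" and H: "herm H" and sep: "separates P H t"
  shows "topproj k H P"
proof -
  define K where "K = H - t *\<^sub>R mat 1"
  have PK: "P ** K = K ** P" using sep by (simp add: K_def separates_def mmult_simps)
  have PKP: "K ** P = P ** K ** P" using PK is_projD(2)[OF P] by (metis matrix_mul_assoc)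
  have K1: "0 \<le> Re (cip z (K *v z))" if "P *v z = z" for z
    using sep that by (simp add: separates_def K_def mv_simps cip_simps cip_self)
  have K2: "Re (cip z (K *v z)) \<le> 0" if "P *v z = 0" for z
    using sep that by (simp add: separates_def K_def mv_simps cip_simps cip_self)
  have A: "0 \<le> Re (cip z ((K ** P) *v z))" for z
  proof -
    have "cip z ((K ** P) *v z) = cip (P *v z) (K *v (P *v z))"
      by (subst PKP) (simp add: mv_assoc cip_proj_swap[OF P])
    thus ?thesis using K1[of "P *v z"] proj_mv_idem[OF P] by simp
  qed
  have B: "0 \<le> Re (cip z ((K ** P - K) *v z))" for z
  proof -
    define y where "y = z - P *v z"
    have "P *v y = 0" by (simp add: y_def mv_simps proj_mv_idem[OF P])
    have "P *v (K *v y) = 0" using \<open>P *v y = 0\<close> PK by (metis mv_assoc matrix_vector_mult_0_right)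
    hence "cip z (K *v y) = cip y (K *v y)"
      using cip_proj_swap[OF P, of z "K *v y"] by (simp add: y_def cip_simps)
    moreover have "(K ** P - K) *v z = - (K *v y)" by (simp add: y_def mv_simps mv_assoc)
    ultimately show ?thesis using K2[OF \<open>P *v y = 0\<close>] by (simp add: cip_simps)
  qed
  have "H \<bullet> R \<le> H \<bullet> P" if R: "is_proj k R" for R
  proof -
    have "0 \<le> (K ** P) \<bullet> (mat 1 - R)"
      by (rule psd_inner_proj[OF A proj_compl[OF R]]) (use k in simp)
    moreover have "0 \<le> (K ** P - K) \<bullet> R" by (rule psd_inner_proj[OF B R])
    ultimately have "K \<bullet> R \<le> (K ** P) \<bullet> mat 1" by (simp add: inner_diff_left inner_diff_right)
    also have "\<dots> = K \<bullet> P"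
      using inner_herm[of "mat 1" "K ** P"] inner_herm[OF is_projD(1)[OF P], of K] by (simp add: adj_simps)
    finally show ?thesis
      by (simp add: K_def inner_diff_left inner_one_proj[OF R] inner_one_proj[OF P])
  qed
  thus ?thesis using P by (simp add: topproj_def)
qed

lemma ex_normalized:
  assumes "a \<noteq> (0::complex^'n::finite)"
  shows "\<exists>u. norm u = 1 \<and> a = of_real (norm a) *s u \<and> u = of_real (1 / norm a) *s a"
  using cip_normalize[OF assms] assms
  by (intro exI[of _ "of_real (1 / norm a) *s a"]) (simp add: vector_smult_assoc)

lemma form_scale: "Re (cip (of_real c *s u) (H *v (of_real c *s u))) = c\<^sup>2 * Re (cip u (H *v u))"
  by (simp add: mv_simps cip_simps power2_eq_square algebra_simps)

text \<open>Exchanging a unit vector of the range for one of the kernel compares the values of H on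
  the two subspaces; stationarity under rotation makes the off-diagonal blocks vanish.\<close>

lemma topproj_separates:
  fixes H :: "'n::finite cmat"
  assumes k: "1 \<le> k" "k < CARD('n)" and H: "herm H" and P: "topproj k H P"
  shows "\<exists>t. separates P H t"
proof -
  have pP: "is_proj k P" using P by (simp add: topproj_def)
  have le: "Re (cip v (H *v v)) \<le> Re (cip u (H *v u))"
    if uv: "P *v u = u" "norm u = 1" "P *v v = 0" "norm v = 1" for u v
  proof -
    have "H \<bullet> (P - outer u u + outer v v) \<le> H \<bullet> P"
      using P proj_swap[OF pP uv] by (simp add: topproj_def)
    thus ?thesis by (simp add: inner_add_right inner_diff_right inner_outer[OF H])
  qed
  have orth1: "cip u (H *v v) = 0" if uv: "P *v u = u" "norm u = 1" "P *v v = 0" "norm v = 1" for u v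
  proof -
    \<comment> \<open>One more than the radius makes the trace w strictly positive, so it can be
      cancelled from the stationarity condition.\<close>
    define s where "s = (kradius k H + 1) / real k"
    define w where "w = s * real k + H \<bullet> P"
    have sk: "s * real k = kradius k H + 1" using k by (simp add: s_def)
    have w: "w > 0" using inner_le_kradius[OF k pP H] by (simp add: w_def sk)
    have "att k (s *\<^sub>R mat 1 + H) P"
      using att_shift[OF k H, of s 0 P] P by (simp add: sk cscale_zero)
    note st = att_stationary[OF this uv(1,2)]
    have tr: "mtrace ((s *\<^sub>R mat 1 + H) ** P) = of_real w"
      using mtrace_herm[OF H is_projD(1)[OF pP]] is_projD(3)[OF pP]
      by (simp add: w_def mmult_simps mtrace_simps)
    have re: "Re (cip u (H *v v)) = 0" if v: "P *v v = 0" "norm v = 1" for v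
    proof -
      have "cip v (H *v u) = cnj (cip u (H *v v))" using H by (metis cip_adj cip_commute)
      thus ?thesis using st[OF v] w proj_orth[OF pP uv(1) v(1)]
        unfolding tr by (simp add: mv_simps cip_simps)
    qed
    have "Re (cip u (H *v v)) = 0" by (rule re[OF uv(3,4)])
    moreover have "Re (\<i> * cip u (H *v v)) = 0"
      using re[of "\<i> *s v"] uv(3,4) by (simp add: mv_simps cip_simps norm_vscale)
    ultimately show ?thesis by (simp add: complex_eq_iff)
  qed
  have orth: "cip a (H *v b) = 0" if ab: "P *v a = a" "P *v b = 0" for a b
  proof (cases "a = 0 \<or> b = 0")
    case False
    then obtain u v where "norm u = 1" "a = of_real (norm a) *s u" "u = of_real (1 / norm a) *s a"
      "norm v = 1" "b = of_real (norm b) *s v" "v = of_real (1 / norm b) *s b"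
      using ex_normalized[of a] ex_normalized[of b] by blast
    moreover from this have "P *v u = u" "P *v v = 0" using ab by (metis mv_scale, metis mv_scale vector_smult_rzero)
    ultimately have "cip u (H *v v) = 0" using orth1 by blast
    thus ?thesis using \<open>a = _\<close> \<open>b = _\<close> by (metis cip_scale_left cip_scale_right mult_zero_right mv_scale)
  qed (auto simp: cip_simps)
  have PHP: "P ** H ** P = P ** H"
    unfolding mat_eq_iff_mv
  proof
    fix z
    have "P *v (H *v (z - P *v z)) = 0"
    proof (rule eq_zero_if_cip)
      fix x
      have "cip x (P *v (H *v (z - P *v z))) = cip (P *v x) (H *v (z - P *v z))" by (rule cip_proj_swap[OF pP])
      also have "\<dots> = 0" by (rule orth) (simp_all add: mv_simps proj_mv_idem[OF pP])
      finally show "cip x (P *v (H *v (z - P *v z))) = 0" .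
    qed
    thus "(P ** H ** P) *v z = (P ** H) *v z" by (simp add: mv_simps mv_assoc)
  qed
  \<comment> \<open>PHP is Hermitian, so taking adjoints in PHP = PH gives PHP = HP.\<close>
  have "adj (P ** H ** P) = adj (P ** H)" using PHP by simp
  hence "P ** H ** P = H ** P" by (simp only: adj_mult is_projD(1)[OF pP] H matrix_mul_assoc)
  hence "P ** H = H ** P" using PHP by simp
  moreover
  obtain u0 v0 where u0: "P *v u0 = u0" "norm u0 = 1" and v0: "P *v v0 = 0" "norm v0 = 1"
    using proj_ran[OF pP k(1)] proj_ker[OF pP k(2)] by blast
  \<comment> \<open>The least possible threshold: the supremum over the kernel, which lies below
    every value on the range by \<open>le\<close>.\<close>
  define t where "t = (SUP v\<in>{v. P *v v = 0 \<and> norm v = 1}. Re (cip v (H *v v)))"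
  have bdd: "bdd_above ((\<lambda>v. Re (cip v (H *v v))) ` {v. P *v v = 0 \<and> norm v = 1})"
    by (rule bdd_aboveI[of _ "Re (cip u0 (H *v u0))"]) (use le[OF u0] in auto)
  have t1: "t \<le> Re (cip u (H *v u))" if u: "P *v u = u" "norm u = 1" for u
    unfolding t_def using v0 le[OF u] by (intro cSUP_least) auto
  have t2: "Re (cip v (H *v v)) \<le> t" if v: "P *v v = 0" "norm v = 1" for v
    unfolding t_def using v by (intro cSUP_upper[OF _ bdd]) auto
  have sc: "Re (cip z (H *v z)) = (norm z)\<^sup>2 * Re (cip u (H *v u))" if "z = of_real (norm z) *s u" for z u
    using form_scale[of "norm z" u H] that by simp
  have "t * (norm z)\<^sup>2 \<le> Re (cip z (H *v z))" if z: "P *v z = z" for z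
  proof (cases "z = 0")
    case False
    then obtain u where u: "norm u = 1" "z = of_real (norm z) *s u" "u = of_real (1 / norm z) *s z"
      using ex_normalized by blast
    have "P *v u = u" using z u(3) by (metis mv_scale)
    thus ?thesis using mult_right_mono[OF t1[OF _ u(1)], of "(norm z)\<^sup>2"] sc[OF u(2)] by (simp add: mult.commute)
  qed (simp add: cip_simps)
  moreover have "Re (cip z (H *v z)) \<le> t * (norm z)\<^sup>2" if z: "P *v z = 0" for z
  proof (cases "z = 0")
    case False
    then obtain u where u: "norm u = 1" "z = of_real (norm z) *s u" "u = of_real (1 / norm z) *s z"
      using ex_normalized by blast
    have "P *v u = 0" using z u(3) by (metis mv_scale vector_smult_rzero)
    thus ?thesis using mult_right_mono[OF t2[OF _ u(1)], of "(norm z)\<^sup>2"] sc[OF u(2)] by (simp add: mult.commute)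
  qed (simp add: cip_simps)
  ultimately show ?thesis unfolding separates_def by blast
qed

section \<open>Equality cases of spectral cuts\<close>

lemma linear_term_zero:
  fixes a b :: real
  assumes "\<And>e. 0 \<le> 2 * e * a + e\<^sup>2 * b"
  shows "a = 0"
proof (rule ccontr)
  assume "a \<noteq> 0"
  define c where "c = \<bar>b\<bar> + 1"
  have c: "c > 0" "b \<le> c" by (auto simp: c_def)
  \<comment> \<open>The vertex of the parabola with b replaced by |b| + 1, which keeps the
    denominator positive.\<close>
  have "0 \<le> 2 * (- a / c) * a + (- a / c)\<^sup>2 * b" by (rule assms)
  also have "\<dots> \<le> 2 * (- a / c) * a + (- a / c)\<^sup>2 * c"
    using c by (intro add_left_mono mult_left_mono) auto
  also have "\<dots> = - (a\<^sup>2 / c)" using c by (simp add: power2_eq_square field_simps)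
  also have "\<dots> < 0" using c \<open>a \<noteq> 0\<close> by simp
  finally show False by simp
qed

text \<open>The form is minimal at z, so its derivative in the direction w = K z, twice the squared
  norm of w, must vanish. This w stays in the range because P and K commute.\<close>

lemma psd_form_null:
  assumes K: "herm K" and PK: "P ** K = K ** P" and z: "P *v z = z"
    and psd: "\<And>w. P *v w = w \<Longrightarrow> 0 \<le> Re (cip w (K *v w))" and null: "Re (cip z (K *v z)) = 0"
  shows "K *v z = 0"
proof -
  define w where "w = K *v z"
  have Pw: "P *v w = w" using PK z by (metis mv_assoc w_def)
  have "0 \<le> 2 * e * (norm w)\<^sup>2 + e\<^sup>2 * Re (cip w (K *v w))" for e
  proof -
    have "cip z (K *v w) = cip w w" using K by (metis cip_adj w_def)
    hence "Re (cip (z + of_real e *s w) (K *v (z + of_real e *s w))) = 2 * e * (norm w)\<^sup>2 + e\<^sup>2 * Re (cip w (K *v w))"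
      using null by (simp add: mv_simps cip_simps w_def[symmetric] cip_self power2_eq_square algebra_simps)
    thus ?thesis using psd[of "z + of_real e *s w"] by (simp add: mv_simps z Pw)
  qed
  hence "(norm w)\<^sup>2 = 0" by (rule linear_term_zero)
  thus ?thesis by (simp add: w_def)
qed

lemma separates_eigen:
  assumes "herm H" "separates P H t"
  shows "P *v z = z \<Longrightarrow> Re (cip z (H *v z)) = t * (norm z)\<^sup>2 \<Longrightarrow> H *v z = of_real t *s z"
    and "P *v z = 0 \<Longrightarrow> Re (cip z (H *v z)) = t * (norm z)\<^sup>2 \<Longrightarrow> H *v z = of_real t *s z"
proof -
  have *: "H *v z = of_real t *s z"
    if "herm H" "separates P H t" "P *v z = z" "Re (cip z (H *v z)) = t * (norm z)\<^sup>2" for P H t z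
  proof -
    have "(H - t *\<^sub>R mat 1) *v z = 0"
      using that by (intro psd_form_null[of _ P])
        (auto simp: separates_def mmult_simps adj_simps mv_simps cip_simps cip_self)
    thus ?thesis by (simp add: mv_simps)
  qed
  show "P *v z = z \<Longrightarrow> Re (cip z (H *v z)) = t * (norm z)\<^sup>2 \<Longrightarrow> H *v z = of_real t *s z"
    by (rule *[OF assms])
  assume "P *v z = 0" "Re (cip z (H *v z)) = t * (norm z)\<^sup>2"
  hence "(- H) *v z = of_real (- t) *s z"
    using assms separates_compl[of P H t]
    by (intro *[of "- H" "mat 1 - P"]) (simp_all add: adj_simps mv_simps cip_simps)
  hence "- (H *v z) = - (of_real t *s z)" by (simp add: mv_minus vector_smult_lneg)
  thus "H *v z = of_real t *s z" by simp
qed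

text \<open>K is Hermitian and kills the complement of x, so K x is orthogonal to that complement
  and x is an eigenvector.\<close>

lemma herm_rank_one:
  assumes K: "herm K" and x: "norm x = 1" and z: "\<And>z. cip x z = 0 \<Longrightarrow> K *v z = 0"
  shows "\<exists>c. K = c *\<^sub>R outer x x"
proof -
  define c where "c = Re (cip x (K *v x))"
  have c: "cip x (K *v x) = of_real c" unfolding c_def by (rule cip_herm_real[OF K])
  have Kx: "K *v x = of_real c *s x"
  proof -
    have "K *v x - of_real c *s x = 0"
    proof (rule eq_zero_if_cip)
      fix z
      define w where "w = z - cip x z *s x"
      have xw: "cip x w = 0" by (simp add: w_def cip_simps cip_self x)
      hence wx: "cip w x = 0" using cip_commute[of w x] by simp
      have "cip w (K *v x) = cip (K *v w) x" by (metis K cip_adj)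
      hence wK: "cip w (K *v x) = 0" using z[OF xw] by (simp add: cip_simps)
      have zz: "z = w + cip x z *s x" by (simp add: w_def)
      show "cip z (K *v x - of_real c *s x) = 0"
        by (subst zz) (simp add: cip_simps wK wx c cip_self x)
    qed
    thus ?thesis by simp
  qed
  have "K *v z = (c *\<^sub>R outer x x) *v z" for z
  proof -
    have "cip x (z - cip x z *s x) = 0" by (simp add: cip_simps cip_self x)
    from this[THEN assms(3)] show ?thesis by (simp add: mv_simps Kx mult.commute)
  qed
  thus ?thesis using mat_eq_iff_mv by blast
qed

text \<open>The form of the sum vanishes on the complement of x. The test vectors z0 and y0 give t1
  + t2 <= 0 and t1 + t2 >= 0, so on vectors of the range or kernel orthogonal to x both summands
  meet their thresholds exactly, and H1 acts there as t1.\<close>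

lemma separates_rank_one_summand:
  assumes P: "is_proj m P" and H: "herm H1" "herm H2" and sep: "separates P H1 t1" "separates P H2 t2"
    and sum: "H1 + H2 = outer x x" and x: "norm x = 1" "P *v x = x"
    and z0: "norm z0 = 1" "P *v z0 = z0" "cip x z0 = 0" and y0: "norm y0 = 1" "P *v y0 = 0"
  shows "\<exists>c. H1 = c *\<^sub>R outer x x + t1 *\<^sub>R mat 1"
proof -
  have val: "Re (cip z (H1 *v z)) + Re (cip z (H2 *v z)) = 0" if "cip x z = 0" for z
  proof -
    have "cip z (H1 *v z) + cip z (H2 *v z) = cip z (outer x x *v z)"
      unfolding sum[symmetric] by (simp add: mv_simps cip_simps)
    thus ?thesis using that by (simp add: mv_simps cip_simps flip: plus_complex.sel)
  qed
  have xker: "cip x y = 0" if "P *v y = 0" for y using proj_orth[OF P x(2) that] by simp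
  have "t1 * (norm z0)\<^sup>2 \<le> Re (cip z0 (H1 *v z0))" "t2 * (norm z0)\<^sup>2 \<le> Re (cip z0 (H2 *v z0))"
    "Re (cip y0 (H1 *v y0)) \<le> t1 * (norm y0)\<^sup>2" "Re (cip y0 (H2 *v y0)) \<le> t2 * (norm y0)\<^sup>2"
    using sep z0 y0 unfolding separates_def by blast+
  hence t: "t2 = - t1" using val[OF z0(3)] val[OF xker[OF y0(2)]] z0(1) y0(1) by simp
  have ran: "H1 *v z = of_real t1 *s z" if z: "P *v z = z" "cip x z = 0" for z
  proof (rule separates_eigen(1)[OF H(1) sep(1) z(1)])
    have "t1 * (norm z)\<^sup>2 \<le> Re (cip z (H1 *v z))" "t2 * (norm z)\<^sup>2 \<le> Re (cip z (H2 *v z))"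
      using sep z unfolding separates_def by blast+
    thus "Re (cip z (H1 *v z)) = t1 * (norm z)\<^sup>2" using val[OF z(2)] by (simp add: t)
  qed
  have ker: "H1 *v z = of_real t1 *s z" if z: "P *v z = 0" for z
  proof (rule separates_eigen(2)[OF H(1) sep(1) z(1)])
    have "Re (cip z (H1 *v z)) \<le> t1 * (norm z)\<^sup>2" "Re (cip z (H2 *v z)) \<le> t2 * (norm z)\<^sup>2"
      using sep z unfolding separates_def by blast+
    thus "Re (cip z (H1 *v z)) = t1 * (norm z)\<^sup>2" using val[OF xker[OF z]] by (simp add: t)
  qed
  have "\<exists>c. H1 - t1 *\<^sub>R mat 1 = c *\<^sub>R outer x x"
  proof (rule herm_rank_one[OF _ x(1)])
    show "herm (H1 - t1 *\<^sub>R mat 1)" using H by (simp add: adj_simps)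
    fix z assume "cip x z = 0"
    hence "cip x (P *v z) = 0" using cip_proj_swap[OF P, of x z] x(2) by simp
    hence "H1 *v (P *v z) = of_real t1 *s (P *v z)" by (intro ran) (simp_all add: proj_mv_idem[OF P])
    moreover have "H1 *v (z - P *v z) = of_real t1 *s (z - P *v z)"
      by (intro ker) (simp add: mv_simps proj_mv_idem[OF P])
    ultimately show "(H1 - t1 *\<^sub>R mat 1) *v z = 0" by (simp add: mv_simps)
  qed
  thus ?thesis by (metis diff_add_cancel)
qed

section \<open>Extremality of rank one matrices\<close>

lemma proj_commute_outer:
  assumes P: "is_proj m P" and c: "P ** outer x x = outer x x ** P" and x: "norm x = 1"
  shows "P *v x = x \<or> P *v x = 0"
proof -
  have "(P ** outer x x) *v x = (outer x x ** P) *v x" using c by simp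
  hence e: "P *v x = cip x (P *v x) *s x" by (simp add: mv_assoc mv_simps cip_self x)
  define l where "l = cip x (P *v x)"
  have "P *v (P *v x) = (l * l) *s x" by (metis e l_def mv_scale vector_smult_assoc)
  hence "l *s x = (l * l) *s x" using proj_mv_idem[OF P] e l_def by metis
  hence "cip x (l *s x) = cip x ((l * l) *s x)" by (rule arg_cong)
  hence "l = 0 \<or> l = 1" by (simp add: cip_simps cip_self x)
  thus ?thesis using e unfolding l_def[symmetric] by auto
qed

text \<open>Commuting with \<open>outer x x\<close> leaves only P x = x or P x = 0. The wrong
  alternative would force 1 <= t <= 0, or 0 <= t <= -1 for the negative matrix.\<close>

lemma topproj_outer:
  fixes x :: "complex^'n::finite"
  assumes k: "1 \<le> k" "k < CARD('n)" and x: "norm x = 1"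
  shows "topproj k (outer x x) P \<Longrightarrow> P *v x = x" "topproj k (- outer x x) P \<Longrightarrow> P *v x = 0"
proof -
  assume P: "topproj k (outer x x) P"
  hence pP: "is_proj k P" by (simp add: topproj_def)
  obtain t where sep: "separates P (outer x x) t" using topproj_separates[OF k _ P] by (auto simp: adj_simps)
  show "P *v x = x"
  proof (rule ccontr)
    assume "\<not> ?thesis"
    hence 0: "P *v x = 0" using proj_commute_outer[OF pP _ x] sep by (auto simp: separates_def)
    obtain u where u: "norm u = 1" "P *v u = u" using proj_ran[OF pP k(1)] by blast
    have "t * (norm u)\<^sup>2 \<le> Re (cip u (outer x x *v u))" "Re (cip x (outer x x *v x)) \<le> t * (norm x)\<^sup>2"
      using sep u 0 unfolding separates_def by blast+
    thus False using proj_orth[OF pP u(2) 0] u x by (simp add: mv_simps cip_simps cip_self)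
  qed
next
  assume P: "topproj k (- outer x x) P"
  hence pP: "is_proj k P" by (simp add: topproj_def)
  obtain t where sep: "separates P (- outer x x) t" using topproj_separates[OF k _ P] by (auto simp: adj_simps)
  show "P *v x = 0"
  proof (rule ccontr)
    assume "\<not> ?thesis"
    hence 1: "P *v x = x" using proj_commute_outer[OF pP _ x] sep by (auto simp: separates_def mmult_simps)
    obtain v where v: "norm v = 1" "P *v v = 0" using proj_ker[OF pP k(2)] by blast
    have "t * (norm x)\<^sup>2 \<le> Re (cip x (- outer x x *v x))" "Re (cip v (- outer x x *v v)) \<le> t * (norm v)\<^sup>2"
      using sep v 1 unfolding separates_def by blast+
    thus False using proj_orth[OF pP 1 v(2)] v x by (simp add: mv_simps cip_simps cip_self)
  qed
qed

lemma topsum_outer: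
  fixes x :: "complex^'n::finite"
  assumes k: "1 \<le> k" "k < CARD('n)" and x: "norm x = 1"
  shows "topsum k (outer x x) = 1" "topsum k (- outer x x) = 0"
proof -
  obtain P where P: "topproj k (outer x x) P" using topproj_ex[OF k] by blast
  hence h: "herm P" using is_projD(1) by (auto simp: topproj_def)
  show "topsum k (outer x x) = 1"
    using topproj_topsum[OF P] inner_outer[OF h, of x] topproj_outer(1)[OF k x P] x
    by (simp add: inner_commute cip_self)
  obtain P where P: "topproj k (- outer x x) P" using topproj_ex[OF k] by blast
  hence h: "herm P" using is_projD(1) by (auto simp: topproj_def)
  show "topsum k (- outer x x) = 0"
    using topproj_topsum[OF P] inner_outer[OF h, of x] topproj_outer(2)[OF k x P] x
    by (simp add: inner_commute cip_simps)
qed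

lemma topsum_affine:
  fixes H :: "'n::finite cmat"
  assumes k: "1 \<le> k" "k < CARD('n)" and a: "0 \<le> a"
  shows "topsum k (a *\<^sub>R H + b *\<^sub>R mat 1) = a * topsum k H + b * real k"
proof -
  obtain P where P: "topproj k H P" using topproj_ex[OF k] by blast
  hence "is_proj k P" by (simp add: topproj_def)
  moreover have "topproj k (a *\<^sub>R H + b *\<^sub>R mat 1) P"
    using P a by (auto simp: topproj_def inner_add_left inner_one_proj mult_left_mono)
  ultimately show ?thesis using topproj_topsum[OF P] topproj_topsum[of k "a *\<^sub>R H + b *\<^sub>R mat 1" P]
    by (simp add: inner_add_left inner_one_proj)
qed

text \<open>Neither summand can exceed its own maximum, so additivity forces both to reach it at
  P.\<close>

lemma common_topproj:
  fixes H1 H2 :: "'n::finite cmat"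
  assumes k: "1 \<le> k" "k < CARD('n)" and P: "topproj k (H1 + H2) P"
    and add: "topsum k (H1 + H2) = topsum k H1 + topsum k H2"
  shows "topproj k H1 P" "topproj k H2 P"
proof -
  have pP: "is_proj k P" using P by (simp add: topproj_def)
  have "H1 \<bullet> P + H2 \<bullet> P = topsum k H1 + topsum k H2"
    using topproj_topsum[OF P] add by (simp add: inner_add_left)
  thus "topproj k H1 P" "topproj k H2 P"
    using le_topsum[OF k pP, of H1] le_topsum[OF k pP, of H2] pP by (simp_all add: topproj_iff[OF k])
qed

text \<open>The Hermitian matrices generating, modulo the scalars, extreme rays of the cones on which the
  convex function topsum is additive.\<close>

definition extremal :: "nat \<Rightarrow> 'n::finite cmat \<Rightarrow> bool" where
  "extremal k H \<longleftrightarrow> (\<forall>H1 H2. herm H1 \<longrightarrow> herm H2 \<longrightarrow> H = H1 + H2 \<longrightarrow>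
      topsum k H = topsum k H1 + topsum k H2 \<longrightarrow> (\<exists>a b. H1 = a *\<^sub>R H + b *\<^sub>R mat 1))"

lemma ex_orthogonal_in_range:
  assumes P: "is_proj m P" "2 \<le> m" and x: "norm x = 1" "P *v x = x"
  shows "\<exists>z. norm z = 1 \<and> P *v z = z \<and> cip x z = 0"
proof -
  obtain m' where m: "m = Suc m'" "1 \<le> m'" using P(2) by (cases m) auto
  have E: "is_proj m' (P - outer x x)" using proj_sub[OF P(1)[unfolded m] x(2,1)] .
  obtain z where z: "norm z = 1" "(P - outer x x) *v z = z" using proj_ran[OF E m(2)] by blast
  have "(P - outer x x) *v x = 0" using x by (simp add: mv_simps cip_self)
  hence "cip x z = 0" using proj_orth[OF E z(2)] by simp
  thus ?thesis using z by (auto simp: mv_simps)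
qed

text \<open>Rank at least 2 provides the range vector orthogonal to x that
  \<open>separates_rank_one_summand\<close> asks for.\<close>

lemma extremal_outer:
  fixes x :: "complex^'n::finite"
  assumes k: "2 \<le> k" "k < CARD('n)" and x: "norm x = 1"
  shows "extremal k (outer x x)"
  unfolding extremal_def
proof (intro allI impI)
  fix H1 H2 :: "'n cmat"
  assume H: "herm H1" "herm H2" "outer x x = H1 + H2" "topsum k (outer x x) = topsum k H1 + topsum k H2"
  have k1: "1 \<le> k" using k by simp
  obtain P where P: "topproj k (outer x x) P" using topproj_ex[OF k1 k(2)] by blast
  hence pP: "is_proj k P" and Px: "P *v x = x" using topproj_outer(1)[OF k1 k(2) x] by (auto simp: topproj_def)
  have "topproj k H1 P" "topproj k H2 P" using common_topproj[OF k1 k(2)] P H by metis+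
  then obtain t1 t2 where "separates P H1 t1" "separates P H2 t2"
    using topproj_separates[OF k1 k(2)] H by meson
  moreover obtain z where "norm z = 1" "P *v z = z" "cip x z = 0"
    using ex_orthogonal_in_range[OF pP k(1) x Px] by blast
  moreover obtain y where "norm y = 1" "P *v y = 0" using proj_ker[OF pP k(2)] by blast
  ultimately show "\<exists>a b. H1 = a *\<^sub>R outer x x + b *\<^sub>R mat 1"
    using separates_rank_one_summand[OF pP H(1,2) _ _ H(3)[symmetric] x Px] by blast
qed

text \<open>The argument of \<open>extremal_outer\<close> for I - P and the negated summands; the
  bound on n - k gives a second vector in the kernel of P.\<close>

lemma extremal_neg_outer:
  fixes x :: "complex^'n::finite"
  assumes k: "1 \<le> k" "2 \<le> CARD('n) - k" and x: "norm x = 1"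
  shows "extremal k (- outer x x)"
  unfolding extremal_def
proof (intro allI impI)
  fix H1 H2 :: "'n cmat"
  assume H: "herm H1" "herm H2" "- outer x x = H1 + H2" "topsum k (- outer x x) = topsum k H1 + topsum k H2"
  have k2: "k < CARD('n)" using k by simp
  obtain P where P: "topproj k (- outer x x) P" using topproj_ex[OF k(1) k2] by blast
  hence pP: "is_proj k P" and Px: "P *v x = 0" using topproj_outer(2)[OF k(1) k2 x] by (auto simp: topproj_def)
  define P' where "P' = mat 1 - P"
  have pP': "is_proj (CARD('n) - k) P'" and Px': "P' *v x = x"
    using proj_compl[OF pP] k2 Px by (simp_all add: P'_def mv_simps)
  have "topproj k H1 P" "topproj k H2 P" using common_topproj[OF k(1) k2] P H by metis+
  then obtain t1 t2 where "separates P H1 t1" "separates P H2 t2"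
    using topproj_separates[OF k(1) k2] H by meson
  hence "separates P' (- H1) (- t1)" "separates P' (- H2) (- t2)"
    unfolding P'_def by (simp_all add: separates_compl)
  moreover obtain z where "norm z = 1" "P' *v z = z" "cip x z = 0"
    using ex_orthogonal_in_range[OF pP' k(2) x Px'] by blast
  moreover obtain y where "norm y = 1" "P' *v y = 0" using proj_ran[OF pP k(1)] by (auto simp: P'_def mv_simps)
  moreover have "herm (- H1)" "herm (- H2)" using H(1,2) by (simp_all add: adj_simps)
  moreover have "- H1 + - H2 = outer x x" using arg_cong[OF H(3), of uminus] by simp
  ultimately obtain c where "- H1 = c *\<^sub>R outer x x + (- t1) *\<^sub>R mat 1"
    using separates_rank_one_summand[OF pP' _ _ _ _ _ x Px'] by blast
  hence "- (- H1) = - (c *\<^sub>R outer x x + (- t1) *\<^sub>R mat 1)" by (rule arg_cong)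
  hence "H1 = c *\<^sub>R (- outer x x) + t1 *\<^sub>R mat 1" by simp
  thus "\<exists>a b. H1 = a *\<^sub>R (- outer x x) + b *\<^sub>R mat 1" by blast
qed

text \<open>A maximiser x of the form on the unit sphere of the range is an eigenvector for the
  largest eigenvalue l there. Subtracting (l - t) \<open>outer x x\<close> lowers this eigenvalue
  exactly to t, so the cut at t survives.\<close>

lemma separates_peel:
  fixes H :: "'n::finite cmat"
  assumes P: "is_proj m P" and H: "herm H" and sep: "separates P H t"
    and u: "norm u = 1" "P *v u = u" "t < Re (cip u (H *v u))"
  shows "\<exists>x a. norm x = 1 \<and> 0 < a \<and> separates P (a *\<^sub>R outer x x) 0 \<and> separates P (H - a *\<^sub>R outer x x) t"
proof -
  define C where "C = sphere 0 1 \<inter> {z. P *v z = z}"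
  have "closed {z. P *v z = z}"
    unfolding matrix_vector_mult_def vec_eq_iff vec_lambda_beta
    by (intro closed_Collect_all closed_Collect_eq continuous_intros)
  hence "compact C" unfolding C_def by (intro compact_Int_closed) auto
  moreover have "continuous_on C (\<lambda>z. Re (cip z (H *v z)))"
    unfolding cip_def matrix_vector_mult_def vec_lambda_beta by (intro continuous_intros)
  moreover have "u \<in> C" using u by (simp add: C_def)
  ultimately obtain x where x: "x \<in> C" "\<And>z. z \<in> C \<Longrightarrow> Re (cip z (H *v z)) \<le> Re (cip x (H *v x))"
    using continuous_attains_sup[of C "\<lambda>z. Re (cip z (H *v z))"] by blast
  define l where "l = Re (cip x (H *v x))"
  have xx: "norm x = 1" "P *v x = x" using x by (simp_all add: C_def)
  have l: "t < l" using x(2)[OF \<open>u \<in> C\<close>] u by (simp add: l_def)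
  have max: "Re (cip z (H *v z)) \<le> l * (norm z)\<^sup>2" if z: "P *v z = z" for z
  proof (cases "z = 0")
    case False
    then obtain w where w: "norm w = 1" "z = of_real (norm z) *s w" "w = of_real (1 / norm z) *s z"
      using ex_normalized by blast
    have "P *v w = w" using z w(3) by (metis mv_scale)
    hence "Re (cip w (H *v w)) \<le> l" using x(2)[of w] w(1) by (simp add: C_def l_def)
    moreover have "Re (cip z (H *v z)) = (norm z)\<^sup>2 * Re (cip w (H *v w))"
      using form_scale[of "norm z" w H] w(2) by simp
    ultimately show ?thesis using mult_right_mono[of _ l "(norm z)\<^sup>2"] by (simp add: mult.commute)
  qed (simp add: cip_simps)
  have PH: "P ** H = H ** P" using sep by (simp add: separates_def)
  have "(l *\<^sub>R mat 1 - H) *v x = 0"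
    using max H PH xx by (intro psd_form_null[of _ P])
       (auto simp: mmult_simps adj_simps mv_simps cip_simps cip_self l_def)
  hence Hx: "H *v x = of_real l *s x" by (simp add: mv_simps)
  define a where "a = l - t"
  have Po: "P ** outer x x = outer x x ** P" using xx is_projD(1)[OF P] by (simp add: mult_outer outer_mult)
  have qo: "Re (cip z ((a *\<^sub>R outer x x) *v z)) = a * (cmod (cip x z))\<^sup>2" for z
  proof -
    have "cip z ((a *\<^sub>R outer x x) *v z) = of_real a * (cip x z * cnj (cip x z))"
      using cip_commute[of z x] by (simp add: mv_simps cip_simps)
    thus ?thesis unfolding complex_norm_square[symmetric] by (simp del: of_real_power)
  qed
  have "separates P (a *\<^sub>R outer x x) 0"
    unfolding separates_def qo using Po l proj_orth[OF P xx(2)]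
    by (auto simp: mmult_simps a_def)
  moreover have "separates P (H - a *\<^sub>R outer x x) t"
    unfolding separates_def mv_diff cip_diff_right minus_complex.sel qo
  proof (intro conjI allI impI)
    show "P ** (H - a *\<^sub>R outer x x) = (H - a *\<^sub>R outer x x) ** P" using PH Po by (simp add: mmult_simps)
    fix z assume "P *v z = 0"
    thus "Re (cip z (H *v z)) - a * (cmod (cip x z))\<^sup>2 \<le> t * (norm z)\<^sup>2"
      using sep proj_orth[OF P xx(2), of z] by (simp add: separates_def)
  next
    fix z assume z: "P *v z = z"
    \<comment> \<open>H x is a multiple of x and w is orthogonal to x, so the form of H is additive
      on this splitting.\<close>
    define c w where "c = cip x z" and "w = z - c *s x"
    have xw: "cip x w = 0" by (simp add: w_def c_def cip_simps cip_self xx)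
    hence wx: "cip w x = 0" using cip_commute[of w x] by simp
    have zz: "z = c *s x + w" by (simp add: w_def)
    have Pw: "P *v w = w" by (simp add: w_def mv_simps z xx)
    have xHw: "cip x (H *v w) = 0" using xw H Hx cip_adj[of x H w] by (simp add: cip_simps)
    have cc: "cnj c * c = of_real ((cmod c)\<^sup>2)" unfolding complex_norm_square by simp
    have "cip z (H *v z) = of_real l * (cnj c * c) + cip w (H *v w)"
      unfolding zz by (simp add: mv_simps cip_simps Hx xHw wx cip_self xx)
    hence 1: "Re (cip z (H *v z)) = l * (cmod c)\<^sup>2 + Re (cip w (H *v w))" unfolding cc by (simp del: of_real_power)
    have "cip z z = cnj c * c + cip w w"
      unfolding zz by (simp add: cip_simps xw wx cip_self[of x] xx)
    hence 2: "(norm z)\<^sup>2 = (cmod c)\<^sup>2 + (norm w)\<^sup>2"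
      unfolding cc cip_self of_real_add[symmetric] of_real_eq_iff .
    have "t * (norm w)\<^sup>2 \<le> Re (cip w (H *v w))" using sep Pw by (simp add: separates_def)
    thus "t * (norm z)\<^sup>2 \<le> Re (cip z (H *v z)) - a * (cmod (cip x z))\<^sup>2"
      unfolding 1 2 a_def c_def[symmetric] by (simp add: algebra_simps)
  qed
  moreover have "0 < a" using l by (simp add: a_def)
  ultimately show ?thesis using xx(1) by blast
qed

lemma outer_not_scalar:
  fixes x :: "complex^'n::finite"
  assumes n: "2 \<le> CARD('n)" and x: "norm x = 1" and a: "a \<noteq> 0"
  shows "a *\<^sub>R outer x x \<noteq> b *\<^sub>R mat 1"
proof
  assume e: "a *\<^sub>R outer x x = b *\<^sub>R mat 1"
  have "is_proj 1 (outer x x)" using x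
    by (intro is_projI) (simp_all add: adj_simps mult_outer outer_simps mv_simps mtrace_simps cip_self)
  then obtain z where z: "norm z = 1" "outer x x *v z = 0" using proj_ker[of 1 "outer x x"] n by auto
  have "(a *\<^sub>R outer x x) *v z = (b *\<^sub>R mat 1) *v z" using e by simp
  hence "b = 0" using z by (auto simp: mv_simps)
  hence "outer x x = 0" using e a by simp
  hence "mtrace (outer x x) = 0" by (simp add: mtrace_simps)
  thus False using x by (simp add: mtrace_simps cip_self)
qed

text \<open>An eigenvalue away from the cut can be peeled off as a summand with the same top
  projection; extremality then ties H to that rank one matrix. If no eigenvalue is off the cut, H is
  scalar.\<close>

lemma extremal_form:
  fixes H :: "'n::finite cmat"
  assumes k: "1 \<le> k" "k < CARD('n)" and H: "herm H" and ext: "extremal k H"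
  shows "\<exists>x a b. norm x = 1 \<and> H = a *\<^sub>R outer x x + b *\<^sub>R mat 1"
proof -
  obtain P where P: "topproj k H P" using topproj_ex[OF k] by blast
  hence pP: "is_proj k P" by (simp add: topproj_def)
  obtain t where sep: "separates P H t" using topproj_separates[OF k H P] by blast
  have hx: "herm (a *\<^sub>R outer x x)" for a and x :: "complex^'n" by (simp add: adj_simps)
  have peel: "\<exists>x a b. norm x = 1 \<and> H = a *\<^sub>R outer x x + b *\<^sub>R mat 1"
    if x: "norm x = 1" "a \<noteq> 0" "separates P (a *\<^sub>R outer x x) s" "separates P (H - a *\<^sub>R outer x x) t" for x a s
  proof -
    have h2: "herm (H - a *\<^sub>R outer x x)" using H by (simp add: adj_simps)
    have "topproj k (a *\<^sub>R outer x x) P" by (rule separates_topproj[OF k(2) pP hx x(3)])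
    moreover have "topproj k (H - a *\<^sub>R outer x x) P" by (rule separates_topproj[OF k(2) pP h2 x(4)])
    ultimately have "topsum k H = topsum k (a *\<^sub>R outer x x) + topsum k (H - a *\<^sub>R outer x x)"
      using topproj_topsum[OF P] topproj_topsum[of k "a *\<^sub>R outer x x" P]
        topproj_topsum[of k "H - a *\<^sub>R outer x x" P] by (simp add: inner_diff_left)
    then obtain p q where pq: "a *\<^sub>R outer x x = p *\<^sub>R H + q *\<^sub>R mat 1"
      using ext hx h2 unfolding extremal_def by (metis add.commute diff_add_cancel)
    \<comment> \<open>Otherwise a nonzero multiple of \<open>outer x x\<close> would be
      scalar.\<close>
    have "p \<noteq> 0" using pq outer_not_scalar[OF _ x(1,2), of q] k by auto
    hence "H = (1/p) *\<^sub>R (a *\<^sub>R outer x x - q *\<^sub>R mat 1)" by (simp add: pq)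
    hence "H = (a/p) *\<^sub>R outer x x + (- q/p) *\<^sub>R mat 1" by (simp add: scaleR_diff_right)
    thus ?thesis using x(1) by blast
  qed
  show ?thesis
  proof (cases "\<exists>u. norm u = 1 \<and> P *v u = u \<and> t < Re (cip u (H *v u))")
    case True
    then obtain x a where "norm x = 1" "0 < a" "separates P (a *\<^sub>R outer x x) 0" "separates P (H - a *\<^sub>R outer x x) t"
      using separates_peel[OF pP H sep] by blast
    thus ?thesis using peel[of x a 0] by simp
  next
    case ran: False
    show ?thesis
    proof (cases "\<exists>v. norm v = 1 \<and> P *v v = 0 \<and> Re (cip v (H *v v)) < t")
      case True
      then obtain v where v: "norm v = 1" "P *v v = 0" "Re (cip v (H *v v)) < t" by blast
      have "is_proj (CARD('n) - k) (mat 1 - P)" using proj_compl[OF pP] k by simp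
      moreover have "herm (- H)" using H by (simp add: adj_simps)
      moreover note separates_compl[OF sep]
      moreover have "(mat 1 - P) *v v = v" "- t < Re (cip v (- H *v v))" using v by (simp_all add: mv_simps cip_simps)
      ultimately obtain x a where x: "norm x = 1" "0 < a" "separates (mat 1 - P) (a *\<^sub>R outer x x) 0"
        "separates (mat 1 - P) (- H - a *\<^sub>R outer x x) (- t)"
        using separates_peel v(1) by blast
      \<comment> \<open>The peeled eigenvalue lies below t, so for H itself the coefficient is -
        a.\<close>
      have "separates P ((- a) *\<^sub>R outer x x) 0"
        using x(3) separates_compl_iff[of P "(- a) *\<^sub>R outer x x" 0] by simp
      moreover have "separates P (H - (- a) *\<^sub>R outer x x) t"
        using x(4) separates_compl_iff[of P "H - (- a) *\<^sub>R outer x x" t] by simp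
      ultimately show ?thesis using peel[of x "- a" 0] x(1,2) by simp
    next
      case ker: False
      obtain u where u: "norm u = 1" "P *v u = u" using proj_ran[OF pP k(1)] by blast
      have eq: "Re (cip z (H *v z)) = t * (norm z)\<^sup>2" if z: "P *v z = z \<or> P *v z = 0" for z
      proof (cases "z = 0")
        case False
        then obtain w where w: "norm w = 1" "z = of_real (norm z) *s w" "w = of_real (1 / norm z) *s z"
          using ex_normalized by blast
        have "P *v w = w \<or> P *v w = 0" using z w(3) by (metis mv_scale vector_smult_rzero)
        hence "Re (cip w (H *v w)) = t" using ran ker sep w(1) unfolding separates_def
          by (metis mult.right_neutral not_less antisym one_power2)
        moreover have "Re (cip z (H *v z)) = (norm z)\<^sup>2 * Re (cip w (H *v w))"
          using form_scale[of "norm z" w H] w(2) by simp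
        ultimately show ?thesis by simp
      qed (simp add: cip_simps)
      have "H *v z = (t *\<^sub>R mat 1) *v z" for z
      proof -
        have "H *v (P *v z) = of_real t *s (P *v z)"
          by (intro separates_eigen(1)[OF H sep] eq) (simp_all add: proj_mv_idem[OF pP])
        moreover have "H *v (z - P *v z) = of_real t *s (z - P *v z)"
          by (intro separates_eigen(2)[OF H sep] eq) (simp_all add: mv_simps proj_mv_idem[OF pP])
        ultimately show ?thesis by (simp add: mv_simps)
      qed
      hence "H = 0 *\<^sub>R outer u u + t *\<^sub>R mat 1" using mat_eq_iff_mv by auto
      thus ?thesis using u by blast
    qed
  qed
qed

lemma proj_one_outer:
  assumes "is_proj 1 P"
  shows "\<exists>z. norm z = 1 \<and> P = outer z z"
proof -
  obtain z where z: "norm z = 1" "P *v z = z" using proj_ran[OF assms] by auto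
  have "is_proj 0 (P - outer z z)" using proj_sub[of 0 P z] assms z by simp
  hence "P - outer z z = 0" using proj_norm by fastforce
  thus ?thesis using z by auto
qed

text \<open>Covers n = 2, k = 1, which neither extremality lemma reaches: a top projection and its
  complement both have rank one and diagonalise H.\<close>

lemma herm_two_form:
  fixes H :: "'n::finite cmat"
  assumes n: "CARD('n) = 2" and H: "herm H"
  shows "\<exists>x a b. norm x = 1 \<and> H = a *\<^sub>R outer x x + b *\<^sub>R mat 1"
proof -
  have k: "1 \<le> (1::nat)" "1 < CARD('n)" using n by auto
  obtain P where P: "topproj 1 H P" using topproj_ex[OF k] by blast
  hence pP: "is_proj 1 P" by (simp add: topproj_def)
  obtain t where sep: "separates P H t" using topproj_separates[OF k H P] by blast
  hence PH: "P ** H = H ** P" by (simp add: separates_def)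
  have rank: "\<exists>l. H ** outer x x = l *\<^sub>R outer x x" if x: "norm x = 1" "outer x x ** H = H ** outer x x" for x
  proof -
    have "outer x (H *v x) = outer (H *v x) x" using x(2) H by (simp add: mult_outer outer_mult)
    hence "outer x (H *v x) *v x = outer (H *v x) x *v x" by simp
    hence "H *v x = cip (H *v x) x *s x" using x by (simp add: mv_simps cip_self)
    moreover have "cip (H *v x) x = of_real (Re (cip x (H *v x)))"
      using cip_herm_real[OF H, of x] H cip_adj[of x H x] by simp
    ultimately have "H ** outer x x = Re (cip x (H *v x)) *\<^sub>R outer x x"
      by (metis mult_outer outer_scale_left cscale_of_real)
    thus ?thesis by blast
  qed
  obtain x where x: "norm x = 1" "P = outer x x" using proj_one_outer[OF pP] by blast
  have "is_proj 1 (mat 1 - P)" using proj_compl[OF pP] n by simp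
  then obtain y where y: "norm y = 1" "mat 1 - P = outer y y" using proj_one_outer by blast
  obtain l where l: "H ** outer x x = l *\<^sub>R outer x x" using rank[OF x(1)] PH x(2) by auto
  have "outer y y ** H = H ** outer y y" using PH unfolding y(2)[symmetric] by (simp add: mmult_simps)
  then obtain m where m: "H ** outer y y = m *\<^sub>R outer y y" using rank[OF y(1)] by auto
  have "H = H ** outer x x + H ** outer y y"
    unfolding x(2)[symmetric] y(2)[symmetric] by (simp add: mmult_simps)
  also have "\<dots> = l *\<^sub>R P + m *\<^sub>R (mat 1 - P)" unfolding l m by (simp only: x(2)[symmetric] y(2)[symmetric])
  also have "\<dots> = (l - m) *\<^sub>R outer x x + m *\<^sub>R mat 1" by (simp add: x(2) algebra_simps)
  finally show ?thesis using x(1) by blast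
qed

section \<open>Images of rank one projections\<close>

lemma continuous_outer: "continuous_on S (\<lambda>x. outer x (x::complex^'n::finite))"
  unfolding outer_def by (intro continuous_intros continuous_on_vec_lambda)

text \<open>Traces give n = 2k, and the form at y gives 1/k = 1 + |<z,y>|^2, hence k = 1. So the two
  kinds of image can meet only when n = 2.\<close>

lemma outer_eq_compl_outer:
  fixes y z :: "complex^'n::finite"
  assumes k: "1 \<le> k" and y: "norm y = 1" and z: "norm z = 1"
    and eq: "outer y y = (1 / real k) *\<^sub>R mat 1 - outer z z"
  shows "CARD('n) = 2"
proof -
  have tr: "real CARD('n) = 2 * real k"
  proof -
    have "mtrace (outer y y) = mtrace ((1 / real k) *\<^sub>R mat 1 - outer z z)" using eq by simp
    hence "complex_of_real (real CARD('n)) = of_real (2 * real k)"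
      using k y z by (simp add: mtrace_simps cip_self field_simps)
    thus ?thesis using of_real_eq_iff by blast
  qed
  have "cip y (outer y y *v y) = cip y (((1 / real k) *\<^sub>R mat 1 - outer z z) *v y)" using eq by simp
  hence "complex_of_real 1 = of_real (1 / real k - (cmod (cip z y))\<^sup>2)"
    unfolding of_real_diff complex_norm_square
    using y cip_commute[of y z] by (simp add: mv_simps cip_simps cip_self)
  hence "1 / real k = 1 + (cmod (cip z y))\<^sup>2" unfolding of_real_eq_iff by simp
  hence "1 \<le> 1 / real k" by simp
  hence "k = 1" using k by (simp add: field_simps)
  thus ?thesis using tr by simp
qed

context parallel_preserver
begin

lemma T_inj: "T A = T B \<Longrightarrow> A = B"
  using bij by (metis bij_pointE)

text \<open>T is a bijection of the Hermitian matrices that fixes the identity and preserves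
  \<open>topsum\<close>, so decompositions of T H pull back to decompositions of H.\<close>

lemma extremal_T:
  assumes H: "herm H" and ext: "extremal k H"
  shows "extremal k (T H)"
  unfolding extremal_def
proof (intro allI impI)
  fix K1 K2
  assume K: "herm K1" "herm K2" "T H = K1 + K2" "topsum k (T H) = topsum k K1 + topsum k K2"
  obtain X1 X2 where X: "herm X1" "T X1 = K1" "herm X2" "T X2 = K2"
    using T_surj_herm K by metis
  have "H = X1 + X2" by (rule T_inj) (simp only: T_add X K(3))
  moreover have "topsum k H = topsum k X1 + topsum k X2"
    using K(4) X topsum_T[OF H] topsum_T[OF X(1)] topsum_T[OF X(3)] by simp
  ultimately obtain a b where "X1 = a *\<^sub>R H + b *\<^sub>R mat 1"
    using ext X unfolding extremal_def by blast
  hence "K1 = a *\<^sub>R T H + b *\<^sub>R mat 1" unfolding X(2)[symmetric] by (simp add: T_simps)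
  thus "\<exists>a b. K1 = a *\<^sub>R T H + b *\<^sub>R mat 1" by blast
qed

lemma T_outer_affine:
  assumes x: "norm x = 1"
  shows "\<exists>y a b. norm y = 1 \<and> T (outer x x) = a *\<^sub>R outer y y + b *\<^sub>R mat 1"
proof -
  have h: "herm (outer x x)" "herm (- outer x x)" by (simp_all add: adj_simps)
  consider "2 \<le> k" | "2 \<le> CARD('n) - k" | "CARD('n) = 2" using k by linarith
  thus ?thesis
  proof cases
    case 1
    show ?thesis
      by (rule extremal_form[OF k herm_T[OF h(1)] extremal_T[OF h(1) extremal_outer[OF 1 k(2) x]]])
  next
    case 2
    obtain y a b where y: "norm y = 1" "T (- outer x x) = a *\<^sub>R outer y y + b *\<^sub>R mat 1"
      using extremal_form[OF k herm_T[OF h(2)] extremal_T[OF h(2) extremal_neg_outer[OF k(1) 2 x]]] by blast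
    from y(2) have "- T (- outer x x) = (- a) *\<^sub>R outer y y + (- b) *\<^sub>R mat 1" by simp
    hence "T (outer x x) = (- a) *\<^sub>R outer y y + (- b) *\<^sub>R mat 1" by (simp add: T_minus)
    thus ?thesis using y(1) by blast
  next
    case 3
    show ?thesis by (rule herm_two_form[OF 3 herm_T[OF h(1)]])
  qed
qed

text \<open>T preserves the values 1 and 0 of \<open>topsum\<close> at \<open>outer x x\<close> and
  its negative. By \<open>topsum_affine\<close> these are two linear equations for a and b; the sign
  of a selects the system, with solutions (1, 0) and (-1, 1/k).\<close>

lemma T_outer_cases:
  assumes x: "norm x = 1"
  shows "\<exists>y. norm y = 1 \<and> (T (outer x x) = outer y y \<or> T (outer x x) = (1 / real k) *\<^sub>R mat 1 - outer y y)"
proof -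
  have h: "herm (outer x x)" "herm (- outer x x)" by (simp_all add: adj_simps)
  obtain y a b where y: "norm y = 1" "T (outer x x) = a *\<^sub>R outer y y + b *\<^sub>R mat 1"
    using T_outer_affine[OF x] by blast
  have s1: "topsum k (a *\<^sub>R outer y y + b *\<^sub>R mat 1) = 1"
    using topsum_T[OF h(1)] topsum_outer(1)[OF k x] y(2) by simp
  have s2: "topsum k (a *\<^sub>R (- outer y y) + (- b) *\<^sub>R mat 1) = 0"
    using topsum_T[OF h(2)] topsum_outer(2)[OF k x] y(2) by (simp add: T_minus)
  show ?thesis
  proof (cases "0 \<le> a")
    case True
    have "a + b * real k = 1" "- b * real k = 0"
      using s1 s2 unfolding topsum_affine[OF k True] topsum_outer[OF k y(1)] by simp_all
    hence "a = 1" "b = 0" using k by simp_all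
    thus ?thesis using y by auto
  next
    case False
    hence a: "0 \<le> - a" by simp
    have "topsum k ((- a) *\<^sub>R (- outer y y) + b *\<^sub>R mat 1) = 1" "topsum k ((- a) *\<^sub>R outer y y + (- b) *\<^sub>R mat 1) = 0"
      using s1 s2 by simp_all
    hence "b * real k = 1" "- a - b * real k = 0"
      unfolding topsum_affine[OF k a] topsum_outer[OF k y(1)] by simp_all
    hence "a = - 1" "b = 1 / real k" using k by (simp_all add: field_simps)
    hence "T (outer x x) = (1 / real k) *\<^sub>R mat 1 - outer y y" using y by simp
    thus ?thesis using y by blast
  qed
qed

lemma continuous_T: "continuous_on S' T"
proof -
  have "linear T" by (rule linearI) (simp_all add: T_simps)
  thus ?thesis by (simp add: linear_continuous_on linear_linear)
qed

text \<open>The two alternatives cut out disjoint closed subsets of the unit sphere, which is connected.\<close>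

lemma T_outer_uniform:
  "(\<forall>x. norm x = 1 \<longrightarrow> (\<exists>y. norm y = 1 \<and> T (outer x x) = outer y y)) \<or>
   (CARD('n) > 2 \<and> (\<forall>x. norm x = 1 \<longrightarrow> (\<exists>y. norm y = 1 \<and> T (outer x x) = (1 / real k) *\<^sub>R mat 1 - outer y y)))"
proof (cases "CARD('n) = 2")
  case True
  \<comment> \<open>For n = 2 the complement of a rank one projection has rank one, so the second
    alternative is an instance of the first.\<close>
  have "\<exists>z. norm z = 1 \<and> (1 / real k) *\<^sub>R mat 1 - outer y y = outer z z" if y: "norm y = 1" for y :: "complex^'n"
  proof -
    have k1: "k = 1" using k True by simp
    have "is_proj 1 (outer y y)" using y
      by (intro is_projI) (simp_all add: adj_simps mult_outer outer_simps mv_simps mtrace_simps cip_self)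
    hence "is_proj 1 (mat 1 - outer y y)" using proj_compl[of 1 "outer y y"] True by simp
    thus ?thesis using proj_one_outer k1 by fastforce
  qed
  hence "\<forall>x. norm x = 1 \<longrightarrow> (\<exists>y. norm y = 1 \<and> T (outer x x) = outer y y)"
    using T_outer_cases by metis
  thus ?thesis by blast
next
  case False
  hence n: "CARD('n) > 2" using k by linarith
  define R1 where "R1 = (\<lambda>y::complex^'n. outer y y) ` sphere 0 1"
  define R2 where "R2 = (\<lambda>y::complex^'n. (1 / real k) *\<^sub>R mat 1 - outer y y) ` sphere 0 1"
  have "compact R1" "compact R2" unfolding R1_def R2_def
    by (intro compact_continuous_image continuous_intros continuous_outer compact_sphere)+
  hence cl: "closed R1" "closed R2" by (simp_all add: compact_imp_closed)
  define F where "F x = T (outer x x)" for x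
  have "continuous_on UNIV F" unfolding F_def
    using continuous_on_compose[OF continuous_outer continuous_T] by (simp add: o_def)
  hence clF: "closed (F -` R1)" "closed (F -` R2)" using cl by (auto intro: closed_vimage)
  have cover: "sphere 0 1 \<subseteq> F -` R1 \<union> F -` R2"
    using T_outer_cases unfolding R1_def R2_def F_def by fastforce
  have "R1 \<inter> R2 = {}" using outer_eq_compl_outer[OF k(1)] False unfolding R1_def R2_def by fastforce
  hence disj: "F -` R1 \<inter> F -` R2 \<inter> sphere 0 1 = {}" by blast
  have "2 \<le> DIM(complex^'n)" by (simp add: Suc_le_eq)
  hence "connected (sphere (0::complex^'n) 1)" by (rule connected_sphere)
  hence "F -` R1 \<inter> sphere 0 1 = {} \<or> F -` R2 \<inter> sphere 0 1 = {}"
    using clF cover disj unfolding connected_closed by blast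
  thus ?thesis
  proof
    assume "F -` R1 \<inter> sphere 0 1 = {}"
    hence "\<forall>x\<in>sphere 0 1. F x \<in> R2" using cover by blast
    thus ?thesis using n unfolding R2_def F_def by fastforce
  next
    assume "F -` R2 \<inter> sphere 0 1 = {}"
    hence "\<forall>x\<in>sphere 0 1. F x \<in> R1" using cover by blast
    thus ?thesis unfolding R1_def F_def by fastforce
  qed
qed

end

section \<open>Rank one preservers\<close>

lemma sum_outer_axis: "(\<Sum>i\<in>UNIV. outer (axis i 1) (axis i 1)) = (mat 1 :: 'n::finite cmat)"
proof -
  have "(\<Sum>i\<in>UNIV. axis i 1 $ a * cnj (axis i (1::complex) $ b)) = (if a = b then 1 else 0)" for a b :: 'n
  proof -
    have "(\<Sum>i\<in>UNIV. axis i 1 $ a * cnj (axis i (1::complex) $ b)) = (\<Sum>i\<in>UNIV. if i = a then (if a = b then 1 else 0) else 0)"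
      by (rule sum.cong) (auto simp: axis_def)
    thus ?thesis by simp
  qed
  thus ?thesis by (simp add: vec_eq_iff outer_def mat_def)
qed

lemma clinear_sum:
  assumes "clinear_map D"
  shows "D (sum g I) = (\<Sum>i\<in>I. D (g i))"
proof -
  have "D 0 = 0" using assms by (metis clinear_map_def cscale_zero)
  thus ?thesis using assms
    by (induction I rule: infinite_finite_induct) (simp_all add: clinear_map_def)
qed

text \<open>The situation after a unitary conjugation that makes D fix the diagonal matrix units.
  Vectors in \<open>pres\<close> are not normalised, because e_i + \<omega> e_j and the all-ones
  vector serve as tests.\<close>

locale rank_one_normalized =
  fixes D :: "'n::finite cmat \<Rightarrow> 'n cmat"
  assumes lin: "clinear_map D"
    and diag: "D (outer (axis i 1) (axis i 1)) = outer (axis i 1) (axis i 1)"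
    and pres: "\<exists>y. D (outer x x) = outer y y"
begin

definition e :: "'n \<Rightarrow> complex^'n" where "e i = axis i 1"

lemma e_nth: "e i $ j = (if j = i then 1 else 0)"
  by (simp add: e_def axis_def)

lemma D_add: "D (A + B) = D A + D B" and D_cscale: "D (cscale c A) = cscale c (D A)"
  using lin by (auto simp: clinear_map_def)

lemma D_nth: "D A $ l $ m = (\<Sum>(i,j)\<in>UNIV. A $ i $ j * D (outer (e i) (e j)) $ l $ m)"
proof -
  have "A = (\<Sum>(i,j)\<in>UNIV. cscale (A $ i $ j) (outer (e i) (e j)))"
  proof -
    have "(\<Sum>p\<in>UNIV. A $ fst p $ snd p * (e (fst p) $ a * cnj (e (snd p) $ b))) = A $ a $ b" for a b
    proof -
      have "(\<Sum>p\<in>UNIV. A $ fst p $ snd p * (e (fst p) $ a * cnj (e (snd p) $ b)))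
          = (\<Sum>p\<in>UNIV. if p = (a,b) then A $ a $ b else 0)"
        by (rule sum.cong) (auto simp: e_nth)
      thus ?thesis by simp
    qed
    thus ?thesis by (simp add: vec_eq_iff case_prod_beta cscale_def outer_def)
  qed
  hence "D A = D (\<Sum>(i,j)\<in>UNIV. cscale (A $ i $ j) (outer (e i) (e j)))" by simp
  also have "\<dots> = (\<Sum>(i,j)\<in>UNIV. cscale (A $ i $ j) (D (outer (e i) (e j))))"
    by (simp add: clinear_sum[OF lin] case_prod_beta D_cscale)
  finally have "D A = (\<Sum>(i,j)\<in>UNIV. cscale (A $ i $ j) (D (outer (e i) (e j))))" .
  thus ?thesis by (simp add: case_prod_beta) (simp add: cscale_def)
qed

lemma D_pair:
  "D (outer (e i + \<omega> *s e j) (e i + \<omega> *s e j)) $ l $ m = outer (e i) (e i) $ l $ m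
     + of_real ((cmod \<omega>)\<^sup>2) * outer (e j) (e j) $ l $ m
     + cnj \<omega> * D (outer (e i) (e j)) $ l $ m + \<omega> * D (outer (e j) (e i)) $ l $ m"
  unfolding complex_norm_square outer_simps D_add D_cscale cscale_add cscale_cscale
  by (simp add: diag[folded e_def] cscale_def algebra_simps)

lemma coeff_zero:
  assumes "\<And>\<omega>. cmod \<omega> = 1 \<Longrightarrow> cnj \<omega> * a + \<omega> * b = 0"
  shows "a = 0 \<and> b = 0"
  using assms[of 1] assms[of \<i>] by (simp add: complex_eq_iff)

text \<open>For l different from i, the (l,l) entry of the image of the rank one matrix of e_i + t
  \<omega> e_j is t^2 d + t c, real and nonnegative for every real t. That forces c = 0, and varying
  \<omega> separates the two coefficients.\<close>

lemma D_off_diagonal_entry: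
  assumes ij: "i \<noteq> j"
  shows "D (outer (e i) (e j)) $ l $ l = 0"
proof -
  have main: "D (outer (e i) (e j)) $ l $ l = 0 \<and> D (outer (e j) (e i)) $ l $ l = 0"
    if ij: "i \<noteq> j" "l \<noteq> i" for i j
  proof (rule coeff_zero)
    fix \<omega> :: complex assume w: "cmod \<omega> = 1"
    define c where "c = cnj \<omega> * D (outer (e i) (e j)) $ l $ l + \<omega> * D (outer (e j) (e i)) $ l $ l"
    define d where "d = (if l = j then 1 else 0 :: real)"
    have val: "\<exists>r\<ge>0. of_real (t\<^sup>2 * d) + of_real t * c = complex_of_real r" for t
    proof -
      obtain y where y: "D (outer (e i + (of_real t * \<omega>) *s e j) (e i + (of_real t * \<omega>) *s e j)) = outer y y"
        using pres by blast
      have "outer y y $ l $ l = of_real (t\<^sup>2 * d) + of_real t * c"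
        unfolding y[symmetric] D_pair using ij w
        by (simp add: norm_mult outer_def e_nth c_def d_def algebra_simps)
      moreover have "outer y y $ l $ l = of_real ((cmod (y $ l))\<^sup>2)"
        unfolding complex_norm_square by (simp add: outer_def)
      ultimately show ?thesis by (intro exI[of _ "(cmod (y $ l))\<^sup>2"]) simp
    qed
    have "0 \<le> 2 * t * (Re c / 2) + t\<^sup>2 * d" for t
    proof -
      obtain r where "r \<ge> 0" "of_real (t\<^sup>2 * d) + of_real t * c = complex_of_real r" using val by blast
      from this(2) have "Re (of_real (t\<^sup>2 * d) + of_real t * c) = r" by simp
      thus ?thesis using \<open>r \<ge> 0\<close> by simp
    qed
    hence "Re c / 2 = 0" by (rule linear_term_zero)
    moreover obtain r where "of_real (1\<^sup>2 * d) + of_real 1 * c = complex_of_real r" using val[of 1] by blast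
    hence "Im (of_real (1\<^sup>2 * d) + of_real 1 * c) = 0" by simp
    ultimately show "c = 0" by (simp add: complex_eq_iff)
  qed
  show ?thesis using main[OF ij] main[of j i] ij by (cases "l = i") auto
qed

lemma D_diagonal: "D A $ l $ l = A $ l $ l"
proof -
  have "D A $ l $ l = (\<Sum>p\<in>UNIV. if p = (l,l) then A $ l $ l else 0)"
  proof (subst D_nth, rule sum.cong[OF refl])
    fix p :: "'n \<times> 'n"
    obtain i j where p: "p = (i,j)" by fastforce
    show "(case p of (i, j) \<Rightarrow> A $ i $ j * D (outer (e i) (e j)) $ l $ l) = (if p = (l,l) then A $ l $ l else 0)"
      using D_off_diagonal_entry[of i j l] diag[of i, folded e_def]
      by (cases "i = j") (auto simp: p outer_def e_nth)
  qed
  thus ?thesis by simp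
qed

text \<open>The squared moduli of the coordinates are the diagonal entries, which D keeps.\<close>

lemma pres_modulus: "\<exists>y. D (outer x x) = outer y y \<and> (\<forall>l. cmod (y $ l) = cmod (x $ l))"
proof -
  obtain y where y: "D (outer x x) = outer y y" using pres by blast
  have "cmod (y $ l) = cmod (x $ l)" for l
  proof -
    have "outer y y $ l $ l = outer x x $ l $ l" unfolding y[symmetric] by (rule D_diagonal)
    hence "complex_of_real ((cmod (y $ l))\<^sup>2) = of_real ((cmod (x $ l))\<^sup>2)"
      unfolding complex_norm_square by (simp add: outer_def)
    thus ?thesis unfolding of_real_eq_iff by (simp add: power2_eq_iff_nonneg)
  qed
  thus ?thesis using y by blast
qed

lemma D_outer_entry: "cmod (D (outer x x) $ l $ m) = cmod (x $ l) * cmod (x $ m)"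
  using pres_modulus[of x] by (auto simp: outer_def norm_mult)

text \<open>With c, the coefficients of A_lm and A_ml in the (l,m) entry of D A: b belongs to the
  direct form, c to the transposed one.\<close>

definition b :: "'n \<Rightarrow> 'n \<Rightarrow> complex" where "b l m = D (outer (e l) (e m)) $ l $ m"
definition c :: "'n \<Rightarrow> 'n \<Rightarrow> complex" where "c l m = D (outer (e m) (e l)) $ l $ m"

text \<open>The test vector e_i + \<omega> e_j vanishes at l or at m, and moduli of entries of the
  image are products of moduli of coordinates.\<close>

lemma D_support:
  assumes "i \<noteq> j" "l \<noteq> m" "(l,m) \<noteq> (i,j)" "(l,m) \<noteq> (j,i)"
  shows "D (outer (e i) (e j)) $ l $ m = 0"
proof -
  have "D (outer (e i) (e j)) $ l $ m = 0 \<and> D (outer (e j) (e i)) $ l $ m = 0"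
  proof (rule coeff_zero)
    fix \<omega> :: complex assume w: "cmod \<omega> = 1"
    have "(e i + \<omega> *s e j) $ l = 0 \<or> (e i + \<omega> *s e j) $ m = 0"
      using assms by (auto simp: e_nth)
    hence "D (outer (e i + \<omega> *s e j) (e i + \<omega> *s e j)) $ l $ m = 0"
      using D_outer_entry[of "e i + \<omega> *s e j" l m] by auto
    thus "cnj \<omega> * D (outer (e i) (e j)) $ l $ m + \<omega> * D (outer (e j) (e i)) $ l $ m = 0"
      unfolding D_pair using assms by (auto simp: outer_def e_nth split: if_splits)
  qed
  thus ?thesis by simp
qed

lemma D_entry:
  assumes lm: "l \<noteq> m"
  shows "D A $ l $ m = A $ l $ m * b l m + A $ m $ l * c l m"
proof -
  have "D A $ l $ m = (\<Sum>(i,j)\<in>{(l,m),(m,l)}. A $ i $ j * D (outer (e i) (e j)) $ l $ m)"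
  proof (subst D_nth, rule sum.mono_neutral_right)
    show "\<forall>p\<in>UNIV - {(l,m),(m,l)}. (case p of (i, j) \<Rightarrow> A $ i $ j * D (outer (e i) (e j)) $ l $ m) = 0"
    proof
      fix p assume p: "p \<in> UNIV - {(l,m),(m,l)}"
      obtain i j where ij: "p = (i,j)" by fastforce
      have "D (outer (e i) (e j)) $ l $ m = 0"
      proof (cases "i = j")
        case True
        thus ?thesis using diag[of i, folded e_def] lm by (auto simp: outer_def e_nth)
      next
        case False
        thus ?thesis using p ij lm by (intro D_support) auto
      qed
      thus "(case p of (i, j) \<Rightarrow> A $ i $ j * D (outer (e i) (e j)) $ l $ m) = 0" by (simp add: ij)
    qed
  qed auto
  thus ?thesis using lm by (simp add: b_def c_def)
qed

lemma bc_unimodular: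
  assumes lm: "l \<noteq> m" and w: "cmod \<omega> = 1"
  shows "cmod (cnj \<omega> * b l m + \<omega> * c l m) = 1"
proof -
  have "D (outer (e l + \<omega> *s e m) (e l + \<omega> *s e m)) $ l $ m = cnj \<omega> * b l m + \<omega> * c l m"
    unfolding D_entry[OF lm] using lm by (simp add: outer_def e_nth)
  thus ?thesis using D_outer_entry[of "e l + \<omega> *s e m" l m] lm w by (simp add: e_nth)
qed

text \<open>The phases 1, i and a primitive eighth root of unity in \<open>bc_unimodular\<close>
  give the hypotheses of \<open>orthogonal_sum_zero\<close>.\<close>

lemma bc_zero:
  assumes lm: "l \<noteq> m"
  shows "b l m * c l m = 0" "b l m \<noteq> 0 \<or> c l m \<noteq> 0"
proof -
  have 1: "cmod (b l m + c l m) = 1" using bc_unimodular[OF lm, of 1] by simp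
  have "cnj \<i> * b l m + \<i> * c l m = (- \<i>) * (b l m - c l m)" by (simp add: algebra_simps)
  hence "cmod (cnj \<i> * b l m + \<i> * c l m) = cmod (b l m - c l m)" by (simp add: norm_mult)
  hence 2: "cmod (b l m - c l m) = 1" using bc_unimodular[OF lm, of \<i>] by simp
  define \<omega> where "\<omega> = cis (- (pi/4))"
  have "cnj \<omega> = \<i> * \<omega>" by (simp add: \<omega>_def complex_eq_iff cos_45 sin_45)
  hence "cnj \<omega> * b l m + \<omega> * c l m = \<omega> * (\<i> * b l m + c l m)" by (simp add: algebra_simps)
  moreover have w: "cmod \<omega> = 1" by (simp add: \<omega>_def)
  ultimately have "cmod (cnj \<omega> * b l m + \<omega> * c l m) = cmod (\<i> * b l m + c l m)" by (simp add: norm_mult)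
  hence "cmod (\<i> * b l m + c l m) = 1" using bc_unimodular[OF lm w] by simp
  thus "b l m * c l m = 0" using 1 2 by (intro orthogonal_sum_zero) simp_all
  show "b l m \<noteq> 0 \<or> c l m \<noteq> 0" using 1 by auto
qed

text \<open>Images of rank one matrices are Hermitian. If the (l,m) entry were direct and the (m,l)
  entry transposed, symmetry would read \<omega> cnj b = cnj \<omega> c for all phases, which 1 and
  i contradict.\<close>

lemma b_sym:
  assumes lm: "l \<noteq> m" and b: "b l m \<noteq> 0"
  shows "b m l \<noteq> 0"
proof
  assume b0: "b m l = 0"
  have c0: "c l m = 0" using bc_zero(1)[OF lm] b by simp
  have "cnj (cnj \<omega> * b l m) = cnj \<omega> * c m l" if "cmod \<omega> = 1" for \<omega>
  proof -
    define x where "x = e l + \<omega> *s e m"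
    obtain y where y: "D (outer x x) = outer y y" using pres by blast
    have "D (outer x x) $ m $ l = cnj (D (outer x x) $ l $ m)" unfolding y by (simp add: outer_def)
    thus ?thesis unfolding D_entry[OF lm] D_entry[OF lm[symmetric]] b0 c0
      using lm by (simp add: x_def outer_def e_nth)
  qed
  from this[of 1] this[of \<i>] have "b l m = 0" by (simp add: complex_eq_iff) 
  thus False using b by simp
qed

text \<open>In \<open>outer y y\<close> with |y_m| = 1 the (l,m) and (m,p) entries multiply to the
  (l,p) entry. With phase \<omega> at coordinate m and 1 elsewhere, mixing direct and transposed
  entries would make the product vary while the (l,p) entry is constant.\<close>

lemma b_chain:
  assumes lm: "l \<noteq> m" and mp: "m \<noteq> p" and lp: "l \<noteq> p" and b: "b l m \<noteq> 0"
  shows "b m p \<noteq> 0"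
proof
  assume b0: "b m p = 0"
  have c0: "c l m = 0" using bc_zero(1)[OF lm] b by simp
  have cmp: "c m p \<noteq> 0" using bc_zero(2)[OF mp] b0 by simp
  have "b l m * c m p * (cnj \<omega> * cnj \<omega>) = b l p + c l p" if w: "cmod \<omega> = 1" for \<omega>
  proof -
    define x :: "complex^'n" where "x = (\<chi> i. if i = m then \<omega> else 1)"
    obtain y where y: "D (outer x x) = outer y y" "\<And>l. cmod (y $ l) = cmod (x $ l)"
      using pres_modulus[of x] by blast
    have ym: "cnj (y $ m) * y $ m = 1"
      using complex_norm_square[of "y $ m"] y(2)[of m] w by (simp add: x_def mult.commute)
    have "outer y y $ l $ m * outer y y $ m $ p = (cnj (y $ m) * y $ m) * outer y y $ l $ p"
      by (simp add: outer_def mult_ac)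
    hence "D (outer x x) $ l $ m * D (outer x x) $ m $ p = D (outer x x) $ l $ p"
      unfolding y(1) ym by simp
    thus ?thesis unfolding D_entry[OF lm] D_entry[OF mp] D_entry[OF lp] b0 c0
      using lm mp lp by (simp add: x_def outer_def mult_ac)
  qed
  from this[of 1] this[of \<i>] have "b l m * c m p = - (b l m * c m p)" by simp
  hence "b l m * c m p = 0" by simp
  thus False using b cmp by simp
qed

lemma b_all:
  assumes "l \<noteq> m" "b l m \<noteq> 0" "p \<noteq> q"
  shows "b p q \<noteq> 0"
proof -
  have step: "b j r \<noteq> 0" if "b i j \<noteq> 0" "i \<noteq> j" "j \<noteq> r" for i j r
    using b_sym[OF that(2,1)] b_chain[OF that(2,3) _ that(1)] by (cases "i = r") simp_all
  show ?thesis
  proof (cases "p = m")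
    case True
    thus ?thesis using step[OF assms(2,1)] assms(3) by simp
  next
    case False
    hence "b m p \<noteq> 0" using step[OF assms(2,1)] by simp
    thus ?thesis using step[of m p q] False assms(3) by simp
  qed
qed

text \<open>The image of the all-ones matrix records every b + c at once; since it has rank one, the
  phases factor as y_l cnj(y_m).\<close>

lemma standard_form:
  "\<exists>y. (\<forall>l. cmod (y $ l) = 1) \<and> ((\<forall>A l m. D A $ l $ m = y $ l * A $ l $ m * cnj (y $ m)) \<or>
     (\<forall>A l m. D A $ l $ m = y $ l * A $ m $ l * cnj (y $ m)))"
proof -
  define x :: "complex^'n" where "x = (\<chi> i. 1)"
  obtain y where y: "D (outer x x) = outer y y" "\<And>l. cmod (y $ l) = 1"
    using pres_modulus[of x] by (auto simp: x_def)
  have yy: "y $ l * (A $ l $ l * cnj (y $ l)) = D A $ l $ l" for A l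
    using complex_norm_square[of "y $ l"] y(2)[of l] by (simp add: D_diagonal mult_ac)
  have off: "y $ l * cnj (y $ m) = b l m + c l m" if "l \<noteq> m" for l m
    using arg_cong[OF y(1), of "\<lambda>M. M $ l $ m"] unfolding D_entry[OF that] by (simp add: outer_def x_def)
  consider "\<And>l m. l \<noteq> m \<Longrightarrow> c l m = 0" | "\<And>l m. l \<noteq> m \<Longrightarrow> b l m = 0"
    using b_all bc_zero(1) by (metis mult_eq_0_iff)
  thus ?thesis
  proof cases
    case 1
    have "D A $ l $ m = y $ l * A $ l $ m * cnj (y $ m)" for A l m
      using D_entry[of l m A] 1[of l m] off[of l m] yy by (cases "l = m") (auto simp: mult_ac)
    thus ?thesis using y(2) by blast
  next
    case 2
    have "D A $ l $ m = y $ l * A $ m $ l * cnj (y $ m)" for A l m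
      using D_entry[of l m A] 2[of l m] off[of l m] yy by (cases "l = m") (auto simp: mult_ac)
    thus ?thesis using y(2) by blast
  qed
qed

end

section \<open>From the normalised form to a unitary\<close>

lemma unitary_adj: "unitary U \<Longrightarrow> unitary (adj U)"
  by (simp add: unitary_def adj_adj)

lemma unitary_mult: "unitary U \<Longrightarrow> unitary V \<Longrightarrow> unitary (U ** V)"
proof -
  assume U: "unitary U" and V: "unitary V"
  have "adj V ** adj U ** (U ** V) = adj V ** (adj U ** U) ** V"
    and "U ** V ** (adj V ** adj U) = U ** (V ** adj V) ** adj U"
    by (simp_all add: matrix_mul_assoc)
  thus "unitary (U ** V)" using U V by (simp add: unitary_def adj_mult)
qed

lemma rank_one_preserver:
  fixes T :: "'n::finite cmat \<Rightarrow> 'n cmat"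
  assumes lin: "clinear_map T" and one: "T (mat 1) = mat 1"
    and pres: "\<And>x. norm x = 1 \<Longrightarrow> \<exists>y. norm y = 1 \<and> T (outer x x) = outer y y"
  shows "\<exists>U. unitary U \<and> ((\<forall>A. T A = adj U ** A ** U) \<or> (\<forall>A. T A = adj U ** transpose A ** U))"
proof -
  have T_add: "T (A + B) = T A + T B" and T_cscale: "T (cscale c A) = cscale c (T A)" for A B c
    using lin by (auto simp: clinear_map_def)
  have "\<exists>g. T (outer (axis i 1) (axis i 1)) = outer g g" for i
    using pres[of "axis i 1"] norm_axis by blast
  then obtain g where g: "\<And>i. T (outer (axis i 1) (axis i 1)) = outer (g i) (g i)" by metis
  \<comment> \<open>The images of the diagonal matrix units have the form
    \<open>outer (g i) (g i)\<close> and sum to the identity, which says that the matrix with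
    columns \<open>g i\<close> is unitary.\<close>
  define V :: "'n cmat" where "V = (\<chi> a i. g i $ a)"
  have "(\<Sum>i\<in>UNIV. outer (g i) (g i)) = mat 1"
    using clinear_sum[OF lin, of "\<lambda>i. outer (axis i 1) (axis i 1)" UNIV] one
    by (simp add: sum_outer_axis g)
  moreover have "V ** adj V = (\<Sum>i\<in>UNIV. outer (g i) (g i))"
    by (simp add: V_def matrix_matrix_mult_def adj_def outer_def vec_eq_iff)
  ultimately have VV: "V ** adj V = mat 1" by simp
  hence VV': "adj V ** V = mat 1" by (rule matrix_left_right_inverse[THEN iffD1])
  have V: "unitary V" using VV VV' by (simp add: unitary_def)
  have Vg: "adj V *v g i = axis i 1" for i
  proof -
    have "V *v axis i 1 = g i" by (simp add: vec_eq_iff mv_axis V_def)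
    thus ?thesis using VV' by (metis mv_assoc matrix_vector_mul_lid)
  qed
  define D where "D A = adj V ** T A ** V" for A
  have D_outer: "D A = outer (adj V *v y) (adj V *v y)" if "T A = outer y y" for A y
    by (simp add: D_def that mult_outer outer_mult)
  interpret rank_one_normalized D
  proof
    show "clinear_map D" by (simp add: clinear_map_def D_def T_add T_cscale mmult_simps)
    show "D (outer (axis i 1) (axis i 1)) = outer (axis i 1) (axis i 1)" for i
      using D_outer[OF g] by (simp add: Vg)
    show "\<exists>y. D (outer x x) = outer y y" for x
    proof (cases "x = 0")
      case True
      have "T (cscale 0 0) = cscale 0 (T 0)" by (rule T_cscale)
      thus ?thesis using True by (intro exI[of _ 0]) (simp add: D_def cscale_zero outer_simps mmult_simps)
    next
      case False
      then obtain u where u: "norm u = 1" "x = of_real (norm x) *s u" using ex_normalized by blast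
      obtain y where y: "T (outer u u) = outer y y" using pres[OF u(1)] by blast
      have "outer x x = cscale (of_real (norm x)) (cscale (of_real (norm x)) (outer u u))"
        by (subst u(2), subst (2) u(2)) (simp add: outer_simps)
      hence "T (outer x x) = outer (of_real (norm x) *s y) (of_real (norm x) *s y)"
        by (simp add: T_cscale y outer_simps)
      thus ?thesis using D_outer by blast
    qed
  qed
  obtain y where y: "\<And>l. cmod (y $ l) = 1"
    and form: "(\<forall>A l m. D A $ l $ m = y $ l * A $ l $ m * cnj (y $ m)) \<or>
     (\<forall>A l m. D A $ l $ m = y $ l * A $ m $ l * cnj (y $ m))"
    using standard_form by blast
  \<comment> \<open>The phases of \<open>standard_form\<close> as a diagonal unitary; with V they
    make up U.\<close>
  define W :: "'n cmat" where "W = (\<chi> l m. if l = m then y $ l else 0)"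
  have WA: "(W ** A ** adj W) $ l $ m = y $ l * A $ l $ m * cnj (y $ m)" for A l m
  proof -
    have "(\<Sum>i\<in>UNIV. (if l = i then y $ l else 0) * A $ i $ j) = y $ l * A $ l $ j" for j
    proof -
      have "(\<Sum>i\<in>UNIV. (if l = i then y $ l else 0) * A $ i $ j) = (\<Sum>i\<in>UNIV. if i = l then y $ l * A $ l $ j else 0)"
        by (rule sum.cong) auto
      thus ?thesis by simp
    qed
    hence "(W ** A ** adj W) $ l $ m = (\<Sum>j\<in>UNIV. y $ l * A $ l $ j * cnj (if m = j then y $ m else 0))"
      by (simp add: W_def matrix_matrix_mult_def adj_def)
    also have "\<dots> = (\<Sum>j\<in>UNIV. if j = m then y $ l * A $ l $ m * cnj (y $ m) else 0)"
      by (rule sum.cong) auto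
    finally show ?thesis by simp
  qed
  have "(W ** adj W) $ l $ m = mat 1 $ l $ m" for l m
    using WA[of "mat 1" l m, unfolded matrix_mul_rid] y[of l] complex_norm_square[of "y $ l"]
    by (auto simp: mat_def)
  hence "W ** adj W = mat 1" by (simp add: vec_eq_iff)
  hence W: "unitary W" unfolding unitary_def by (simp add: matrix_left_right_inverse)
  have T_D: "T A = V ** D A ** adj V" for A
  proof -
    have "V ** D A ** adj V = (V ** adj V) ** T A ** (V ** adj V)"
      unfolding D_def by (simp add: matrix_mul_assoc)
    thus ?thesis using VV by simp
  qed
  define U where "U = adj (V ** W)"
  have "unitary U" unfolding U_def by (intro unitary_adj unitary_mult V W)
  moreover have TU: "T A = adj U ** B ** U" if "D A = W ** B ** adj W" for A B
    unfolding T_D that U_def by (simp add: adj_adj adj_mult matrix_mul_assoc)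
  have "(\<forall>A. T A = adj U ** A ** U) \<or> (\<forall>A. T A = adj U ** transpose A ** U)"
    using form
  proof
    assume "\<forall>A l m. D A $ l $ m = y $ l * A $ l $ m * cnj (y $ m)"
    hence "D A = W ** A ** adj W" for A using WA by (simp add: vec_eq_iff)
    thus ?thesis using TU by blast
  next
    assume "\<forall>A l m. D A $ l $ m = y $ l * A $ m $ l * cnj (y $ m)"
    hence "D A = W ** transpose A ** adj W" for A using WA by (simp add: vec_eq_iff transpose_def)
    thus ?thesis using TU by blast
  qed
  ultimately show ?thesis by blast
qed

section \<open>Invariance of the k-numerical radius and the classification\<close>

text \<open>Conjugation by U permutes the rank k projections; the reverse inclusion is the same fact
  for the adjoint of U.\<close>

lemma kNR_conj:
  assumes U: "unitary U"
  shows "kNR k (adj U ** A ** U) = kNR k A"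
proof -
  have sub: "kNR k (adj U ** A ** U) \<subseteq> kNR k A" if U: "unitary U" for U A :: "'a cmat"
  proof
    fix z assume "z \<in> kNR k (adj U ** A ** U)"
    then obtain P where P: "is_proj k P" "z = mtrace (adj U ** A ** U ** P)" by (auto simp: kNR_def)
    define Q where "Q = U ** P ** adj U"
    have "Q ** Q = U ** P ** (adj U ** U) ** P ** adj U" by (simp add: Q_def matrix_mul_assoc)
    also have "\<dots> = U ** (P ** P) ** adj U" using U by (simp add: unitary_def matrix_mul_assoc)
    finally have "Q ** Q = Q" using is_projD(2)[OF P(1)] by (simp add: Q_def)
    moreover have "herm Q" using is_projD(1)[OF P(1)] by (simp add: Q_def adj_simps matrix_mul_assoc)
    moreover have "mtrace Q = mtrace (adj U ** U ** P)"
      unfolding Q_def using mtrace_mult_commute[of "U ** P" "adj U"] by (simp add: matrix_mul_assoc)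
    hence "mtrace Q = of_nat k" using U is_projD(3)[OF P(1)] by (simp add: unitary_def)
    ultimately have "is_proj k Q" by (intro is_projI)
    moreover have "z = mtrace (A ** Q)"
      unfolding P(2) Q_def using mtrace_mult_commute[of "adj U" "A ** U ** P"] by (simp add: matrix_mul_assoc)
    ultimately show "z \<in> kNR k A" by (auto simp: kNR_def)
  qed
  have "adj (adj U) ** (adj U ** A ** U) ** adj U = (U ** adj U) ** A ** (U ** adj U)"
    by (simp add: adj_adj matrix_mul_assoc)
  hence "adj (adj U) ** (adj U ** A ** U) ** adj U = A" using U by (simp add: unitary_def)
  thus ?thesis using sub[OF U, of A] sub[OF unitary_adj[OF U], of "adj U ** A ** U"] by auto
qed

lemma kNR_transpose: "kNR k (transpose A) = kNR k A"
proof -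
  have sub: "kNR k (transpose A) \<subseteq> kNR k A" for A :: "'a cmat"
  proof
    fix z assume "z \<in> kNR k (transpose A)"
    then obtain P where P: "is_proj k P" "z = mtrace (transpose A ** P)" by (auto simp: kNR_def)
    have tr: "mtrace (transpose B) = mtrace B" for B :: "'a cmat" by (simp add: mtrace_def transpose_def)
    have "adj (transpose P) = transpose (adj P)" by (simp add: adj_def transpose_def vec_eq_iff)
    moreover have "transpose P ** transpose P = transpose (P ** P)" by (simp add: matrix_transpose_mul)
    ultimately have "is_proj k (transpose P)"
      using is_projD[OF P(1)] by (intro is_projI) (simp_all add: tr)
    moreover have "z = mtrace (A ** transpose P)"
      using tr[of "transpose A ** P"] P(2) mtrace_mult_commute[of "transpose P" A]
      by (simp add: matrix_transpose_mul transpose_transpose)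
    ultimately show "z \<in> kNR k A" by (auto simp: kNR_def)
  qed
  show ?thesis using sub[of A] sub[of "transpose A"] by (simp add: transpose_transpose)
qed

text \<open>For n = 2k this replaces tr(AP) by tr(A(I - P)), and I - P again has rank k.\<close>

definition reflection :: "nat \<Rightarrow> 'n::finite cmat \<Rightarrow> 'n cmat" where
  "reflection k A = cscale (mtrace A / of_nat k) (mat 1) - A"

lemma mtrace_reflection:
  assumes "CARD('n::finite) = 2 * k"
  shows "mtrace (reflection k A) = mtrace (A :: 'n cmat)"
proof -
  have "k \<noteq> 0" using assms by (metis mult_0_right zero_less_card_finite less_irrefl)
  thus ?thesis using assms by (simp add: reflection_def mtrace_simps)
qed

lemma reflection_reflection:
  assumes "CARD('n::finite) = 2 * k"
  shows "reflection k (reflection k A) = (A :: 'n cmat)"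
  using mtrace_reflection[OF assms, of A] by (simp add: reflection_def)

lemma kNR_reflection:
  assumes n: "CARD('n::finite) = 2 * k"
  shows "kNR k (reflection k A) = kNR k (A :: 'n cmat)"
proof -
  have k: "k \<noteq> 0" using assms by (metis mult_0_right zero_less_card_finite less_irrefl)
  have sub: "kNR k (reflection k A) \<subseteq> kNR k A" for A :: "'n cmat"
  proof
    fix z assume "z \<in> kNR k (reflection k A)"
    then obtain P where P: "is_proj k P" "z = mtrace (reflection k A ** P)" by (auto simp: kNR_def)
    have "is_proj k (mat 1 - P)" using proj_compl[OF P(1)] n by simp
    moreover have "z = mtrace (A ** (mat 1 - P))"
      using P k is_projD(3)[OF P(1)] by (simp add: reflection_def mmult_simps mtrace_simps)
    ultimately show "z \<in> kNR k A" by (auto simp: kNR_def)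
  qed
  show ?thesis using sub[of A] sub[of "reflection k A"] by (simp add: reflection_reflection[OF n])
qed

section \<open>Standard maps and their effect on the radius\<close>

lemma att_cscale: "att k A R \<Longrightarrow> att k (cscale c A) R"
  by (auto simp: att_def mmult_simps mtrace_simps norm_mult mult_left_mono)

lemma kradius_cscale:
  fixes A :: "'n::finite cmat"
  assumes k: "1 \<le> k" "k < CARD('n)"
  shows "kradius k (cscale c A) = cmod c * kradius k A"
proof -
  obtain R where R: "att k A R" using att_ex[OF k] by blast
  show ?thesis
    using att_kradius[OF R] att_kradius[OF att_cscale[OF R, of c]]
    by (simp add: mmult_simps mtrace_simps norm_mult)
qed

text \<open>Condition (c), spelled exactly as in the final theorem so that unfolding identifies the
  two.\<close>

definition standard_map :: "nat \<Rightarrow> ('n::finite cmat \<Rightarrow> 'n cmat) \<Rightarrow> bool" where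
  "standard_map k T \<longleftrightarrow> (\<exists>\<mu> U. \<mu> \<noteq> 0 \<and> unitary U \<and>
                ((\<forall>A. cscale \<mu> (T A) = adj U ** A ** U)
               \<or> (\<forall>A. cscale \<mu> (T A) = adj U ** transpose A ** U)
               \<or> (CARD('n) = 2 * k \<and> CARD('n) > 2 \<and>
                   ((\<forall>A. cscale \<mu> (T A) = cscale (mtrace A / of_nat k) (mat 1) - adj U ** A ** U)
                  \<or> (\<forall>A. cscale \<mu> (T A) = cscale (mtrace A / of_nat k) (mat 1) - adj U ** transpose A ** U)))))"

lemma mtrace_conj: "unitary U \<Longrightarrow> mtrace (adj U ** A ** U) = mtrace A"
  using mtrace_mult_commute[of "adj U ** A" U] by (simp add: matrix_mul_assoc unitary_def)

lemma mtrace_transpose: "mtrace (transpose A) = mtrace A"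
  by (simp add: mtrace_def transpose_def)

lemma standard_map_radius:
  fixes T :: "'n::finite cmat \<Rightarrow> 'n cmat"
  assumes k: "1 \<le> k" "k < CARD('n)" and T: "standard_map k T"
  shows "\<exists>r. r \<noteq> 0 \<and> (\<forall>A. r * kradius k (T A) = kradius k A)"
proof -
  obtain \<mu> U where mu: "\<mu> \<noteq> 0" and U: "unitary U" and
    form: "(\<forall>A. cscale \<mu> (T A) = adj U ** A ** U)
               \<or> (\<forall>A. cscale \<mu> (T A) = adj U ** transpose A ** U)
               \<or> (CARD('n) = 2 * k \<and>
                   ((\<forall>A. cscale \<mu> (T A) = cscale (mtrace A / of_nat k) (mat 1) - adj U ** A ** U)
                  \<or> (\<forall>A. cscale \<mu> (T A) = cscale (mtrace A / of_nat k) (mat 1) - adj U ** transpose A ** U)))"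
    using T unfolding standard_map_def by blast
  have "kNR k (cscale \<mu> (T A)) = kNR k A" for A
    using form
  proof (elim disjE conjE)
    assume n: "CARD('n) = 2 * k"
    { assume "\<forall>A. cscale \<mu> (T A) = cscale (mtrace A / of_nat k) (mat 1) - adj U ** A ** U"
      hence "cscale \<mu> (T A) = reflection k (adj U ** A ** U)" by (simp add: reflection_def mtrace_conj[OF U])
      thus ?thesis by (simp add: kNR_reflection[OF n] kNR_conj[OF U]) }
    { assume "\<forall>A. cscale \<mu> (T A) = cscale (mtrace A / of_nat k) (mat 1) - adj U ** transpose A ** U"
      hence "cscale \<mu> (T A) = reflection k (adj U ** transpose A ** U)"
        by (simp add: reflection_def mtrace_conj[OF U] mtrace_transpose)
      thus ?thesis by (simp add: kNR_reflection[OF n] kNR_conj[OF U] kNR_transpose) }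
  qed (simp_all add: kNR_conj[OF U] kNR_transpose)
  hence "cmod \<mu> * kradius k (T A) = kradius k A" for A
    unfolding kradius_cscale[OF k, symmetric] by (simp add: kradius_def)
  thus ?thesis using mu by (intro exI[of _ "cmod \<mu>"]) simp
qed

lemma parallel_preserver_unital_standard:
  assumes "parallel_preserver k (T :: 'n::finite cmat \<Rightarrow> 'n cmat)"
  shows "standard_map k T"
proof -
  interpret parallel_preserver k T by (rule assms)
  show ?thesis
    using T_outer_uniform
  proof
    assume "\<forall>x. norm x = 1 \<longrightarrow> (\<exists>y. norm y = 1 \<and> T (outer x x) = outer y y)"
    then obtain U where "unitary U" "(\<forall>A. T A = adj U ** A ** U) \<or> (\<forall>A. T A = adj U ** transpose A ** U)"
      using rank_one_preserver[OF lin T_one] by blast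
    thus ?thesis unfolding standard_map_def
      by (intro exI[of _ 1] exI[of _ U]) (auto simp: cscale_one)
  next
    assume "CARD('n) > 2 \<and> (\<forall>x. norm x = 1 \<longrightarrow> (\<exists>y. norm y = 1 \<and> T (outer x x) = (1 / real k) *\<^sub>R mat 1 - outer y y))"
    hence n2: "CARD('n) > 2" and T: "\<And>x. norm x = 1 \<Longrightarrow> \<exists>y. norm y = 1 \<and> T (outer x x) = (1 / real k) *\<^sub>R mat 1 - outer y y"
      by auto
    have tr: "mtrace (T (outer x x)) = of_nat CARD('n) / of_nat k - 1" if x: "norm x = 1" for x
      using T[OF x] by (auto simp: mtrace_simps cip_self)
    \<comment> \<open>Summing traces over the coordinate projections gives n = n (n/k - 1), which
      forces n = 2k.\<close>
    have "of_nat CARD('n) = mtrace (T (mat 1))" by (simp add: T_one mtrace_simps)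
    also have "\<dots> = (\<Sum>i\<in>UNIV. mtrace (T (outer (axis i 1) (axis i 1))))"
    proof -
      have "mtrace (\<Sum>i\<in>I. g i) = (\<Sum>i\<in>I. mtrace (g i :: 'n cmat))" for g and I :: "'n set"
        by (induction I rule: infinite_finite_induct) (simp_all add: mtrace_simps)
      thus ?thesis unfolding sum_outer_axis[symmetric] clinear_sum[OF lin] by simp
    qed
    also have "\<dots> = of_nat CARD('n) * (of_nat CARD('n) / of_nat k - 1)"
      by (simp add: tr norm_axis)
    finally have "of_nat CARD('n) / of_nat k - 1 = (1 :: complex)" using n2 by simp
    hence "of_nat CARD('n) = (of_nat (2 * k) :: complex)" using k by (simp add: field_simps)
    hence n: "CARD('n) = 2 * k" using of_nat_eq_iff by blast
    \<comment> \<open>Reflection is an involution, and it turns I/k - \<open>outer y y\<close>,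
      which has trace 1, into \<open>outer y y\<close>.\<close>
    define T' where "T' A = reflection k (T A)" for A
    have "clinear_map T'"
      unfolding clinear_map_def T'_def reflection_def T_add T_cscale
      by (simp add: mtrace_simps cscale_diff cscale_cscale add_divide_distrib cscale_plus)
    moreover have "T' (mat 1) = mat 1"
    proof -
      have "mtrace (mat 1 :: 'n cmat) / of_nat k = 2" using n k by (simp add: mtrace_simps)
      thus ?thesis by (simp add: T'_def T_one reflection_def) (simp add: vec_eq_iff cscale_def)
    qed
    moreover have "\<exists>y. norm y = 1 \<and> T' (outer x x) = outer y y" if x: "norm x = 1" for x
    proof -
      obtain y where y: "norm y = 1" "T (outer x x) = (1 / real k) *\<^sub>R mat 1 - outer y y" using T[OF x] by blast
      have "mtrace (T (outer x x)) = 1" using tr[OF x] n k by simp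
      hence "T' (outer x x) = cscale (of_real (1 / real k)) (mat 1) - T (outer x x)" by (simp add: T'_def reflection_def)
      also have "\<dots> = outer y y" unfolding cscale_of_real y(2) by simp
      finally show ?thesis using y(1) by blast
    qed
    ultimately obtain U where U: "unitary U" and
      form: "(\<forall>A. T' A = adj U ** A ** U) \<or> (\<forall>A. T' A = adj U ** transpose A ** U)"
      using rank_one_preserver by blast
    have T_T': "T A = reflection k (T' A)" for A by (simp add: T'_def reflection_reflection[OF n])
    have "(\<forall>A. T A = cscale (mtrace A / of_nat k) (mat 1) - adj U ** A ** U) \<or>
       (\<forall>A. T A = cscale (mtrace A / of_nat k) (mat 1) - adj U ** transpose A ** U)"
      using form
      by (elim disjE) (simp_all add: T_T' reflection_def mtrace_conj[OF U] mtrace_transpose)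
    thus ?thesis unfolding standard_map_def using U n n2
      by (intro exI[of _ 1] exI[of _ U]) (auto simp: cscale_one)
  qed
qed

section \<open>Reduction to T(I) = I\<close>

lemma att_proj_unique:
  fixes P R :: "'n::finite cmat"
  assumes P: "is_proj k P" and R: "att k P R"
  shows "R = P"
proof -
  have pR: "is_proj k R" using R by (simp add: att_def)
  have "cmod (mtrace (P ** P)) \<le> cmod (mtrace (P ** R))" using R P by (simp add: att_def)
  hence "real k \<le> P \<bullet> R"
    using mtrace_herm[of P R] is_projD[OF P] is_projD[OF pR] proj_inner_nonneg[OF P pR] by simp
  thus ?thesis by (rule proj_inner_eq[OF P pR])
qed

text \<open>The identity attains its radius at every projection, hence is parallel to a preimage Z
  of any projection P. Now T Z = P attains its radius only at P, so T(I) attains its radius at every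
  P and \<open>const_modulus_scalar\<close> applies.\<close>

lemma parallel_preserver_one:
  fixes T :: "'n::finite cmat \<Rightarrow> 'n cmat"
  assumes k: "1 \<le> k" "k < CARD('n)" and lin: "clinear_map T" and bij: "bij T"
    and pres: "\<And>A B. kparallel k A B \<Longrightarrow> kparallel k (T A) (T B)"
  shows "\<exists>c. c \<noteq> 0 \<and> T (mat 1) = smat c"
proof -
  have att1: "att k (mat 1 :: 'n cmat) R" if "is_proj k R" for R
    using that by (auto simp: att_def is_projD(3))
  have "att k (T (mat 1)) P" if P: "is_proj k P" for P
  proof -
    obtain Z where Z: "T Z = P" using bij by (metis bij_pointE)
    obtain R where "att k Z R" using att_ex[OF k] by blast
    hence "kparallel k (mat 1) Z" using att1 kparallel_iff[OF k] by (metis att_def)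
    hence "kparallel k (T (mat 1)) P" using pres Z by metis
    thus ?thesis using att_proj_unique[OF P] kparallel_iff[OF k] by metis
  qed
  hence "cmod (mtrace (T (mat 1) ** P)) = kradius k (T (mat 1))" if "is_proj k P" for P
    using att_kradius that by metis
  then obtain c where c: "T (mat 1) = smat c" using const_modulus_scalar[OF k] by blast
  have "c \<noteq> 0"
  proof
    assume "c = 0"
    have "T (cscale 0 (mat 1)) = cscale 0 (T (mat 1))" using lin unfolding clinear_map_def by blast
    hence "T 0 = T (mat 1)" using c \<open>c = 0\<close> by (simp add: cscale_zero)
    hence "0 = (mat 1 :: 'n cmat)" using bij by (metis bij_pointE)
    thus False using mat_one_nonzero by metis
  qed
  thus ?thesis using c by blast
qed

lemma parallel_preserver_standard:
  fixes T :: "'n::finite cmat \<Rightarrow> 'n cmat"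
  assumes k: "1 \<le> k" "k < CARD('n)" and lin: "clinear_map T" and bij: "bij T"
    and pres: "\<And>A B. kparallel k A B \<Longrightarrow> kparallel k (T A) (T B)"
  shows "standard_map k T"
proof -
  obtain c where c: "c \<noteq> 0" "T (mat 1) = smat c" using parallel_preserver_one[OF assms] by blast
  define T1 where "T1 A = cscale (1 / c) (T A)" for A
  have "parallel_preserver k T1"
  proof
    show "1 \<le> k" "k < CARD('n)" by (rule k)+
    show "clinear_map T1" using lin by (simp add: clinear_map_def T1_def cscale_add cscale_cscale mult.commute)
    show "T1 (mat 1) = mat 1" using c by (simp add: T1_def cscale_cscale cscale_one)
    have "T1 = cscale (1 / c) \<circ> T" by (simp add: T1_def fun_eq_iff)
    moreover have "bij (cscale (1 / c) :: 'n cmat \<Rightarrow> 'n cmat)"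
      by (rule bij_betw_byWitness[of _ "cscale c"]) (use c in \<open>auto simp: cscale_cscale cscale_one\<close>)
    ultimately show "bij T1" using bij_comp[OF bij] by simp
    fix A B :: "'n cmat"
    assume "kparallel k A B"
    thus "kparallel k (T1 A) (T1 B)"
      using pres[of A B] att_cscale unfolding kparallel_iff[OF k] T1_def by blast
  qed
  hence "standard_map k T1" by (rule parallel_preserver_unital_standard)
  then obtain \<mu> U where mu: "\<mu> \<noteq> 0" and U: "unitary U" and
    form: "(\<forall>A. cscale \<mu> (T1 A) = adj U ** A ** U)
               \<or> (\<forall>A. cscale \<mu> (T1 A) = adj U ** transpose A ** U)
               \<or> (CARD('n) = 2 * k \<and> CARD('n) > 2 \<and>
                   ((\<forall>A. cscale \<mu> (T1 A) = cscale (mtrace A / of_nat k) (mat 1) - adj U ** A ** U)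
                  \<or> (\<forall>A. cscale \<mu> (T1 A) = cscale (mtrace A / of_nat k) (mat 1) - adj U ** transpose A ** U)))"
    unfolding standard_map_def by blast
  have "cscale \<mu> (T1 A) = cscale (\<mu> / c) (T A)" for A by (simp add: T1_def cscale_cscale)
  moreover have "\<mu> / c \<noteq> 0" using mu c by simp
  ultimately show ?thesis using U form unfolding standard_map_def by metis
qed

text \<open>The phase in the definition of parallelism is absorbed into B, making a TEA pair, and
  linearity carries it through T.\<close>

lemma kTEA_imp_kparallel:
  fixes T :: "'n::finite cmat \<Rightarrow> 'n cmat"
  assumes k: "1 \<le> k" "k < CARD('n)" and lin: "clinear_map T"
    and pres: "\<And>A B. kTEA k A B \<Longrightarrow> kTEA k (T A) (T B)" and AB: "kparallel k A B"
  shows "kparallel k (T A) (T B)"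
proof -
  obtain \<mu> where mu: "cmod \<mu> = 1" "kradius k (A + cscale \<mu> B) = kradius k A + kradius k B"
    using AB by (auto simp: kparallel_def)
  have "kTEA k A (cscale \<mu> B)" using mu by (simp add: kTEA_def kradius_cscale[OF k])
  from pres[OF this] have "kTEA k (T A) (cscale \<mu> (T B))" using lin by (simp add: clinear_map_def)
  thus ?thesis using mu by (auto simp: kparallel_def kTEA_def kradius_cscale[OF k])
qed

lemma standard_map_kTEA:
  fixes T :: "'n::finite cmat \<Rightarrow> 'n cmat"
  assumes k: "1 \<le> k" "k < CARD('n)" and lin: "clinear_map T" and T: "standard_map k T" and AB: "kTEA k A B"
  shows "kTEA k (T A) (T B)"
proof -
  obtain r where r: "r \<noteq> 0" "\<And>A. r * kradius k (T A) = kradius k A"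
    using standard_map_radius[OF k T] by blast
  have "r * kradius k (T A + T B) = r * (kradius k (T A) + kradius k (T B))"
  proof -
    have "T (A + B) = T A + T B" using lin by (simp add: clinear_map_def)
    hence "r * kradius k (T A + T B) = kradius k A + kradius k B"
      using AB r(2)[of "A + B"] by (simp add: kTEA_def)
    thus ?thesis by (simp add: distrib_left r(2))
  qed
  thus ?thesis using r(1) by (simp add: kTEA_def)
qed

theorem theorem1p1:
  fixes T :: "'n::finite cmat \<Rightarrow> 'n cmat" and k :: nat
  assumes "CARD('n) \<ge> 2" and "1 \<le> k" and "k < CARD('n)"
    and "clinear_map T" and "bij T"
  shows "((\<forall>A B. kparallel k A B \<longrightarrow> kparallel k (T A) (T B))
          \<longleftrightarrow> (\<forall>A B. kTEA k A B \<longrightarrow> kTEA k (T A) (T B)))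
       \<and> ((\<forall>A B. kTEA k A B \<longrightarrow> kTEA k (T A) (T B))
          \<longleftrightarrow> (\<exists>\<mu> U. \<mu> \<noteq> 0 \<and> unitary U \<and>
                ((\<forall>A. cscale \<mu> (T A) = adj U ** A ** U)
               \<or> (\<forall>A. cscale \<mu> (T A) = adj U ** transpose A ** U)
               \<or> (CARD('n) = 2 * k \<and> CARD('n) > 2 \<and>
                   ((\<forall>A. cscale \<mu> (T A) = cscale (mtrace A / of_nat k) (mat 1) - adj U ** A ** U)
                  \<or> (\<forall>A. cscale \<mu> (T A) = cscale (mtrace A / of_nat k) (mat 1) - adj U ** transpose A ** U))))))"
proof -
  note k = assms(2,3) and lin = assms(4)
  have "(\<forall>A B. kTEA k A B \<longrightarrow> kTEA k (T A) (T B)) \<Longrightarrow> (\<forall>A B. kparallel k A B \<longrightarrow> kparallel k (T A) (T B))"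
    using kTEA_imp_kparallel[OF k lin] by blast
  moreover have "(\<forall>A B. kparallel k A B \<longrightarrow> kparallel k (T A) (T B)) \<Longrightarrow> standard_map k T"
    using parallel_preserver_standard[OF k lin assms(5)] by blast
  moreover have "standard_map k T \<Longrightarrow> (\<forall>A B. kTEA k A B \<longrightarrow> kTEA k (T A) (T B))"
    using standard_map_kTEA[OF k lin] by blast
  ultimately show ?thesis unfolding standard_map_def by argo
qed

end
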